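(* The Lindelöf Hypothesis is true if and only if, for every $k\in\mathbb{N}$, the functions $\phi_{N,k}(x)=e^{-x}\sum_{n=0}^{N}\frac{(-1)^n\ell_{n,k}}{n!}x^n$ converge to $\phi_k$ in $L^2(\mathbb{R}_+)$ as $N\to\infty$.
   Context: $J_0$ is the Bessel function of the first kind of order $0$. $d_k(n)$ is the number of ordered factorizations of $n$ into $k$ factors; $\lambda_{j,k}$ are defined by $(s-1)^k\zeta^k(s)=\sum_{j\ge0}\frac{\lambda_{j,k}}{j!}(s-1)^j$ for $|s-1|\le1$; $a_{j,k}=(-1)^{k-1-j}\sum_{i=0}^{k-1-j}(-1)^i\frac{\lambda_{i,k}}{i!}$, $P_k(X)=\sum_{j=0}^{k-1}\frac{a_{j,k}}{j!}X^j$, $\Delta_k(x)=\sum_{1\le n\le x}d_k(n)-xP_k(\log x)$; $\ell_{n,k}=(-1)^n\sum_{j=1}^n\binom{n-1}{j-1}\frac{\lambda_{j+k,k}}{(j+k)!}$ for $n\ge1$, $\ell_{0,k}=(-1)^k\sum_{j=0}^{k}(-1)^j\frac{\lambda_{j,k}}{j!}$. $\phi_k(x)=\int_1^\infty\Delta_k(r)J_0(2\sqrt{x\log r})\,r^{-2}dr$ for $x\ge0$. The Lindelöf Hypothesis is the statement $\zeta(\frac12+it)=O(|t|^\varepsilon)$ for every $\varepsilon>0$. *)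

theory Defs
  imports "HOL-Complex_Analysis.Complex_Analysis" "HOL-Library.Landau_Symbols"
begin

text \<open>Riemann zeta function: the (unique) holomorphic function on the plane minus 1
  given by the Dirichlet series for Re s > 1 (analytic continuation).\<close>
definition zeta :: "complex \<Rightarrow> complex" where
  "zeta = (SOME f. f holomorphic_on (- {1}) \<and>
      (\<forall>s. 1 < Re s \<longrightarrow> (\<lambda>n. 1 / (of_nat (Suc n)) powr s) sums f s))"

definition lindelof_hypothesis :: bool where
  "lindelof_hypothesis \<longleftrightarrow>
     (\<forall>\<epsilon>>0. (\<lambda>t::real. norm (zeta (Complex (1/2) t))) \<in> O[at_infinity](\<lambda>t. \<bar>t\<bar> powr \<epsilon>))"

definition bessel_J0 :: "real \<Rightarrow> real" where
  "bessel_J0 x = (\<Sum>m. (-1) ^ m * (x / 2) ^ (2 * m) / (fact m) ^ 2)"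

definition dk :: "nat \<Rightarrow> nat \<Rightarrow> nat" where
  "dk k n = card {xs :: nat list. length xs = k \<and> prod_list xs = n}"

text \<open>The entire function (s-1)^k zeta(s)^k (removable singularity at 1 filled in).\<close>
definition zeta_pow_reg :: "nat \<Rightarrow> complex \<Rightarrow> complex" where
  "zeta_pow_reg k s = (if s = 1 then 1 else (s - 1) ^ k * zeta s ^ k)"

definition lam :: "nat \<Rightarrow> nat \<Rightarrow> complex" where
  "lam j k = (deriv ^^ j) (zeta_pow_reg k) 1"

definition a_coef :: "nat \<Rightarrow> nat \<Rightarrow> complex" where
  "a_coef j k = (-1) ^ (k - 1 - j) * (\<Sum>i=0..k - 1 - j. (-1) ^ i * lam i k / fact i)"

definition P_poly :: "nat \<Rightarrow> real \<Rightarrow> complex" where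
  "P_poly k X = (\<Sum>j=0..k - 1. a_coef j k / fact j * of_real X ^ j)"

definition Delta :: "nat \<Rightarrow> real \<Rightarrow> complex" where
  "Delta k x = of_nat (\<Sum>n=1..nat \<lfloor>x\<rfloor>. dk k n) - of_real x * P_poly k (ln x)"

definition ell :: "nat \<Rightarrow> nat \<Rightarrow> complex" where
  "ell n k = (if n = 0 then (-1) ^ k * (\<Sum>j=0..k. (-1) ^ j * lam j k / fact j)
              else (-1) ^ n * (\<Sum>j=1..n. of_nat ((n - 1) choose (j - 1)) * lam (j + k) k / fact (j + k)))"

definition phi :: "nat \<Rightarrow> real \<Rightarrow> complex" where
  "phi k x = (LBINT r:{1..}. Delta k r * of_real (bessel_J0 (2 * sqrt (x * ln r))) / of_real (r ^ 2))"

definition phi_N :: "nat \<Rightarrow> nat \<Rightarrow> real \<Rightarrow> complex" where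
  "phi_N N k x = of_real (exp (- x)) * (\<Sum>n=0..N. (-1) ^ n * ell n k / fact n * of_real x ^ n)"

end

theory Submission
  imports Defs "HOL-Probability.Distributions"
begin

text \<open>
  Write \<open>c\<^sub>n = (-1)\<^sup>n \<ell>\<^sub>n\<^sub>,\<^sub>k\<close>. Let \<open>F\<close> be \<open>\<zeta>(s)\<^sup>k / s\<close> minus its principal part at \<open>s = 1\<close>; it is the
  Mellin transform of \<open>\<Delta>\<^sub>k\<close>. Under \<open>s = 1 / (1 - z)\<close> the half-plane \<open>Re s > 1/2\<close> becomes the unit disc
  and \<open>s F(s) = \<Sum>\<^sub>n c\<^sub>n z\<^sup>n\<close>.

  If the \<open>\<phi>\<^sub>N\<^sub>,\<^sub>k\<close> converge in \<open>L\<^sup>2\<close>, then \<open>\<phi>\<^sub>N\<^sub>,\<^sub>k - \<phi>\<^sub>N\<^sub>-\<^sub>1\<^sub>,\<^sub>k \<rightarrow> 0\<close> already gives \<open>c\<^sub>n = O(n)\<close>, so on every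
  line \<open>Re s = 1/2 + \<delta>\<close> the function \<open>\<zeta>(s)\<^sup>k\<close> grows at most like \<open>\<bar>t\<bar>\<^sup>4\<close>, with an exponent that does not depend
  on \<open>k\<close>. Taking \<open>k\<close> large and moving to the critical line by convexity yields the Lindeloef Hypothesis.

  Conversely, an elementary bound \<open>\<Delta>\<^sub>k(r) = O(r powr (1 - \<delta>))\<close> makes all moments \<open>\<integral> \<Delta>\<^sub>k(r) (ln r)\<^sup>m r\<^sup>-\<^sup>2 dr\<close> converge; they
  are the Taylor coefficients of \<open>F\<close> at \<open>1\<close>, whence \<open>\<phi>\<^sub>k(x) = \<Sum>\<^sub>n c\<^sub>n e\<^sub>n(x)\<close> pointwise with the Poisson weights
  \<open>e\<^sub>n(x) = exp (-x) x\<^sup>n / n!\<close>. The Lindeloef Hypothesis puts \<open>s F(s)\<close> into the Hardy space \<open>H\<^sup>2\<close> of the disc, so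
  \<open>\<Sum> \<bar>c\<^sub>n\<bar>\<^sup>2 < \<infinity>\<close>. As \<open>\<Sum>\<^sub>n e\<^sub>n(x) = 1\<close> and \<open>\<integral> e\<^sub>n = 1\<close>, the Cauchy-Schwarz inequality bounds the squared
  \<open>L\<^sup>2\<close> distance from \<open>\<phi>\<^sub>N\<^sub>,\<^sub>k\<close> to \<open>\<phi>\<^sub>k\<close> by the tail \<open>\<Sum>\<^sub>n\<^sub>>\<^sub>N \<bar>c\<^sub>n\<bar>\<^sup>2\<close>.
\<close>

section \<open>Analytic continuation of the zeta function\<close>

definition real_zeta :: "real \<Rightarrow> real" where
  "real_zeta a = (\<Sum>n. real (Suc n) powr (- a))"

lemma summable_Suc_powr: "1 < a \<Longrightarrow> summable (\<lambda>n. real (Suc n) powr (- a))"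
  by (subst summable_Suc_iff) (simp add: summable_real_powr_iff)

lemma real_zeta_nonneg: "1 < a \<Longrightarrow> 0 \<le> real_zeta a"
  unfolding real_zeta_def by (intro suminf_nonneg summable_Suc_powr) auto

lemma real_zeta_antimono: "1 < a \<Longrightarrow> a \<le> b \<Longrightarrow> real_zeta b \<le> real_zeta a"
  unfolding real_zeta_def by (intro suminf_le summable_Suc_powr powr_mono) auto

lemma norm_suminf_le_real_zeta:
  fixes f :: "nat \<Rightarrow> 'a :: banach"
  assumes "1 < a" "\<And>n. norm (f n) \<le> real (Suc n) powr (- a)"
  shows "norm (suminf f) \<le> real_zeta a"
  unfolding real_zeta_def using assms by (intro norm_suminf_le summable_Suc_powr)

lemma norm_of_real_powr: "0 \<le> y \<Longrightarrow> norm (of_real y powr s :: complex) = y powr Re s"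
  by (simp add: norm_powr_real_powr)

lemma of_real_powr_has_vector_derivative:
  fixes c x :: real and s :: complex
  assumes "0 < c + x"
  shows "((\<lambda>x. of_real (c + x) powr s) has_vector_derivative s * of_real (c + x) powr (s - 1)) (at x within A)"
proof -
  have "((\<lambda>x. of_real (c + x)) has_vector_derivative complex_of_real 1) (at x within A)"
    by (intro has_vector_derivative_of_real) (auto intro!: derivative_eq_intros)
  moreover have "((\<lambda>z. z powr s) has_field_derivative s * of_real (c + x) powr (s - 1))
      (at (of_real (c + x)) within (\<lambda>x. of_real (c + x)) ` A)"
    using assms by (intro has_field_derivative_at_within[OF has_field_derivative_powr]) (simp add: complex_nonpos_Reals_iff)
  ultimately have "((\<lambda>z. z powr s) \<circ> (\<lambda>x. of_real (c + x)) has_vector_derivative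
      complex_of_real 1 * (s * of_real (c + x) powr (s - 1))) (at x within A)"
    by (rule field_vector_diff_chain_within)
  thus ?thesis by (simp only: o_def of_real_1 mult_1_left)
qed

definition powr_mean :: "(real \<Rightarrow> real) \<Rightarrow> nat \<Rightarrow> complex \<Rightarrow> complex" where
  "powr_mean p n s = integral {0..1} (\<lambda>x. of_real (p x) * of_real (real (Suc n) + x) powr (-s))"

lemma powr_mean_integrable:
  assumes "continuous_on {0..1} p"
  shows "(\<lambda>x. complex_of_real (p x) * of_real (real (Suc n) + x) powr s) integrable_on {0..1}"
  by (intro integrable_continuous_real continuous_intros assms) (auto simp: complex_eq_iff)

lemma powr_mean_holomorphic:
  assumes "continuous_on {0..1} p"
  shows "powr_mean p n holomorphic_on UNIV"
proof -
  let ?b = "\<lambda>x. complex_of_real (real (Suc n) + x)"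
  have base_nz: "?b x \<noteq> 0" if "x \<in> cbox 0 1" for x
    using that by (auto simp: complex_eq_iff)
  have "(\<lambda>s. integral (cbox 0 1) (\<lambda>x. of_real (p x) * ?b x powr (-s))) holomorphic_on UNIV"
  proof (rule leibniz_rule_holomorphic[where fx = "\<lambda>s x. of_real (p x) * (- Ln (?b x) * ?b x powr (-s))"])
    show "continuous_on (UNIV \<times> cbox 0 1) (\<lambda>(s, x). of_real (p x) * (- Ln (?b x) * ?b x powr (-s)))"
      unfolding case_prod_beta
      by (intro continuous_intros continuous_on_compose2[OF assms]) (auto simp: complex_eq_iff complex_nonpos_Reals_iff)
    show "((\<lambda>s. of_real (p x) * ?b x powr (-s)) has_field_derivative of_real (p x) * (- Ln (?b x) * ?b x powr (-s))) (at s within UNIV)"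
      if "x \<in> cbox 0 1" for s x
    proof -
      have "((\<lambda>s. ?b x powr (-s)) has_field_derivative (- 1) * (Ln (?b x) * ?b x powr (-s))) (at s)"
        using DERIV_chain2[OF has_field_derivative_powr_right[OF base_nz[OF that]] DERIV_minus[OF DERIV_ident]]
        by (simp only: mult.commute)
      from DERIV_cmult[OF this, of "of_real (p x)"] show ?thesis by simp
    qed
  qed (use powr_mean_integrable[OF assms] in auto)
  thus ?thesis by (simp add: powr_mean_def[abs_def])
qed

lemma norm_powr_mean_le:
  assumes p: "continuous_on {0..1} p" and B: "\<And>x. x \<in> {0..1} \<Longrightarrow> \<bar>p x\<bar> \<le> B" and s: "0 \<le> Re s"
  shows "norm (powr_mean p n s) \<le> B * real (Suc n) powr (- Re s)"
proof -
  have "norm (powr_mean p n s) \<le> integral {0..1} (\<lambda>x::real. B * real (Suc n) powr (- Re s))"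
    unfolding powr_mean_def
  proof (rule integral_norm_bound_integral)
    fix x :: real assume x: "x \<in> {0..1}"
    have "(real (Suc n) + x) powr (- Re s) \<le> real (Suc n) powr (- Re s)"
      using x s by (intro powr_mono2') auto
    moreover have "norm (of_real (real (Suc n) + x) powr (-s) :: complex) = (real (Suc n) + x) powr (- Re s)"
      using x by (subst norm_of_real_powr) auto
    ultimately show "norm (of_real (p x) * of_real (real (Suc n) + x) powr (-s) :: complex) \<le> B * real (Suc n) powr (- Re s)"
      unfolding norm_mult norm_of_real using B[OF x] by (intro mult_mono) auto
  qed (use powr_mean_integrable[OF p] in auto)
  thus ?thesis by simp
qed

lemma powr_mean_majorant:
  assumes p: "continuous_on {0..1} p"
  obtains B where "\<And>n s a. 1 < a \<Longrightarrow> a \<le> Re s \<Longrightarrow> norm (powr_mean p n s) \<le> B * real (Suc n) powr (- a)"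
proof -
  have "compact (p ` {0..1})" using p by (intro compact_continuous_image) auto
  then obtain B where B: "\<And>x. x \<in> {0..1} \<Longrightarrow> \<bar>p x\<bar> \<le> B"
    by (metis bounded_iff compact_imp_bounded imageI real_norm_def)
  have "0 \<le> B" using B[of 0] by auto
  hence "norm (powr_mean p n s) \<le> B * real (Suc n) powr (- a)" if "1 < a" "a \<le> Re s" for n s a
    using that by (intro order_trans[OF norm_powr_mean_le[OF p B]] mult_left_mono powr_mono) auto
  thus thesis by (rule that)
qed

lemma summable_powr_mean:
  assumes "continuous_on {0..1} p" "1 < Re s"
  shows "summable (\<lambda>n. powr_mean p n s)"
proof -
  obtain B where "\<And>n s a. 1 < a \<Longrightarrow> a \<le> Re s \<Longrightarrow> norm (powr_mean p n s) \<le> B * real (Suc n) powr (- a)"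
    using powr_mean_majorant[OF assms(1)] by blast
  hence "norm (powr_mean p n s) \<le> B * real (Suc n) powr (- Re s)" for n using assms(2) by blast
  thus ?thesis by (intro summable_comparison_test'[OF summable_mult[OF summable_Suc_powr[OF assms(2)]]])
qed

lemma suminf_powr_mean_holomorphic:
  assumes p: "continuous_on {0..1} p"
  shows "(\<lambda>s. \<Sum>n. powr_mean p n s) holomorphic_on {s. 1 < Re s}"
proof (rule holomorphic_uniform_sequence[where f = "\<lambda>N s. \<Sum>n<N. powr_mean p n s"])
  show "open {s. 1 < Re s}" by (simp add: open_halfspace_Re_gt)
  show "(\<lambda>s. \<Sum>n<N. powr_mean p n s) holomorphic_on {s. 1 < Re s}" for N
    by (intro holomorphic_intros holomorphic_on_subset[OF powr_mean_holomorphic] p) auto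
  obtain B where B: "\<And>n s a. 1 < a \<Longrightarrow> a \<le> Re s \<Longrightarrow> norm (powr_mean p n s) \<le> B * real (Suc n) powr (- a)"
    using powr_mean_majorant[OF p] by blast
  fix z assume z: "z \<in> {s. 1 < Re s}"
  define d where "d = (Re z - 1) / 2"
  have d: "0 < d" using z by (simp add: d_def)
  have Re_ge: "1 + d \<le> Re y" if "y \<in> cball z d" for y
    using that abs_Re_le_cmod[of "z - y"] by (auto simp: dist_norm d_def field_simps)
  have "uniform_limit (cball z d) (\<lambda>N s. \<Sum>n<N. powr_mean p n s) (\<lambda>s. \<Sum>n. powr_mean p n s) sequentially"
  proof (rule Weierstrass_m_test)
    show "summable (\<lambda>n. B * real (Suc n) powr (-(1 + d)))"
      using d by (intro summable_mult summable_Suc_powr) auto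
    show "norm (powr_mean p n y) \<le> B * real (Suc n) powr (-(1 + d))" if "y \<in> cball z d" for n y
      using d Re_ge[OF that] by (intro B) auto
  qed
  moreover have "cball z d \<subseteq> {s. 1 < Re s}" using Re_ge d by force
  ultimately show "\<exists>d>0. cball z d \<subseteq> {s. 1 < Re s} \<and>
      uniform_limit (cball z d) (\<lambda>N s. \<Sum>n<N. powr_mean p n s) (\<lambda>s. \<Sum>n. powr_mean p n s) sequentially"
    using d by blast
qed

lemma powr_mean_by_parts:
  assumes p: "continuous_on {0..1} p"
    and q: "\<And>x. x \<in> {0..1} \<Longrightarrow> (q has_real_derivative p x) (at x within {0..1})"
  shows "powr_mean p n s = of_real (q 1) * of_nat (Suc (Suc n)) powr (-s)
           - of_real (q 0) * of_nat (Suc n) powr (-s) + s * powr_mean q n (s + 1)"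
proof -
  have q_cont: "continuous_on {0..1} q" using q by (intro DERIV_continuous_on)
  let ?e = "\<lambda>z x. of_real (real (Suc n) + x) powr z :: complex"
  have "((\<lambda>x. of_real (p x) * ?e (-s) x - s * (of_real (q x) * ?e (-(s + 1)) x)) has_integral
      of_real (q 1) * ?e (-s) 1 - of_real (q 0) * ?e (-s) 0) {0..1}"
  proof (rule fundamental_theorem_of_calculus)
    fix x :: real assume x: "x \<in> {0..1}"
    have "(?e (-s) has_vector_derivative (-s * ?e (-s - 1) x)) (at x within {0..1})"
      using x by (intro of_real_powr_has_vector_derivative) auto
    hence "((\<lambda>x. of_real (q x) * ?e (-s) x) has_vector_derivative
        of_real (q x) * (-s * ?e (-s - 1) x) + of_real (p x) * ?e (-s) x) (at x within {0..1})"
      using q[OF x]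
      by (intro has_vector_derivative_mult has_vector_derivative_of_real)
         (auto simp: has_real_derivative_iff_has_vector_derivative)
    moreover have exponent: "-(s + 1) = -s - 1" by simp
    ultimately show "((\<lambda>x. of_real (q x) * ?e (-s) x) has_vector_derivative
        of_real (p x) * ?e (-s) x - s * (of_real (q x) * ?e (-(s + 1)) x)) (at x within {0..1})"
      unfolding exponent by (simp add: mult.left_commute)
  qed auto
  moreover have "((\<lambda>x. of_real (p x) * ?e (-s) x - s * (of_real (q x) * ?e (-(s + 1)) x)) has_integral
      powr_mean p n s - s * powr_mean q n (s + 1)) {0..1}"
    unfolding powr_mean_def
    by (intro has_integral_diff has_integral_mult_right integrable_integral powr_mean_integrable p q_cont)
  ultimately have "powr_mean p n s - s * powr_mean q n (s + 1) = of_real (q 1) * ?e (-s) 1 - of_real (q 0) * ?e (-s) 0"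
    by (rule has_integral_unique[rotated])
  thus ?thesis by (simp add: algebra_simps)
qed

text \<open>Integrating by parts against the antiderivative \<open>q\<close> of \<open>p\<close> that again has mean zero replaces
  \<open>p\<close> at \<open>s\<close> by \<open>q\<close> at \<open>s + 1\<close>, since the boundary terms telescope.\<close>

lemma suminf_powr_mean_extends_half_plane:
  assumes "continuous_on {0..1} p" "integral {0..1} p = 0"
  shows "\<exists>f. f holomorphic_on {s. 1 - real m < Re s} \<and> (\<forall>s. 1 < Re s \<longrightarrow> (\<lambda>n. powr_mean p n s) sums f s)"
  using assms
proof (induction m arbitrary: p)
  case 0
  show ?case using suminf_powr_mean_holomorphic summable_powr_mean 0(1)
    by (intro exI[of _ "\<lambda>s. \<Sum>n. powr_mean p n s"]) (auto intro: summable_sums)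
next
  case (Suc m)
  define c where "c = - integral {0..1} (\<lambda>x. integral {0..x} p)"
  define q where "q = (\<lambda>x. integral {0..x} p + c)"
  have q_deriv: "(q has_real_derivative p x) (at x within {0..1})" if "x \<in> {0..1}" for x
    unfolding q_def using integral_has_real_derivative[OF Suc.prems(1) that]
    by (auto intro!: derivative_eq_intros)
  have q_ends: "q 0 = c" "q 1 = c" using Suc.prems(2) by (auto simp: q_def)
  have "continuous_on {0..1} (\<lambda>x. integral {0..x} p)"
    by (intro indefinite_integral_continuous_1 integrable_continuous_real Suc.prems)
  hence "integral {0..1} q = 0"
    unfolding q_def by (subst integral_add) (auto simp: c_def intro!: integrable_continuous_real)
  moreover have "continuous_on {0..1} q" using q_deriv by (intro DERIV_continuous_on)
  ultimately obtain f where f_hol: "f holomorphic_on {s. 1 - real m < Re s}"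
    and f_sums: "\<And>s. 1 < Re s \<Longrightarrow> (\<lambda>n. powr_mean q n s) sums f s"
    using Suc.IH by blast
  let ?g = "\<lambda>s. - of_real c + s * f (s + 1)"
  have "?g holomorphic_on {s. 1 - real (Suc m) < Re s}"
    by (intro holomorphic_intros holomorphic_on_compose_gen[OF _ f_hol, unfolded o_def]) auto
  moreover have "(\<lambda>n. powr_mean p n s) sums ?g s" if s: "1 < Re s" for s
  proof -
    let ?a = "\<lambda>n. of_nat (Suc n) powr (-s) :: complex"
    have "(\<lambda>n. ?a (Suc n) - ?a n) sums (0 - ?a 0)"
      using s by (intro telescope_sums LIMSEQ_Suc tendsto_neg_powr_complex_of_nat filterlim_ident) auto
    hence "(\<lambda>n. of_real c * (?a (Suc n) - ?a n) + s * powr_mean q n (s + 1)) sums (of_real c * (0 - ?a 0) + s * f (s + 1))"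
      using s by (intro sums_add sums_mult f_sums) auto
    moreover have "powr_mean p n s = of_real c * (?a (Suc n) - ?a n) + s * powr_mean q n (s + 1)" for n
      by (subst powr_mean_by_parts[OF Suc.prems(1) q_deriv]) (auto simp: q_ends algebra_simps)
    ultimately show ?thesis by simp
  qed
  ultimately show ?case by blast
qed

lemma holomorphic_half_plane_eqI:
  assumes "f holomorphic_on {s. a < Re s}" "g holomorphic_on {s. a < Re s}"
    and "\<And>s. b < Re s \<Longrightarrow> f s = g s" and "a < Re z"
  shows "f z = g z"
proof (rule analytic_continuation_open[where s = "{s. max a b < Re s}" and s' = "{s. a < Re s}" and f = f and g = g])
  show "{s. max a b < Re s} \<noteq> {}"
    by (auto intro!: exI[of _ "of_real (max a b + 1)"])
  show "open {s. max a b < Re s}" by (rule open_halfspace_Re_gt)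
qed (use assms in \<open>auto simp: open_halfspace_Re_gt convex_connected convex_halfspace_Re_gt\<close>)

lemma suminf_powr_mean_extends_entire:
  assumes "continuous_on {0..1} p" "integral {0..1} p = 0"
  obtains B where "B holomorphic_on UNIV" "\<And>s. 1 < Re s \<Longrightarrow> (\<lambda>n. powr_mean p n s) sums B s"
proof -
  obtain A where A_hol: "\<And>m. A m holomorphic_on {s. 1 - real m < Re s}"
    and A_sums: "\<And>m s. 1 < Re s \<Longrightarrow> (\<lambda>n. powr_mean p n s) sums A m s"
    using suminf_powr_mean_extends_half_plane[OF assms] by metis
  define B where "B s = A (nat \<lceil>2 - Re s\<rceil>) s" for s
  have A_eq: "A m s = A n s" if "m \<le> n" "1 - real m < Re s" for m n s
  proof (rule holomorphic_half_plane_eqI[where f = "A m" and g = "A n" and a = "1 - real m" and b = 1])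
    show "A n holomorphic_on {s. 1 - real m < Re s}"
      by (rule holomorphic_on_subset[OF A_hol]) (use that in auto)
    show "A m s = A n s" if "1 < Re s" for s
      using A_sums[OF that] sums_unique2 by blast
  qed (use A_hol that in auto)
  have B_eq: "B s = A m s" if "1 - real m < Re s" for m s
  proof -
    have "1 - real (nat \<lceil>2 - Re s\<rceil>) < Re s" by linarith
    thus ?thesis using A_eq[of m "nat \<lceil>2 - Re s\<rceil>" s] A_eq[of "nat \<lceil>2 - Re s\<rceil>" m s] that
      unfolding B_def by (metis nat_le_linear)
  qed
  have "B holomorphic_on (\<Union>m. {s. 1 - real m < Re s})"
  proof (rule holomorphic_on_UN_open)
    show "B holomorphic_on {s. 1 - real m < Re s}" for m
      using A_hol[of m] by (rule holomorphic_transform) (auto simp: B_eq)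
  qed (simp add: open_halfspace_Re_gt)
  also have "(\<Union>m. {s. 1 - real m < Re s}) = UNIV"
  proof safe
    fix s :: complex
    obtain m where "1 - Re s < real m" using reals_Archimedean2 by blast
    thus "s \<in> (\<Union>m. {s. 1 - real m < Re s})" by (auto intro!: exI[of _ m])
  qed auto
  finally have "B holomorphic_on UNIV" .
  moreover have "(\<lambda>n. powr_mean p n s) sums B s" if "1 < Re s" for s
    using that A_sums[of s 0] B_eq[of 0 s] by simp
  ultimately show thesis by (rule that)
qed

definition saw :: "real \<Rightarrow> real" where "saw x = x - 1/2"

lemma continuous_on_saw: "continuous_on A saw"
  by (auto simp: saw_def[abs_def] intro!: continuous_intros)

lemma integral_saw: "integral {0..1} saw = 0"
proof -
  have "(saw has_integral ((1\<^sup>2 - 1) / 2 - (0\<^sup>2 - 0) / 2)) {0..1}"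
    by (rule fundamental_theorem_of_calculus)
      (auto simp: saw_def has_real_derivative_iff_has_vector_derivative[symmetric] field_simps intro!: derivative_eq_intros)
  thus ?thesis by (simp add: integral_unique)
qed

lemma Dirichlet_series_conv_powr_mean:
  assumes s: "1 < Re s" and A: "(\<lambda>n. powr_mean saw n (s + 1)) sums A"
  shows "(\<lambda>n. 1 / of_nat (Suc n) powr s) sums (1 / (s - 1) + 1 / 2 - s * A)"
proof -
  let ?a = "\<lambda>n. of_nat (Suc n) powr (-s) :: complex"
  let ?b = "\<lambda>n. of_nat (Suc n) powr (-(s-1)) :: complex"
  have s_nz: "s \<noteq> 1" "1 - s \<noteq> 0" using s by auto
  have mean_trapezoid: "powr_mean (\<lambda>_. 1) n s = 1/2 * ?a (Suc n) + 1/2 * ?a n + s * powr_mean saw n (s + 1)" for n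
  proof -
    have "(saw has_real_derivative 1) (at x within {0..1})" for x
      by (auto simp: saw_def[abs_def] intro!: derivative_eq_intros)
    from powr_mean_by_parts[OF _ this, of n s] show ?thesis by (simp add: saw_def)
  qed
  have mean_exact: "powr_mean (\<lambda>_. 1) n s = (?b n - ?b (Suc n)) / (s - 1)" for n
  proof -
    have "powr_mean (\<lambda>_. 0) n (s - 1) = ?b (Suc n) - ?b n + (s - 1) * powr_mean (\<lambda>_. 1) n (s - 1 + 1)"
      by (subst powr_mean_by_parts[where q = "\<lambda>_. 1"]) auto
    thus ?thesis using s_nz by (simp add: powr_mean_def field_simps)
  qed
  have powr_tendsto_0: "(\<lambda>n. of_nat (Suc n) powr (-z) :: complex) \<longlonglongrightarrow> 0" if "0 < Re z" for z
    using that by (intro LIMSEQ_Suc tendsto_neg_powr_complex_of_nat filterlim_ident) simp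
  have integral_part: "(\<lambda>n. (?b n - ?b (Suc n)) / (s - 1)) sums ((?b 0 - 0) / (s - 1))"
    using s by (intro sums_divide telescope_sums' powr_tendsto_0) auto
  have boundary_part: "(\<lambda>n. 1/2 * (?a n - ?a (Suc n))) sums (1/2 * (?a 0 - 0))"
    using s by (intro sums_mult telescope_sums' powr_tendsto_0) auto
  have "(\<lambda>n. (?b n - ?b (Suc n)) / (s - 1) + 1/2 * (?a n - ?a (Suc n)) - s * powr_mean saw n (s + 1))
      sums ((?b 0 - 0) / (s - 1) + 1/2 * (?a 0 - 0) - s * A)"
    by (intro sums_diff[OF sums_add[OF integral_part boundary_part] sums_mult[OF A]])
  moreover have "?a n = (?b n - ?b (Suc n)) / (s - 1) + 1/2 * (?a n - ?a (Suc n)) - s * powr_mean saw n (s + 1)" for n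
    using mean_trapezoid[of n] mean_exact[of n] by (simp add: field_simps)
  ultimately have "?a sums ((?b 0 - 0) / (s - 1) + 1/2 * (?a 0 - 0) - s * A)" by simp
  thus ?thesis by (simp add: powr_minus field_simps)
qed

lemma zeta_holomorphic: "zeta holomorphic_on (- {1})"
  and zeta_sums: "1 < Re s \<Longrightarrow> (\<lambda>n. 1 / of_nat (Suc n) powr s) sums zeta s"
proof -
  obtain B where B_hol: "B holomorphic_on UNIV" and B_sums: "\<And>s. 1 < Re s \<Longrightarrow> (\<lambda>n. powr_mean saw n s) sums B s"
    using suminf_powr_mean_extends_entire[OF continuous_on_saw integral_saw] by blast
  have "(\<lambda>s. 1 / (s - 1) + 1 / 2 - s * B (s + 1)) holomorphic_on (- {1})"
    by (intro holomorphic_intros holomorphic_on_compose_gen[OF _ B_hol, unfolded o_def]) auto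
  moreover have "(\<lambda>n. 1 / of_nat (Suc n) powr s) sums (1 / (s - 1) + 1 / 2 - s * B (s + 1))" if "1 < Re s" for s
    using that by (intro Dirichlet_series_conv_powr_mean B_sums) auto
  ultimately have "\<exists>f. f holomorphic_on (- {1}) \<and> (\<forall>s. 1 < Re s \<longrightarrow> (\<lambda>n. 1 / of_nat (Suc n) powr s) sums f s)"
    by blast
  from someI_ex[OF this]
  show "zeta holomorphic_on (- {1})" "1 < Re s \<Longrightarrow> (\<lambda>n. 1 / of_nat (Suc n) powr s) sums zeta s"
    unfolding zeta_def[symmetric] by auto
qed

lemma zeta_saw_representation:
  obtains B where "B holomorphic_on UNIV"
    "\<And>s. s \<noteq> 1 \<Longrightarrow> zeta s = 1 / (s - 1) + 1 / 2 - s * B (s + 1)"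
    "\<And>s. 1 < Re s \<Longrightarrow> norm (B s) \<le> real_zeta (Re s)"
proof -
  obtain B where B_hol: "B holomorphic_on UNIV" and B_sums: "\<And>s. 1 < Re s \<Longrightarrow> (\<lambda>n. powr_mean saw n s) sums B s"
    using suminf_powr_mean_extends_entire[OF continuous_on_saw integral_saw] by blast
  have "zeta s = 1 / (s - 1) + 1 / 2 - s * B (s + 1)" if "s \<noteq> 1" for s
  proof (rule analytic_continuation_open[where s = "{s. 1 < Re s}" and s' = "- {1}" and f = zeta and g = "\<lambda>s. 1 / (s - 1) + 1 / 2 - s * B (s + 1)"])
    show "{s. 1 < Re s} \<noteq> {}" by (auto intro!: exI[of _ 2])
    show "connected (- {1 :: complex})" by (simp add: connected_punctured_universe)
    show "(\<lambda>s. 1 / (s - 1) + 1 / 2 - s * B (s + 1)) holomorphic_on (- {1})"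
      by (intro holomorphic_intros holomorphic_on_compose_gen[OF _ B_hol, unfolded o_def]) auto
    show "zeta s = 1 / (s - 1) + 1 / 2 - s * B (s + 1)" if "s \<in> {s. 1 < Re s}" for s
      using that by (intro sums_unique2[OF zeta_sums Dirichlet_series_conv_powr_mean] B_sums) auto
  qed (use that zeta_holomorphic in \<open>auto simp: open_halfspace_Re_gt\<close>)
  moreover have "norm (B s) \<le> real_zeta (Re s)" if s: "1 < Re s" for s
  proof -
    have "norm (powr_mean saw n s) \<le> 1 * real (Suc n) powr (- Re s)" for n
      using s by (intro norm_powr_mean_le continuous_on_saw) (auto simp: saw_def abs_if)
    hence "norm (\<Sum>n. powr_mean saw n s) \<le> real_zeta (Re s)"
      using s by (intro norm_suminf_le_real_zeta) auto
    moreover have "B s = (\<Sum>n. powr_mean saw n s)" using B_sums[OF s] by (rule sums_unique)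
    ultimately show ?thesis by (simp only:)
  qed
  ultimately show thesis using that B_hol by blast
qed

lemma zeta_pow_reg_holomorphic: "zeta_pow_reg k holomorphic_on UNIV"
proof -
  obtain B where B_hol: "B holomorphic_on UNIV"
    and zeta_eq: "\<And>s. s \<noteq> 1 \<Longrightarrow> zeta s = 1 / (s - 1) + 1 / 2 - s * B (s + 1)"
    by (rule zeta_saw_representation) blast
  have "(\<lambda>s. (1 + (s - 1) / 2 - (s - 1) * s * B (s + 1)) ^ k) holomorphic_on UNIV"
    by (intro holomorphic_intros holomorphic_on_compose_gen[OF _ B_hol, unfolded o_def]) auto
  also have "(\<lambda>s. (1 + (s - 1) / 2 - (s - 1) * s * B (s + 1)) ^ k) = zeta_pow_reg k"
    by (auto simp: zeta_pow_reg_def fun_eq_iff zeta_eq power_mult_distrib[symmetric] field_simps)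
  finally show ?thesis .
qed

lemma zeta_of_real:
  assumes "1 < a" shows "zeta (of_real a) = of_real (real_zeta a)"
proof -
  have "(\<lambda>n. of_real (real (Suc n) powr (- a))) sums (of_real (real_zeta a) :: complex)"
    unfolding real_zeta_def using assms by (intro sums_of_real summable_sums summable_Suc_powr)
  moreover have "of_real (real (Suc n) powr (- a)) = 1 / (of_nat (Suc n) :: complex) powr of_real a" for n
    using powr_of_real[of "real (Suc n)" a] by (simp add: powr_minus_divide del: of_nat_Suc)
  ultimately show ?thesis using zeta_sums[of "of_real a"] assms sums_unique2 by fastforce
qed

lemma norm_zeta_le_real_zeta:
  assumes "1 < a" "a \<le> Re s"
  shows "norm (zeta s) \<le> real_zeta a"
proof -
  have "norm (1 / of_nat (Suc n) powr s) \<le> real (Suc n) powr (- a)" for n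
  proof -
    have "norm (1 / of_nat (Suc n) powr s) = real (Suc n) powr (- Re s)"
      using norm_of_real_powr[of "real (Suc n)" s] by (simp add: norm_divide powr_minus_divide del: of_nat_Suc)
    also have "\<dots> \<le> real (Suc n) powr (- a)" using assms(2) by (intro powr_mono) auto
    finally show ?thesis .
  qed
  hence "norm (\<Sum>n. 1 / of_nat (Suc n) powr s) \<le> real_zeta a" by (intro norm_suminf_le_real_zeta assms)
  moreover have "zeta s = (\<Sum>n. 1 / of_nat (Suc n) powr s)" using assms by (intro sums_unique zeta_sums) auto
  ultimately show ?thesis by (simp only:)
qed

lemma norm_zeta_le_linear:
  assumes "0 < a"
  obtains C where "0 \<le> C" "\<And>s. a \<le> Re s \<Longrightarrow> 1 \<le> \<bar>Im s\<bar> \<Longrightarrow> norm (zeta s) \<le> C * norm s"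
proof -
  obtain B where zeta_eq: "\<And>s. s \<noteq> 1 \<Longrightarrow> zeta s = 1 / (s - 1) + 1 / 2 - s * B (s + 1)"
     and B_le: "\<And>s. 1 < Re s \<Longrightarrow> norm (B s) \<le> real_zeta (Re s)"
    by (rule zeta_saw_representation) blast
  let ?M = "real_zeta (1 + a)"
  have M_nonneg: "0 \<le> ?M" using assms by (intro real_zeta_nonneg) auto
  have "norm (zeta s) \<le> (2 + ?M) * norm s" if s: "a \<le> Re s" "1 \<le> \<bar>Im s\<bar>" for s
  proof -
    have norm_s: "1 \<le> norm s" using s(2) abs_Im_le_cmod[of s] by linarith
    have norm_s_minus_1: "1 \<le> norm (s - 1)" using s(2) abs_Im_le_cmod[of "s - 1"] by simp
    have "norm (B (s + 1)) \<le> real_zeta (Re (s + 1))" using s assms by (intro B_le) auto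
    also have "\<dots> \<le> ?M" using s assms by (intro real_zeta_antimono) auto
    finally have B_s: "norm (B (s + 1)) \<le> ?M" .
    have "zeta s = 1 / (s - 1) + 1 / 2 - s * B (s + 1)" using s(2) by (intro zeta_eq) auto
    hence "norm (zeta s) \<le> norm (1 / (s - 1)) + norm (1 / 2 :: complex) + norm (s * B (s + 1))"
      by (simp only:) (intro order_trans[OF norm_triangle_ineq4] add_mono norm_triangle_ineq order_refl)
    also have "\<dots> \<le> 1 + 1 / 2 + norm s * ?M"
      using norm_s_minus_1 B_s by (intro add_mono) (auto simp: norm_divide norm_mult divide_simps intro!: mult_left_mono)
    also have "\<dots> \<le> (2 + ?M) * norm s" using norm_s M_nonneg by (simp add: algebra_simps)
    finally show ?thesis .
  qed
  thus thesis using M_nonneg that[of "2 + ?M"] by auto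
qed

section \<open>Convexity in vertical strips\<close>

definition vertical_growth :: "(complex \<Rightarrow> complex) \<Rightarrow> real set \<Rightarrow> (real \<Rightarrow> real) \<Rightarrow> bool" where
  "vertical_growth f S \<mu> \<longleftrightarrow>
     (\<exists>K. \<forall>s. Re s \<in> S \<longrightarrow> 1 \<le> \<bar>Im s\<bar> \<longrightarrow> norm (f s) \<le> K * \<bar>Im s\<bar> powr \<mu> (Re s))"

lemma vertical_growthI:
  assumes "\<And>s. Re s \<in> S \<Longrightarrow> 1 \<le> \<bar>Im s\<bar> \<Longrightarrow> norm (f s) \<le> K * \<bar>Im s\<bar> powr \<mu> (Re s)"
  shows "vertical_growth f S \<mu>"
  using assms unfolding vertical_growth_def by blast

lemma vertical_growthE:
  assumes "vertical_growth f S \<mu>"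
  obtains K where "1 \<le> K" "\<And>s. Re s \<in> S \<Longrightarrow> 1 \<le> \<bar>Im s\<bar> \<Longrightarrow> norm (f s) \<le> K * \<bar>Im s\<bar> powr \<mu> (Re s)"
proof -
  obtain K where K: "\<And>s. Re s \<in> S \<Longrightarrow> 1 \<le> \<bar>Im s\<bar> \<Longrightarrow> norm (f s) \<le> K * \<bar>Im s\<bar> powr \<mu> (Re s)"
    using assms unfolding vertical_growth_def by blast
  have "norm (f s) \<le> max 1 K * \<bar>Im s\<bar> powr \<mu> (Re s)" if "Re s \<in> S" "1 \<le> \<bar>Im s\<bar>" for s
    using that by (intro order_trans[OF K] mult_right_mono) auto
  thus thesis by (intro that[of "max 1 K"]) auto
qed

lemma vertical_growth_mono:
  assumes f: "vertical_growth f T \<mu>" and "S \<subseteq> T" and le: "\<And>\<sigma>. \<sigma> \<in> S \<Longrightarrow> \<mu> \<sigma> \<le> \<nu> \<sigma>"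
  shows "vertical_growth f S \<nu>"
proof -
  obtain K where K: "1 \<le> K" "\<And>s. Re s \<in> T \<Longrightarrow> 1 \<le> \<bar>Im s\<bar> \<Longrightarrow> norm (f s) \<le> K * \<bar>Im s\<bar> powr \<mu> (Re s)"
    using f by (rule vertical_growthE) blast
  show ?thesis
    by (rule vertical_growthI[of _ _ K], rule order_trans[OF K(2)])
      (use K(1) le \<open>S \<subseteq> T\<close> in \<open>auto intro!: mult_left_mono powr_mono\<close>)
qed

lemma vertical_growth_Un:
  assumes "vertical_growth f S \<mu>" "vertical_growth f T \<mu>"
  shows "vertical_growth f (S \<union> T) \<mu>"
proof -
  obtain K where K: "\<And>s. Re s \<in> S \<Longrightarrow> 1 \<le> \<bar>Im s\<bar> \<Longrightarrow> norm (f s) \<le> K * \<bar>Im s\<bar> powr \<mu> (Re s)"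
    using assms(1) by (rule vertical_growthE) blast
  obtain L where L: "\<And>s. Re s \<in> T \<Longrightarrow> 1 \<le> \<bar>Im s\<bar> \<Longrightarrow> norm (f s) \<le> L * \<bar>Im s\<bar> powr \<mu> (Re s)"
    using assms(2) by (rule vertical_growthE) blast
  show ?thesis
  proof (rule vertical_growthI[of _ _ "max K L"])
    fix s assume s: "Re s \<in> S \<union> T" "1 \<le> \<bar>Im s\<bar>"
    hence "norm (f s) \<le> K * \<bar>Im s\<bar> powr \<mu> (Re s) \<or> norm (f s) \<le> L * \<bar>Im s\<bar> powr \<mu> (Re s)"
      using K L by blast
    moreover have "K * \<bar>Im s\<bar> powr \<mu> (Re s) \<le> max K L * \<bar>Im s\<bar> powr \<mu> (Re s)"
      "L * \<bar>Im s\<bar> powr \<mu> (Re s) \<le> max K L * \<bar>Im s\<bar> powr \<mu> (Re s)"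
        by (auto intro!: mult_right_mono)
    ultimately show "norm (f s) \<le> max K L * \<bar>Im s\<bar> powr \<mu> (Re s)" by linarith
  qed
qed

lemma vertical_growth_power_iff:
  assumes "1 \<le> k"
  shows "vertical_growth (\<lambda>s. f s ^ k) S (\<lambda>\<sigma>. real k * \<mu> \<sigma>) \<longleftrightarrow> vertical_growth f S \<mu>"
proof
  assume "vertical_growth (\<lambda>s. f s ^ k) S (\<lambda>\<sigma>. real k * \<mu> \<sigma>)"
  then obtain K where K: "1 \<le> K"
    "\<And>s. Re s \<in> S \<Longrightarrow> 1 \<le> \<bar>Im s\<bar> \<Longrightarrow> norm (f s ^ k) \<le> K * \<bar>Im s\<bar> powr (real k * \<mu> (Re s))"
    by (rule vertical_growthE) blast
  show "vertical_growth f S \<mu>"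
  proof (rule vertical_growthI[of _ _ K])
    fix s assume s: "Re s \<in> S" "1 \<le> \<bar>Im s\<bar>"
    have "norm (f s) ^ k \<le> K * \<bar>Im s\<bar> powr (real k * \<mu> (Re s))"
      using K(2)[OF s] by (simp add: norm_power)
    also have "\<dots> \<le> K ^ k * \<bar>Im s\<bar> powr (real k * \<mu> (Re s))"
      using K(1) assms self_le_power[of K k] by (intro mult_right_mono) auto
    also have "\<dots> = (K * \<bar>Im s\<bar> powr \<mu> (Re s)) ^ k"
      using s assms by (simp add: power_mult_distrib powr_power mult.commute)
    finally show "norm (f s) \<le> K * \<bar>Im s\<bar> powr \<mu> (Re s)"
      using K(1) assms power_mono_iff[of "norm (f s)" "K * \<bar>Im s\<bar> powr \<mu> (Re s)" k] by simp
  qed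
next
  assume "vertical_growth f S \<mu>"
  then obtain K where K: "\<And>s. Re s \<in> S \<Longrightarrow> 1 \<le> \<bar>Im s\<bar> \<Longrightarrow> norm (f s) \<le> K * \<bar>Im s\<bar> powr \<mu> (Re s)"
    by (rule vertical_growthE) blast
  show "vertical_growth (\<lambda>s. f s ^ k) S (\<lambda>\<sigma>. real k * \<mu> \<sigma>)"
  proof (rule vertical_growthI[of _ _ "K ^ k"])
    fix s assume s: "Re s \<in> S" "1 \<le> \<bar>Im s\<bar>"
    have "norm (f s ^ k) \<le> (K * \<bar>Im s\<bar> powr \<mu> (Re s)) ^ k"
      unfolding norm_power using K[OF s] by (intro power_mono) auto
    thus "norm (f s ^ k) \<le> K ^ k * \<bar>Im s\<bar> powr (real k * \<mu> (Re s))"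
      using s assms by (simp add: power_mult_distrib powr_power mult.commute)
  qed
qed

lemma vertical_growth_if_bounded_diff:
  assumes f: "vertical_growth f S \<mu>" and nonneg: "\<And>\<sigma>. \<sigma> \<in> S \<Longrightarrow> 0 \<le> \<mu> \<sigma>"
    and bounded_diff: "bounded ((\<lambda>s. f s - g s) ` {s. 1 \<le> \<bar>Im s\<bar>})"
  shows "vertical_growth g S \<mu>"
proof -
  obtain K where K: "\<And>s. Re s \<in> S \<Longrightarrow> 1 \<le> \<bar>Im s\<bar> \<Longrightarrow> norm (f s) \<le> K * \<bar>Im s\<bar> powr \<mu> (Re s)"
    using f by (rule vertical_growthE) blast
  obtain A where A: "0 < A" "\<And>s. 1 \<le> \<bar>Im s\<bar> \<Longrightarrow> norm (f s - g s) \<le> A"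
    using bounded_diff unfolding bounded_pos by auto
  show ?thesis
  proof (rule vertical_growthI[of _ _ "K + A"])
    fix s assume s: "Re s \<in> S" "1 \<le> \<bar>Im s\<bar>"
    have "norm (g s) \<le> norm (f s) + norm (f s - g s)"
      using norm_triangle_ineq4[of "f s" "f s - g s"] by simp
    also have "\<dots> \<le> K * \<bar>Im s\<bar> powr \<mu> (Re s) + A * 1" using K[OF s] A(2)[OF s(2)] by simp
    also have "\<dots> \<le> K * \<bar>Im s\<bar> powr \<mu> (Re s) + A * \<bar>Im s\<bar> powr \<mu> (Re s)"
      using A(1) s nonneg by (intro add_left_mono mult_left_mono ge_one_powr_ge_zero) auto
    finally show "norm (g s) \<le> (K + A) * \<bar>Im s\<bar> powr \<mu> (Re s)" by (simp add: algebra_simps)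
  qed
qed

lemma maximum_modulus_rectangle:
  fixes f :: "complex \<Rightarrow> complex" and a b c d :: real
  defines "R \<equiv> cbox (Complex a c) (Complex b d)"
  assumes hol: "f holomorphic_on U" "R \<subseteq> U" and w: "w \<in> R"
    and vertical: "\<And>s. s \<in> R \<Longrightarrow> Re s = a \<Longrightarrow> norm (f s) \<le> B" "\<And>s. s \<in> R \<Longrightarrow> Re s = b \<Longrightarrow> norm (f s) \<le> B"
    and horizontal: "\<And>s. s \<in> R \<Longrightarrow> Im s = c \<Longrightarrow> norm (f s) \<le> B" "\<And>s. s \<in> R \<Longrightarrow> Im s = d \<Longrightarrow> norm (f s) \<le> B"
  shows "norm (f w) \<le> B"
proof (rule maximum_modulus_frontier[of f R])
  show "f holomorphic_on interior R"
    using hol interior_subset by (blast intro: holomorphic_on_subset)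
  show "continuous_on (closure R) f"
    using hol by (auto simp: R_def intro: holomorphic_on_imp_continuous_on holomorphic_on_subset)
  show "bounded R" unfolding R_def by (rule bounded_cbox)
  fix s assume "s \<in> frontier R"
  hence s: "s \<in> R" and "s \<notin> box (Complex a c) (Complex b d)"
    by (auto simp: R_def frontier_cbox)
  hence "Re s = a \<or> Re s = b \<or> Im s = c \<or> Im s = d"
    by (force simp: R_def in_cbox_complex_iff in_box_complex_iff)
  thus "norm (f s) \<le> B" using s vertical horizontal by blast
qed (rule w)

lemma norm_exp_linear_plus_square:
  "norm (exp (of_real \<tau> * z + z\<^sup>2)) = exp ((Re z)\<^sup>2) * exp (\<tau> * Re z - (Im z)\<^sup>2)"
  by (simp add: norm_exp_eq_Re exp_add[symmetric] power2_eq_square)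

text \<open>The factor \<open>exp ((s - w)\<^sup>2)\<close> makes the horizontal sides of a tall rectangle around \<open>w\<close>
  negligible, and \<open>\<tau>\<close> can be chosen to balance the two vertical sides.\<close>

lemma three_lines_rectangle:
  fixes f :: "complex \<Rightarrow> complex" and a b h \<tau> :: real and w :: complex
  defines "R \<equiv> cbox (Complex a (Im w - h)) (Complex b (Im w + h))"
  assumes hol: "f holomorphic_on U" "R \<subseteq> U" and w: "a \<le> Re w" "Re w \<le> b" "0 \<le> h"
    and left: "\<And>s. s \<in> R \<Longrightarrow> Re s = a \<Longrightarrow> norm (f s) \<le> A"
    and right: "\<And>s. s \<in> R \<Longrightarrow> Re s = b \<Longrightarrow> norm (f s) \<le> B"
    and ends: "\<And>s. s \<in> R \<Longrightarrow> \<bar>Im s - Im w\<bar> = h \<Longrightarrow> norm (f s) \<le> M"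
  shows "norm (f w) \<le> exp ((b - a)\<^sup>2) *
    (A * exp (\<tau> * (a - Re w)) + B * exp (\<tau> * (b - Re w)) + M * exp (\<bar>\<tau>\<bar> * (b - a) - h\<^sup>2))"
    (is "_ \<le> exp _ * ?T")
proof -
  have R_iff: "s \<in> R \<longleftrightarrow> a \<le> Re s \<and> Re s \<le> b \<and> \<bar>Im s - Im w\<bar> \<le> h" for s
    by (auto simp: R_def in_cbox_complex_iff)
  define g where "g s = f s * exp (of_real \<tau> * (s - w) + (s - w)\<^sup>2)" for s
  have norm_g: "norm (g s) = norm (f s) * (exp ((Re s - Re w)\<^sup>2) * exp (\<tau> * (Re s - Re w) - (Im s - Im w)\<^sup>2))" for s
    by (simp only: g_def norm_mult norm_exp_linear_plus_square minus_complex.sel)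
  have side: "norm (g s) \<le> exp ((b - a)\<^sup>2) * ?T"
    if "s \<in> R" "norm (f s) \<le> C" "\<tau> * (Re s - Re w) - (Im s - Im w)\<^sup>2 \<le> E" "C * exp E \<le> ?T" for s C E
  proof -
    have "(Re s - Re w)\<^sup>2 \<le> (b - a)\<^sup>2"
      using that(1) w by (intro abs_le_square_iff[THEN iffD1]) (auto simp: R_iff)
    hence "norm (g s) \<le> C * (exp ((b - a)\<^sup>2) * exp E)"
      unfolding norm_g using that(2,3) by (intro mult_mono) (auto intro: order_trans[OF norm_ge_zero])
    also have "\<dots> \<le> exp ((b - a)\<^sup>2) * ?T" using that(4) by simp
    finally show ?thesis .
  qed
  have "0 \<le> A"
    by (rule order_trans[OF norm_ge_zero left[of "Complex a (Im w)"]]) (use w in \<open>auto simp: R_iff\<close>)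
  moreover have "0 \<le> B"
    by (rule order_trans[OF norm_ge_zero right[of "Complex b (Im w)"]]) (use w in \<open>auto simp: R_iff\<close>)
  moreover have "0 \<le> M"
    by (rule order_trans[OF norm_ge_zero ends[of "Complex a (Im w + h)"]]) (use w in \<open>auto simp: R_iff\<close>)
  ultimately have T_ge: "A * exp (\<tau> * (a - Re w)) \<le> ?T" "B * exp (\<tau> * (b - Re w)) \<le> ?T"
    "M * exp (\<bar>\<tau>\<bar> * (b - a) - h\<^sup>2) \<le> ?T" by auto
  have horizontal: "norm (g s) \<le> exp ((b - a)\<^sup>2) * ?T" if s: "s \<in> R" "\<bar>Im s - Im w\<bar> = h" for s
  proof (rule side[OF s(1) ends[OF s] _ T_ge(3)])
    have "\<tau> * (Re s - Re w) \<le> \<bar>\<tau>\<bar> * \<bar>Re s - Re w\<bar>" by (metis abs_ge_self abs_mult)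
    also have "\<dots> \<le> \<bar>\<tau>\<bar> * (b - a)" using s w by (intro mult_left_mono) (auto simp: R_iff)
    finally show "\<tau> * (Re s - Re w) - (Im s - Im w)\<^sup>2 \<le> \<bar>\<tau>\<bar> * (b - a) - h\<^sup>2"
      using s(2) by (metis diff_right_mono power2_abs)
  qed
  have "norm (g w) \<le> exp ((b - a)\<^sup>2) * ?T"
  proof (rule maximum_modulus_rectangle[of g R])
    show "g holomorphic_on R"
      unfolding g_def by (intro holomorphic_intros holomorphic_on_subset[OF hol])
    show "norm (g s) \<le> exp ((b - a)\<^sup>2) * ?T" if "s \<in> cbox (Complex a (Im w - h)) (Complex b (Im w + h))" "Re s = a" for s
      using that by (intro side[OF _ left _ T_ge(1)]) (simp_all add: R_def)
    show "norm (g s) \<le> exp ((b - a)\<^sup>2) * ?T" if "s \<in> cbox (Complex a (Im w - h)) (Complex b (Im w + h))" "Re s = b" for s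
      using that by (intro side[OF _ right _ T_ge(2)]) (simp_all add: R_def)
  qed (use w horizontal in \<open>auto simp: R_def in_cbox_complex_iff\<close>)
  thus ?thesis by (simp add: g_def)
qed

lemma powr_times_gaussian_le:
  fixes x c e :: real
  assumes "1 \<le> x" "0 \<le> c" "0 \<le> e"
  shows "x powr c * exp (- (x / 2)\<^sup>2) \<le> exp (c\<^sup>2) * x powr e"
proof -
  have "c * ln x \<le> c * x"
    using assms ln_bound[of x] by (intro mult_left_mono) auto
  moreover have "0 \<le> (c - x / 2)\<^sup>2" by simp
  ultimately have "c * ln x - (x / 2)\<^sup>2 \<le> c\<^sup>2" by (simp add: power2_eq_square algebra_simps)
  hence "x powr c * exp (- (x / 2)\<^sup>2) \<le> exp (c\<^sup>2)"
    using assms by (simp add: powr_def exp_add[symmetric])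
  also have "\<dots> \<le> exp (c\<^sup>2) * x powr e" using assms ge_one_powr_ge_zero[of x e] by simp
  finally show ?thesis .
qed

lemma three_lines_powr_bound:
  fixes f :: "complex \<Rightarrow> complex" and a b \<alpha> \<beta> \<gamma> A B K :: real and w :: complex
  defines "\<kappa> \<equiv> (\<alpha> - \<beta>) / (b - a)"
  defines "c \<equiv> \<gamma> + \<bar>\<kappa>\<bar> * (b - a)" and "e \<equiv> (\<alpha> * (b - Re w) + \<beta> * (Re w - a)) / (b - a)"
  assumes ab: "a < b" and nonneg: "0 \<le> \<alpha>" "0 \<le> \<beta>" "0 \<le> \<gamma>" "0 \<le> A" "0 \<le> B" "0 \<le> K"
    and hol: "f holomorphic_on U" "\<And>s. Re s \<in> {a..b} \<Longrightarrow> 1 \<le> \<bar>Im s\<bar> \<Longrightarrow> s \<in> U"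
    and left: "\<And>s. Re s = a \<Longrightarrow> 1 \<le> \<bar>Im s\<bar> \<Longrightarrow> norm (f s) \<le> A * \<bar>Im s\<bar> powr \<alpha>"
    and right: "\<And>s. Re s = b \<Longrightarrow> 1 \<le> \<bar>Im s\<bar> \<Longrightarrow> norm (f s) \<le> B * \<bar>Im s\<bar> powr \<beta>"
    and strip: "\<And>s. Re s \<in> {a..b} \<Longrightarrow> 1 \<le> \<bar>Im s\<bar> \<Longrightarrow> norm (f s) \<le> K * \<bar>Im s\<bar> powr \<gamma>"
    and w: "Re w \<in> {a..b}" "2 \<le> \<bar>Im w\<bar>"
  shows "norm (f w) \<le> exp ((b - a)\<^sup>2) * (A * 2 powr \<alpha> + B * 2 powr \<beta> + K * 2 powr \<gamma> * exp (c\<^sup>2)) * \<bar>Im w\<bar> powr e"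
proof -
  let ?t = "\<bar>Im w\<bar>"
  define \<tau> where "\<tau> = \<kappa> * ln ?t"
  have exp_\<tau>: "exp (\<tau> * y) = ?t powr (\<kappa> * y)" "exp (\<bar>\<tau>\<bar> * y) = ?t powr (\<bar>\<kappa>\<bar> * y)" for y
    using w by (auto simp: \<tau>_def powr_def abs_mult mult_ac)
  have rectangle: "1 \<le> \<bar>Im s\<bar>" "\<bar>Im s\<bar> \<le> 2 * ?t" "Re s \<in> {a..b}"
    if "s \<in> cbox (Complex a (Im w - ?t / 2)) (Complex b (Im w + ?t / 2))" for s
    using that w by (auto simp: in_cbox_complex_iff)
  have scale: "y \<le> C * (2 powr \<delta> * ?t powr \<delta>)"
    if "y \<le> C * \<bar>Im s\<bar> powr \<delta>" "\<bar>Im s\<bar> \<le> 2 * ?t" "0 \<le> \<delta>" "0 \<le> C" for y C \<delta> s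
    using that by (intro order_trans[OF that(1)] mult_left_mono) (auto simp: powr_mult[symmetric] intro!: powr_mono2)
  have "norm (f w) \<le> exp ((b - a)\<^sup>2) * (A * (2 powr \<alpha> * ?t powr \<alpha>) * exp (\<tau> * (a - Re w)) +
      B * (2 powr \<beta> * ?t powr \<beta>) * exp (\<tau> * (b - Re w)) +
      K * (2 powr \<gamma> * ?t powr \<gamma>) * exp (\<bar>\<tau>\<bar> * (b - a) - (?t / 2)\<^sup>2))"
  proof (rule three_lines_rectangle[OF hol(1)])
    fix s assume s: "s \<in> cbox (Complex a (Im w - ?t / 2)) (Complex b (Im w + ?t / 2))"
    show "norm (f s) \<le> A * (2 powr \<alpha> * ?t powr \<alpha>)" if "Re s = a"
      using nonneg rectangle[OF s] that by (intro scale[OF left]) auto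
    show "norm (f s) \<le> B * (2 powr \<beta> * ?t powr \<beta>)" if "Re s = b"
      using nonneg rectangle[OF s] that by (intro scale[OF right]) auto
    show "norm (f s) \<le> K * (2 powr \<gamma> * ?t powr \<gamma>)"
      using nonneg rectangle[OF s] by (intro scale[OF strip]) auto
  qed (use rectangle hol(2) w in auto)
  also have "\<dots> = exp ((b - a)\<^sup>2) * (A * 2 powr \<alpha> * ?t powr e + B * 2 powr \<beta> * ?t powr e +
      K * 2 powr \<gamma> * (?t powr c * exp (- (?t / 2)\<^sup>2)))"
  proof -
    have "\<alpha> + \<kappa> * (a - Re w) = e" "\<beta> + \<kappa> * (b - Re w) = e"
      using ab by (simp_all add: e_def \<kappa>_def field_simps)
    hence "?t powr \<alpha> * exp (\<tau> * (a - Re w)) = ?t powr e" "?t powr \<beta> * exp (\<tau> * (b - Re w)) = ?t powr e"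
      by (simp_all only: exp_\<tau> powr_add[symmetric])
    moreover have "?t powr \<gamma> * exp (\<bar>\<tau>\<bar> * (b - a) - (?t / 2)\<^sup>2) = ?t powr c * exp (- (?t / 2)\<^sup>2)"
      unfolding diff_conv_add_uminus[of _ "(?t / 2)\<^sup>2"] exp_add exp_\<tau> c_def powr_add by (rule mult.assoc[symmetric])
    ultimately show ?thesis by (simp only: mult.assoc)
  qed
  also have "\<dots> \<le> exp ((b - a)\<^sup>2) * (A * 2 powr \<alpha> * ?t powr e + B * 2 powr \<beta> * ?t powr e +
      K * 2 powr \<gamma> * (exp (c\<^sup>2) * ?t powr e))"
    using nonneg ab w by (intro mult_left_mono add_left_mono powr_times_gaussian_le) (auto simp: c_def e_def)
  also have "\<dots> = exp ((b - a)\<^sup>2) * (A * 2 powr \<alpha> + B * 2 powr \<beta> + K * 2 powr \<gamma> * exp (c\<^sup>2)) * ?t powr e"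
    by (simp add: algebra_simps)
  finally show ?thesis .
qed

lemma vertical_growth_convexity:
  fixes f :: "complex \<Rightarrow> complex" and a b \<alpha> \<beta> \<gamma> :: real
  assumes ab: "a < b" and nonneg: "0 \<le> \<alpha>" "0 \<le> \<beta>" "0 \<le> \<gamma>"
    and hol: "f holomorphic_on U" "\<And>s. Re s \<in> {a..b} \<Longrightarrow> 1 \<le> \<bar>Im s\<bar> \<Longrightarrow> s \<in> U"
    and growth: "vertical_growth f {a..b} (\<lambda>_. \<gamma>)" "vertical_growth f {a} (\<lambda>_. \<alpha>)" "vertical_growth f {b} (\<lambda>_. \<beta>)"
  shows "vertical_growth f {a..b} (\<lambda>\<sigma>. (\<alpha> * (b - \<sigma>) + \<beta> * (\<sigma> - a)) / (b - a))"
proof -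
  define c where "c = \<gamma> + \<bar>(\<alpha> - \<beta>) / (b - a)\<bar> * (b - a)"
  obtain K where K: "1 \<le> K" "\<And>s. Re s \<in> {a..b} \<Longrightarrow> 1 \<le> \<bar>Im s\<bar> \<Longrightarrow> norm (f s) \<le> K * \<bar>Im s\<bar> powr \<gamma>"
    using growth(1) by (rule vertical_growthE) blast
  obtain A where A: "1 \<le> A" "\<And>s. Re s \<in> {a} \<Longrightarrow> 1 \<le> \<bar>Im s\<bar> \<Longrightarrow> norm (f s) \<le> A * \<bar>Im s\<bar> powr \<alpha>"
    using growth(2) by (rule vertical_growthE) blast
  obtain B where B: "1 \<le> B" "\<And>s. Re s \<in> {b} \<Longrightarrow> 1 \<le> \<bar>Im s\<bar> \<Longrightarrow> norm (f s) \<le> B * \<bar>Im s\<bar> powr \<beta>"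
    using growth(3) by (rule vertical_growthE) blast
  define L where "L = exp ((b - a)\<^sup>2) * (A * 2 powr \<alpha> + B * 2 powr \<beta> + K * 2 powr \<gamma> * exp (c\<^sup>2))"
  show ?thesis
  proof (rule vertical_growthI[of _ _ "max L (K * 2 powr \<gamma>)"])
    fix s assume s: "Re s \<in> {a..b}" "1 \<le> \<bar>Im s\<bar>"
    let ?T = "\<bar>Im s\<bar> powr ((\<alpha> * (b - Re s) + \<beta> * (Re s - a)) / (b - a))"
    show "norm (f s) \<le> max L (K * 2 powr \<gamma>) * ?T"
    proof (cases "2 \<le> \<bar>Im s\<bar>")
      case True
      have "norm (f s) \<le> L * ?T" unfolding L_def c_def
        by (rule three_lines_powr_bound[OF ab nonneg _ _ _ hol]) (use A B K s True in auto)
      also have "\<dots> \<le> max L (K * 2 powr \<gamma>) * ?T" by (intro mult_right_mono) auto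
      finally show ?thesis .
    next
      case False
      have "norm (f s) \<le> K * \<bar>Im s\<bar> powr \<gamma>" using K(2)[OF s] .
      also have "\<dots> \<le> K * 2 powr \<gamma>" using False K(1) nonneg by (intro mult_left_mono powr_mono2) auto
      also have "\<dots> \<le> max L (K * 2 powr \<gamma>) * 1" by simp
      also have "\<dots> \<le> max L (K * 2 powr \<gamma>) * ?T"
        using s ab nonneg K(1) by (intro mult_left_mono ge_one_powr_ge_zero) (auto simp: le_max_iff_disj)
      finally show ?thesis .
    qed
  qed
qed

lemma vertical_growth_zeta_linear:
  assumes "0 < a"
  shows "vertical_growth zeta {a..b} (\<lambda>_. 1)"
proof -
  obtain C where C: "0 \<le> C" "\<And>s. a \<le> Re s \<Longrightarrow> 1 \<le> \<bar>Im s\<bar> \<Longrightarrow> norm (zeta s) \<le> C * norm s"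
    by (rule norm_zeta_le_linear[OF assms]) blast
  show ?thesis
  proof (rule vertical_growthI[of _ _ "C * (1 + b)"])
    fix s assume s: "Re s \<in> {a..b}" "1 \<le> \<bar>Im s\<bar>"
    have "norm s \<le> Re s + \<bar>Im s\<bar>" using cmod_le[of s] s assms by simp
    also have "\<dots> \<le> b * \<bar>Im s\<bar> + \<bar>Im s\<bar>"
      using mult_mono[of "Re s" b 1 "\<bar>Im s\<bar>"] s assms by simp
    finally have "C * norm s \<le> C * ((1 + b) * \<bar>Im s\<bar>)"
      using C(1) by (intro mult_left_mono) (simp_all add: algebra_simps)
    thus "norm (zeta s) \<le> C * (1 + b) * \<bar>Im s\<bar> powr 1" using C(2)[of s] s by simp
  qed
qed

lemma vertical_growth_zeta_bounded: "1 < a \<Longrightarrow> vertical_growth zeta {a..} (\<lambda>_. 0)"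
  by (rule vertical_growthI[of _ _ "real_zeta a"]) (use norm_zeta_le_real_zeta in auto)

lemma vertical_growth_zeta_convexity:
  assumes "0 < a" "a < b" "0 \<le> \<alpha>" "0 \<le> \<beta>"
    and "vertical_growth zeta {a} (\<lambda>_. \<alpha>)" "vertical_growth zeta {b} (\<lambda>_. \<beta>)"
  shows "vertical_growth zeta {a..b} (\<lambda>\<sigma>. (\<alpha> * (b - \<sigma>) + \<beta> * (\<sigma> - a)) / (b - a))"
  by (rule vertical_growth_convexity[where \<gamma> = 1, OF _ _ _ _ zeta_holomorphic _ vertical_growth_zeta_linear])
    (use assms in auto)

lemma lindelof_hypothesis_iff_vertical_growth:
  "lindelof_hypothesis \<longleftrightarrow> (\<forall>\<epsilon>>0. vertical_growth zeta {1/2} (\<lambda>_. \<epsilon>))"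
  unfolding lindelof_hypothesis_def
proof (intro all_cong1 imp_cong refl iffI)
  fix \<epsilon> :: real assume \<epsilon>: "0 < \<epsilon>"
  assume "(\<lambda>t. norm (zeta (Complex (1/2) t))) \<in> O[at_infinity](\<lambda>t. \<bar>t\<bar> powr \<epsilon>)"
  then obtain c where "\<forall>\<^sub>F t in at_infinity. norm (norm (zeta (Complex (1/2) t))) \<le> c * norm (\<bar>t\<bar> powr \<epsilon>)"
    by (rule landau_o.bigE)
  then obtain T where T: "\<And>t. T \<le> \<bar>t\<bar> \<Longrightarrow> norm (zeta (Complex (1/2) t)) \<le> c * \<bar>t\<bar> powr \<epsilon>"
    by (auto simp: eventually_at_infinity)
  obtain C where C: "1 \<le> C" "\<And>s. Re s \<in> {1/2..1/2} \<Longrightarrow> 1 \<le> \<bar>Im s\<bar> \<Longrightarrow> norm (zeta s) \<le> C * \<bar>Im s\<bar> powr 1"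
    by (rule vertical_growthE[OF vertical_growth_zeta_linear[of "1/2" "1/2"]]) auto
  show "vertical_growth zeta {1/2} (\<lambda>_. \<epsilon>)"
  proof (rule vertical_growthI[of _ _ "max c (C * \<bar>T\<bar>)"])
    fix s assume s: "Re s \<in> {1/2}" "1 \<le> \<bar>Im s\<bar>"
    hence s_eq: "s = Complex (1/2) (Im s)" by (simp add: complex_eq_iff)
    have powr_ge_1: "1 \<le> \<bar>Im s\<bar> powr \<epsilon>" using s \<epsilon> by (intro ge_one_powr_ge_zero) auto
    show "norm (zeta s) \<le> max c (C * \<bar>T\<bar>) * \<bar>Im s\<bar> powr \<epsilon>"
    proof (cases "T \<le> \<bar>Im s\<bar>")
      case True
      have "norm (zeta s) \<le> c * \<bar>Im s\<bar> powr \<epsilon>" using T[OF True] s_eq by simp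
      also have "\<dots> \<le> max c (C * \<bar>T\<bar>) * \<bar>Im s\<bar> powr \<epsilon>"
        by (intro mult_right_mono) auto
      finally show ?thesis .
    next
      case False
      have "norm (zeta s) \<le> C * \<bar>Im s\<bar>" using C(2)[of s] s by simp
      also have "\<dots> \<le> max c (C * \<bar>T\<bar>) * 1" using False C(1) by (simp add: le_max_iff_disj)
      also have "\<dots> \<le> max c (C * \<bar>T\<bar>) * \<bar>Im s\<bar> powr \<epsilon>"
        using powr_ge_1 C(1) by (intro mult_left_mono) (auto simp: le_max_iff_disj)
      finally show ?thesis .
    qed
  qed
next
  fix \<epsilon> :: real assume "vertical_growth zeta {1/2} (\<lambda>_. \<epsilon>)"
  then obtain K where K: "\<And>s. Re s \<in> {1/2} \<Longrightarrow> 1 \<le> \<bar>Im s\<bar> \<Longrightarrow> norm (zeta s) \<le> K * \<bar>Im s\<bar> powr \<epsilon>"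
    by (rule vertical_growthE) blast
  have "norm (zeta (Complex (1/2) t)) \<le> K * \<bar>t\<bar> powr \<epsilon>" if "1 \<le> \<bar>t\<bar>" for t
    using K[of "Complex (1/2) t"] that by simp
  thus "(\<lambda>t. norm (zeta (Complex (1/2) t))) \<in> O[at_infinity](\<lambda>t. \<bar>t\<bar> powr \<epsilon>)"
    by (intro bigoI[of _ K]) (auto simp: eventually_at_infinity intro!: exI[of _ 1])
qed

lemma lindelof_half_plane:
  assumes "lindelof_hypothesis" "0 < \<epsilon>"
  shows "vertical_growth zeta {1/2..} (\<lambda>_. \<epsilon>)"
proof -
  have right: "vertical_growth zeta {2..} (\<lambda>_. \<epsilon>)"
    using assms(2) by (intro vertical_growth_mono[OF vertical_growth_zeta_bounded[of 2]]) auto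
  have "vertical_growth zeta {1/2..2} (\<lambda>\<sigma>. (\<epsilon> * (2 - \<sigma>) + \<epsilon> * (\<sigma> - 1/2)) / (2 - 1/2))"
    using assms right by (intro vertical_growth_zeta_convexity)
      (auto simp: lindelof_hypothesis_iff_vertical_growth elim: vertical_growth_mono)
  also have "(\<lambda>\<sigma>. (\<epsilon> * (2 - \<sigma>) + \<epsilon> * (\<sigma> - 1/2)) / (2 - 1/2)) = (\<lambda>_. \<epsilon>)"
    by (simp add: fun_eq_iff field_simps)
  finally have "vertical_growth zeta ({1/2..2} \<union> {2..}) (\<lambda>_. \<epsilon>)"
    using right by (rule vertical_growth_Un)
  also have "{1/2..2} \<union> {2..} = {1/2::real..}" by auto
  finally show ?thesis .
qed

lemma lindelof_if_right_of_line:
  assumes "\<And>\<delta> \<epsilon>. 0 < \<delta> \<Longrightarrow> 0 < \<epsilon> \<Longrightarrow> vertical_growth zeta {1/2 + \<delta>} (\<lambda>_. \<epsilon>)"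
  shows "lindelof_hypothesis"
  unfolding lindelof_hypothesis_iff_vertical_growth
proof (intro allI impI)
  fix \<epsilon> :: real assume \<epsilon>: "0 < \<epsilon>"
  define \<delta> where "\<delta> = \<epsilon> / 8"
  have \<delta>: "0 < \<delta>" using \<epsilon> by (simp add: \<delta>_def)
  have "vertical_growth zeta {1/4..1/2 + \<delta>} (\<lambda>\<sigma>. (1 * (1/2 + \<delta> - \<sigma>) + \<epsilon> / 2 * (\<sigma> - 1/4)) / (1/2 + \<delta> - 1/4))"
    using \<delta> \<epsilon> assms vertical_growth_zeta_linear[of "1/4" "1/4"]
    by (intro vertical_growth_zeta_convexity) auto
  thus "vertical_growth zeta {1/2} (\<lambda>_. \<epsilon>)"
  proof (rule vertical_growth_mono)
    have "0 \<le> \<epsilon> * \<delta>" using \<delta> \<epsilon> by simp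
    hence "\<delta> + \<epsilon> / 8 \<le> \<epsilon> * (1/4 + \<delta>)" by (simp add: \<delta>_def algebra_simps)
    hence "(1 * (1/2 + \<delta> - 1/2) + \<epsilon> / 2 * (1/2 - 1/4)) / (1/2 + \<delta> - 1/4) \<le> \<epsilon>"
      using \<delta> by (simp add: field_simps)
    thus "(1 * (1/2 + \<delta> - \<sigma>) + \<epsilon> / 2 * (\<sigma> - 1/4)) / (1/2 + \<delta> - 1/4) \<le> \<epsilon>" if "\<sigma> \<in> {1/2}" for \<sigma>
      by (simp only: singletonD[OF that])
  qed (use \<delta> in auto)
qed

section \<open>Taylor coefficients in the disc\<close>

definition lam_fps :: "nat \<Rightarrow> complex fps" where
  "lam_fps k = Abs_fps (\<lambda>j. lam j k / fact j)"

text \<open>The Taylor coefficients of \<open>(s - 1)\<^sup>k \<zeta>(s)\<^sup>k / s\<close> at \<open>s = 1\<close>.\<close>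

definition quot_coef :: "nat \<Rightarrow> nat \<Rightarrow> complex" where
  "quot_coef k m = (\<Sum>i\<le>m. (-1) ^ (m - i) * (lam i k / fact i))"

definition signed_ell :: "nat \<Rightarrow> nat \<Rightarrow> complex" where
  "signed_ell k n = (-1) ^ n * ell n k"

lemma quot_coef_alt: "quot_coef k m = (-1) ^ m * (\<Sum>i=0..m. (-1) ^ i * lam i k / fact i)"
  unfolding quot_coef_def sum_distrib_left atLeast0AtMost
  by (intro sum.cong) (auto simp: minus_one_power_iff)

lemma quot_coef_Suc: "quot_coef k (Suc m) + quot_coef k m = lam (Suc m) k / fact (Suc m)"
  by (simp add: quot_coef_alt algebra_simps minus_one_power_iff)

lemma a_coef_conv_quot_coef: "a_coef j k = quot_coef k (k - 1 - j)"
  by (simp add: a_coef_def quot_coef_alt)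

lemma signed_ell_0: "signed_ell k 0 = quot_coef k k"
  by (simp add: signed_ell_def ell_def quot_coef_alt)

lemma signed_ell_Suc: "signed_ell k (Suc n) = (\<Sum>j\<le>n. of_nat (n choose j) * (lam (Suc j + k) k / fact (Suc j + k)))"
proof -
  have "signed_ell k (Suc n) = (\<Sum>j=Suc 0..Suc n. of_nat (n choose (j - 1)) * lam (j + k) k / fact (j + k))"
    by (simp add: signed_ell_def ell_def power_add[symmetric] mult.assoc[symmetric] power_mult_distrib[symmetric])
  also have "\<dots> = (\<Sum>j=0..n. of_nat (n choose j) * lam (Suc j + k) k / fact (Suc j + k))"
    by (subst sum.shift_bounds_cl_Suc_ivl) simp
  finally show ?thesis by (simp add: atLeast0AtMost)
qed

lemma signed_ell_conv_quot_coef: "signed_ell k n = (\<Sum>m\<le>n. of_nat (n choose m) * quot_coef k (k + m))"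
proof (cases n)
  case 0 thus ?thesis by (simp add: signed_ell_0)
next
  case (Suc N)
  let ?b = "\<lambda>m. quot_coef k (k + m)"
  have "signed_ell k n = (\<Sum>j\<le>N. of_nat (N choose j) * ?b (Suc j)) + (\<Sum>j\<le>N. of_nat (N choose j) * ?b j)"
    unfolding Suc signed_ell_Suc sum.distrib[symmetric] distrib_left[symmetric]
  proof (intro sum.cong arg_cong2[where f = "(*)"] refl)
    fix j show "lam (Suc j + k) k / fact (Suc j + k) = ?b (Suc j) + ?b j"
      using quot_coef_Suc[of k "k + j"] by (simp only: add_Suc add_Suc_right add.commute[of j k])
  qed
  also have "(\<Sum>j\<le>N. of_nat (N choose j) * ?b j) = (\<Sum>j\<le>n. of_nat (N choose j) * ?b j)"
    by (simp add: Suc)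
  also have "\<dots> = ?b 0 + (\<Sum>j\<le>N. of_nat (N choose Suc j) * ?b (Suc j))"
    unfolding Suc by (subst sum.atMost_Suc_shift) simp
  also have "(\<Sum>j\<le>N. of_nat (N choose j) * ?b (Suc j)) + (?b 0 + (\<Sum>j\<le>N. of_nat (N choose Suc j) * ?b (Suc j)))
      = ?b 0 + (\<Sum>j\<le>N. of_nat (n choose Suc j) * ?b (Suc j))"
    by (simp add: Suc sum.distrib[symmetric] algebra_simps)
  also have "\<dots> = (\<Sum>m\<le>n. of_nat (n choose m) * ?b m)"
    unfolding Suc by (simp only: sum.atMost_Suc_shift) simp
  finally show ?thesis .
qed

lemma has_fps_expansion_zeta_pow_reg: "(\<lambda>w. zeta_pow_reg k (1 + w)) has_fps_expansion lam_fps k"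
proof -
  have "zeta_pow_reg k analytic_on {1}"
    using zeta_pow_reg_holomorphic[of k] analytic_on_open[OF open_UNIV] analytic_on_subset by blast
  from analytic_at_imp_has_fps_expansion[OF this] show ?thesis
    by (simp add: fps_expansion_def lam_fps_def lam_def)
qed

lemma has_fps_expansion_quot_coef:
  "(\<lambda>w. zeta_pow_reg k (1 + w) * inverse (1 + w)) has_fps_expansion Abs_fps (quot_coef k)"
proof -
  have "(\<lambda>w. zeta_pow_reg k (1 + w) * inverse (1 + w)) has_fps_expansion lam_fps k * inverse (1 + fps_X)"
    by (intro fps_expansion_intros has_fps_expansion_zeta_pow_reg) auto
  also have "lam_fps k * inverse (1 + fps_X) = Abs_fps (quot_coef k)"
    by (auto simp: fps_inverse_fps_X_plus1 fps_eq_iff fps_mult_nth lam_fps_def quot_coef_def atLeast0AtMost intro!: sum.cong)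
  finally show ?thesis .
qed

lemma fps_geometric_power_nth:
  "fps_nth ((Abs_fps (\<lambda>_. 1) :: 'a :: comm_ring_1 fps) ^ Suc i) n = of_nat ((n + i) choose i)"
proof (induction i arbitrary: n)
  case (Suc i)
  have "fps_nth ((Abs_fps (\<lambda>_. 1) :: 'a fps) ^ Suc (Suc i)) n = (\<Sum>j\<le>n. of_nat ((j + i) choose i))"
    unfolding power_Suc2[of _ "Suc i"] fps_mult_nth by (simp only: Suc atLeast0AtMost) simp
  also have "\<dots> = of_nat (\<Sum>j\<le>n. (i + j) choose j)"
    unfolding of_nat_sum
  proof (intro sum.cong arg_cong[where f = of_nat] refl)
    fix j show "(j + i) choose i = (i + j) choose j" using binomial_symmetric[of j "i + j"] by (simp add: add.commute)
  qed
  also have "\<dots> = of_nat ((n + Suc i) choose Suc i)"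
    unfolding sum_choose_lower using binomial_symmetric[of n "Suc (i + n)"] by (simp add: add_ac)
  finally show ?case .
qed simp

definition moebius_fps :: "'a :: comm_ring_1 fps" where
  "moebius_fps = fps_X * Abs_fps (\<lambda>_. 1)"

lemma has_fps_expansion_moebius: "(\<lambda>z::complex. z * inverse (1 - z)) has_fps_expansion moebius_fps"
  unfolding moebius_fps_def fps_inverse_one_minus_fps_X[symmetric] by (intro fps_expansion_intros) auto

lemma fps_compose_moebius_nth_0: "fps_nth (fps_compose F moebius_fps) 0 = fps_nth F 0"
  by (simp add: fps_compose_nth)

lemma fps_compose_moebius_nth_Suc:
  fixes F :: "'a :: comm_ring_1 fps"
  shows "fps_nth (fps_compose F moebius_fps) (Suc n) = (\<Sum>j\<le>n. of_nat (n choose j) * fps_nth F (Suc j))"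
proof -
  have "fps_nth ((moebius_fps :: 'a fps) ^ Suc j) (Suc n) = of_nat (n choose j)" for j
    unfolding moebius_fps_def power_mult_distrib fps_X_power_mult_nth fps_geometric_power_nth by (auto simp: binomial_eq_0)
  thus ?thesis
    unfolding fps_compose_nth atLeast0AtMost sum.atMost_Suc_shift
    by (simp add: mult.commute del: power_Suc)
qed

lemma has_fps_expansion_taylor_remainder:
  fixes f :: "complex \<Rightarrow> complex"
  assumes f: "f has_fps_expansion F"
  shows "(\<lambda>w. if w = 0 then fps_nth F k else (f w - (\<Sum>i<k. fps_nth F i * w ^ i)) / w ^ k)
    has_fps_expansion fps_shift k F"
proof -
  let ?T = "\<lambda>w. \<Sum>i<k. fps_nth F i * w ^ i" and ?g = "eval_fps (fps_shift k F)"
  have g: "?g has_fps_expansion fps_shift k F"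
    using f by (simp add: has_fps_expansion_def)
  have "(\<lambda>w. w ^ k * ?g w + ?T w) has_fps_expansion
      fps_X ^ k * fps_shift k F + (\<Sum>i<k. fps_const (fps_nth F i) * fps_X ^ i)"
    by (intro fps_expansion_intros g)
  also have "(\<Sum>i<k. fps_const (fps_nth F i) * fps_X ^ i) = fps_cutoff k F"
    by (simp add: fps_eq_iff fps_sum_nth mult_delta_right)
  finally have "(\<lambda>w. w ^ k * ?g w + ?T w) has_fps_expansion F"
    by (simp only: fps_shift_cutoff')
  hence "(\<lambda>w. w ^ k * ?g w + ?T w - f w) has_fps_expansion 0"
    using has_fps_expansion_diff[OF _ f] by fastforce
  hence "\<forall>\<^sub>F w in nhds 0. w ^ k * ?g w + ?T w = f w"
    by (simp add: has_fps_expansion_0_iff)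
  hence "\<forall>\<^sub>F w in nhds 0. (if w = 0 then fps_nth F k else (f w - ?T w) / w ^ k) = ?g w"
    by eventually_elim (auto simp: eval_fps_at_0 field_simps)
  with g show ?thesis by (subst has_fps_expansion_cong[OF _ refl])
qed

definition zeta_principal_part :: "nat \<Rightarrow> complex \<Rightarrow> complex" where
  "zeta_principal_part k s = (\<Sum>i<k. lam i k / fact i / (s - 1) ^ (k - i))"

text \<open>This is \<open>s F(s)\<close>, where \<open>F(s)\<close> is \<open>\<zeta>(s)\<^sup>k / s\<close> minus its principal part at \<open>s = 1\<close>.\<close>

definition zeta_pow_remainder :: "nat \<Rightarrow> complex \<Rightarrow> complex" where
  "zeta_pow_remainder k s =
     (if s = 1 then signed_ell k 0 else zeta s ^ k - zeta_principal_part k s - quot_coef k (k - 1))"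

lemma has_fps_expansion_zeta_pow_remainder:
  assumes "1 \<le> k"
  shows "(\<lambda>w. zeta_pow_remainder k (1 + w)) has_fps_expansion fps_shift k (lam_fps k) - fps_const (quot_coef k (k - 1))"
proof -
  let ?F = "lam_fps k" and ?b = "quot_coef k (k - 1)"
  have "zeta_principal_part k (1 + w) = (\<Sum>i<k. fps_nth ?F i * w ^ i) / w ^ k" if "w \<noteq> 0" for w
    unfolding zeta_principal_part_def sum_divide_distrib
  proof (intro sum.cong refl)
    fix i assume "i \<in> {..<k}"
    hence "w ^ k = w ^ (k - i) * w ^ i" by (simp add: power_add[symmetric])
    thus "lam i k / fact i / (1 + w - 1) ^ (k - i) = fps_nth ?F i * w ^ i / w ^ k"
      using that by (simp add: lam_fps_def)
  qed
  moreover have "signed_ell k 0 = fps_nth ?F k - ?b"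
    using assms quot_coef_Suc[of k "k - 1"] by (simp add: signed_ell_0 lam_fps_def eq_diff_eq)
  ultimately have "zeta_pow_remainder k (1 + w) =
      (if w = 0 then fps_nth ?F k else (zeta_pow_reg k (1 + w) - (\<Sum>i<k. fps_nth ?F i * w ^ i)) / w ^ k) - ?b" for w
    by (simp add: zeta_pow_remainder_def zeta_pow_reg_def diff_divide_distrib)
  thus ?thesis
    using has_fps_expansion_diff[OF has_fps_expansion_taylor_remainder[OF has_fps_expansion_zeta_pow_reg] has_fps_expansion_const]
    by (simp only:)
qed

lemma zeta_pow_remainder_holomorphic:
  assumes "1 \<le> k"
  shows "zeta_pow_remainder k holomorphic_on UNIV"
proof -
  have "zeta_pow_remainder k holomorphic_on - {1}"
  proof (rule holomorphic_transform)
    show "(\<lambda>s. zeta s ^ k - zeta_principal_part k s - quot_coef k (k - 1)) holomorphic_on - {1}"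
      unfolding zeta_principal_part_def by (intro holomorphic_intros zeta_holomorphic) auto
  qed (auto simp: zeta_pow_remainder_def)
  hence "zeta_pow_remainder k analytic_on - {1}" by (subst analytic_on_open) auto
  moreover have "zeta_pow_remainder k analytic_on {1}"
    using has_fps_expansion_imp_analytic[OF has_fps_expansion_zeta_pow_remainder[OF assms]] .
  ultimately have "zeta_pow_remainder k analytic_on (- {1} \<union> {1})" by (simp only: analytic_on_Un)
  thus ?thesis by (intro analytic_imp_holomorphic) (simp add: Un_commute)
qed

lemma zeta_pow_remainder_sums:
  assumes k: "1 \<le> k" and z: "norm z < 1"
  shows "(\<lambda>n. signed_ell k n * z ^ n) sums zeta_pow_remainder k (1 / (1 - z))"
proof -
  let ?F = "fps_shift k (lam_fps k) - fps_const (quot_coef k (k - 1))"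
  let ?f = "(\<lambda>w. zeta_pow_remainder k (1 + w)) \<circ> (\<lambda>z. z * inverse (1 - z))"
  have "?f has_fps_expansion fps_compose ?F moebius_fps"
    by (intro has_fps_expansion_compose has_fps_expansion_zeta_pow_remainder has_fps_expansion_moebius k)
      (simp add: moebius_fps_def)
  moreover have "?f holomorphic_on eball 0 1"
    unfolding o_def
    by (intro holomorphic_on_compose_gen[OF _ zeta_pow_remainder_holomorphic[OF k], unfolded o_def] holomorphic_intros) auto
  ultimately have "(\<lambda>n. fps_nth (fps_compose ?F moebius_fps) n * z ^ n) sums ?f z"
    by (rule has_fps_expansion_imp_sums_complex) (use z in \<open>simp add: one_ereal_def\<close>)
  moreover have "fps_nth (fps_compose ?F moebius_fps) n = signed_ell k n" for n
  proof (cases n)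
    case 0
    thus ?thesis
      using k quot_coef_Suc[of k "k - 1"] by (simp add: fps_compose_moebius_nth_0 signed_ell_0 lam_fps_def diff_eq_eq)
  qed (simp add: fps_compose_moebius_nth_Suc signed_ell_Suc lam_fps_def)
  moreover have "1 + z * inverse (1 - z) = 1 / (1 - z)"
  proof -
    have "1 - z \<noteq> 0" using z by auto
    thus ?thesis by (simp add: field_simps)
  qed
  ultimately show ?thesis by (simp only: o_def)
qed

lemma bounded_zeta_pow_diff_remainder:
  "bounded ((\<lambda>s. zeta s ^ k - zeta_pow_remainder k s) ` {s. 1 \<le> norm (s - 1)})"
proof (rule boundedI)
  fix y assume "y \<in> (\<lambda>s. zeta s ^ k - zeta_pow_remainder k s) ` {s. 1 \<le> norm (s - 1)}"
  then obtain s where s: "1 \<le> norm (s - 1)" and y: "y = zeta s ^ k - zeta_pow_remainder k s" by blast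
  have "norm (zeta_principal_part k s) \<le> (\<Sum>i<k. norm (lam i k / fact i))"
    unfolding zeta_principal_part_def
  proof (intro order_trans[OF norm_sum] sum_mono)
    fix i
    have "norm (lam i k / fact i) / norm (s - 1) ^ (k - i) \<le> norm (lam i k / fact i) / 1"
      by (rule frac_le[OF norm_ge_zero order_refl zero_less_one one_le_power[OF s]])
    thus "norm (lam i k / fact i / (s - 1) ^ (k - i)) \<le> norm (lam i k / fact i)"
      by (simp only: norm_divide norm_power div_by_1)
  qed
  moreover have "y = zeta_principal_part k s + quot_coef k (k - 1)"
    using s by (auto simp: y zeta_pow_remainder_def)
  ultimately show "norm y \<le> (\<Sum>i<k. norm (lam i k / fact i)) + norm (quot_coef k (k - 1))"
    using norm_triangle_ineq order_trans add_right_mono by blast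
qed

lemma vertical_growth_zeta_pow_remainder_iff:
  assumes "\<And>\<sigma>. \<sigma> \<in> S \<Longrightarrow> 0 \<le> \<mu> \<sigma>"
  shows "vertical_growth (zeta_pow_remainder k) S \<mu> \<longleftrightarrow> vertical_growth (\<lambda>s. zeta s ^ k) S \<mu>"
proof -
  have "{s. 1 \<le> \<bar>Im s\<bar>} \<subseteq> {s. 1 \<le> norm (s - 1)}"
    using abs_Im_le_cmod[of "s - 1" for s] by (auto intro: order_trans)
  hence "bounded ((\<lambda>s. zeta s ^ k - zeta_pow_remainder k s) ` {s. 1 \<le> \<bar>Im s\<bar>})"
    by (rule bounded_subset[OF bounded_zeta_pow_diff_remainder image_mono])
  moreover from this have "bounded ((\<lambda>s. zeta_pow_remainder k s - zeta s ^ k) ` {s. 1 \<le> \<bar>Im s\<bar>})"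
    by (simp add: bounded_iff norm_minus_commute)
  ultimately show ?thesis by (auto intro: vertical_growth_if_bounded_diff[OF _ assms])
qed

section \<open>From mean square convergence to the growth of zeta\<close>

definition poisson_weight :: "nat \<Rightarrow> real \<Rightarrow> real" where
  "poisson_weight n x = exp (- x) * x ^ n / fact n"

lemma poisson_weight_nonneg: "0 \<le> x \<Longrightarrow> 0 \<le> poisson_weight n x"
  by (simp add: poisson_weight_def)

lemma poisson_weight_sums: "(\<lambda>n. poisson_weight n x) sums 1"
  using sums_mult[OF exp_converges[of x], of "exp (- x)"] by (simp add: poisson_weight_def exp_minus field_simps)

lemma poisson_weight_measurable [measurable]: "poisson_weight n \<in> borel_measurable borel"
  unfolding poisson_weight_def[abs_def] by measurable

lemma nn_integral_poisson_weight: "(\<integral>\<^sup>+x\<in>{0..}. ennreal (poisson_weight n x) \<partial>lborel) = 1"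
proof -
  have "(\<integral>\<^sup>+x\<in>{0..}. ennreal (poisson_weight n x) \<partial>lborel)
      = (\<integral>\<^sup>+x. ennreal (1 / fact n) * (ennreal (x ^ n * exp (- x)) * indicator {0..} x) \<partial>lborel)"
    by (intro nn_integral_cong) (auto simp: poisson_weight_def indicator_def ennreal_mult'[symmetric] mult_ac)
  also have "\<dots> = ennreal (1 / fact n) * ennreal (fact n)"
    using nn_intergal_power_times_exp_Ici[of n] by (subst nn_integral_cmult) auto
  also have "\<dots> = 1" by (simp add: ennreal_mult'[symmetric])
  finally show ?thesis .
qed

lemma poisson_weight_half_square:
  "(poisson_weight n (x / 2))\<^sup>2 = real ((2 * n) choose n) / 4 ^ n * poisson_weight (2 * n) x"
proof -
  have "real ((2 * n) choose n) = fact (2 * n) / (fact n * fact n)"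
    by (subst binomial_fact) (auto simp: mult_2)
  moreover have "exp (- x) = (exp (- (x / 2)))\<^sup>2" by (simp add: exp_double[symmetric])
  moreover have "x ^ (2 * n) = (x ^ n)\<^sup>2" by (simp add: power_mult[symmetric] mult.commute)
  moreover have "(4::real) ^ n = (2 ^ n)\<^sup>2" by (simp add: power2_eq_square power_mult_distrib[symmetric])
  ultimately show ?thesis
    by (simp add: poisson_weight_def power_divide power_mult_distrib field_simps power2_eq_square)
qed

lemma nn_integral_poisson_weight_square:
  "(\<integral>\<^sup>+x\<in>{0..}. ennreal ((poisson_weight n x)\<^sup>2) \<partial>lborel) = ennreal (real ((2 * n) choose n) / (2 * 4 ^ n))"
proof -
  let ?c = "real ((2 * n) choose n) / 4 ^ n"
  have "(\<integral>\<^sup>+x\<in>{0..}. ennreal ((poisson_weight n x)\<^sup>2) \<partial>lborel)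
      = ennreal \<bar>1/2\<bar> * (\<integral>\<^sup>+x. ennreal ((poisson_weight n (0 + 1/2 * x))\<^sup>2) * indicator {0..} (0 + 1/2 * x) \<partial>lborel)"
    by (rule nn_integral_real_affine[where t = 0 and c = "1/2"]) auto
  also have "(\<integral>\<^sup>+x. ennreal ((poisson_weight n (0 + 1/2 * x))\<^sup>2) * indicator {0..} (0 + 1/2 * x) \<partial>lborel)
      = (\<integral>\<^sup>+x. ennreal ?c * (ennreal (poisson_weight (2 * n) x) * indicator {0..} x) \<partial>lborel)"
    using poisson_weight_half_square[of n] by (intro nn_integral_cong) (auto simp: indicator_def ennreal_mult'[symmetric])
  also have "\<dots> = ennreal ?c * 1"
    by (subst nn_integral_cmult) (auto simp: nn_integral_poisson_weight)
  also have "ennreal \<bar>1/2\<bar> * (ennreal ?c * 1) = ennreal (real ((2 * n) choose n) / (2 * 4 ^ n))"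
    unfolding mult_1_right by (subst ennreal_mult'[symmetric]) (simp_all add: field_simps)
  finally show ?thesis .
qed

definition sq_dist :: "(real \<Rightarrow> complex) \<Rightarrow> (real \<Rightarrow> complex) \<Rightarrow> ennreal" where
  "sq_dist f g = (\<integral>\<^sup>+x\<in>{0..}. ennreal ((cmod (f x - g x))\<^sup>2) \<partial>lborel)"

lemma sq_dist_triangle:
  assumes [measurable]: "f \<in> borel_measurable borel" "g \<in> borel_measurable borel" "h \<in> borel_measurable borel"
  shows "sq_dist f g \<le> 2 * sq_dist f h + 2 * sq_dist g h"
proof -
  have "ennreal ((cmod (f x - g x))\<^sup>2) \<le> 2 * ennreal ((cmod (f x - h x))\<^sup>2) + 2 * ennreal ((cmod (g x - h x))\<^sup>2)" for x
  proof -
    let ?a = "cmod (f x - h x)" and ?b = "cmod (g x - h x)"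
    have "cmod (f x - g x) \<le> ?a + ?b" using norm_triangle_ineq4[of "f x - h x" "g x - h x"] by simp
    hence "(cmod (f x - g x))\<^sup>2 \<le> (?a + ?b)\<^sup>2" by (intro power_mono) auto
    also have "\<dots> \<le> 2 * ?a\<^sup>2 + 2 * ?b\<^sup>2"
      using zero_le_power2[of "?a - ?b"] by (simp add: power2_eq_square algebra_simps)
    finally have "ennreal ((cmod (f x - g x))\<^sup>2) \<le> ennreal (2 * ?a\<^sup>2 + 2 * ?b\<^sup>2)"
      by (rule ennreal_leI)
    also have "\<dots> = 2 * ennreal (?a\<^sup>2) + 2 * ennreal (?b\<^sup>2)"
      by (subst ennreal_plus) (auto simp: ennreal_mult')
    finally show ?thesis .
  qed
  hence "sq_dist f g \<le> (\<integral>\<^sup>+x. 2 * (ennreal ((cmod (f x - h x))\<^sup>2) * indicator {0..} x)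
      + 2 * (ennreal ((cmod (g x - h x))\<^sup>2) * indicator {0..} x) \<partial>lborel)"
    unfolding sq_dist_def by (intro nn_integral_mono) (auto simp: indicator_def)
  also have "\<dots> = 2 * sq_dist f h + 2 * sq_dist g h"
    unfolding sq_dist_def by (subst nn_integral_add; simp add: nn_integral_cmult)
  finally show ?thesis .
qed

lemma bessel_J0_measurable [measurable]: "bessel_J0 \<in> borel_measurable borel"
  unfolding bessel_J0_def[abs_def] by measurable

lemma Delta_measurable [measurable]: "Delta k \<in> borel_measurable borel"
proof -
  have "(\<lambda>x::real. nat \<lfloor>x\<rfloor>) \<in> measurable borel (count_space UNIV)" by measurable
  moreover have "(\<lambda>m. complex_of_nat (\<Sum>n=1..m. dk k n)) \<in> borel_measurable (count_space UNIV)" by simp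
  ultimately have [measurable]: "(\<lambda>x::real. complex_of_nat (\<Sum>n=1..nat \<lfloor>x\<rfloor>. dk k n)) \<in> borel_measurable borel"
    by (rule measurable_compose)
  show ?thesis unfolding Delta_def[abs_def] P_poly_def by measurable
qed

lemma phi_measurable [measurable]: "phi k \<in> borel_measurable borel"
  unfolding phi_def[abs_def] set_lebesgue_integral_def
  by (rule sigma_finite_measure.borel_measurable_lebesgue_integral[OF sigma_finite_lborel]) measurable

lemma phi_N_measurable [measurable]: "phi_N N k \<in> borel_measurable borel"
  unfolding phi_N_def[abs_def] by measurable

lemma phi_N_conv_poisson_weight: "phi_N N k x = (\<Sum>n\<le>N. signed_ell k n * of_real (poisson_weight n x))"
  unfolding phi_N_def sum_distrib_left atLeast0AtMost
  by (intro sum.cong) (auto simp: signed_ell_def poisson_weight_def)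

lemma sq_dist_phi_N_Suc:
  "sq_dist (phi_N (Suc N) k) (phi_N N k) =
    ennreal ((norm (signed_ell k (Suc N)))\<^sup>2 * (real ((2 * Suc N) choose Suc N) / (2 * 4 ^ Suc N)))"
proof -
  let ?n = "Suc N" and ?c = "(norm (signed_ell k (Suc N)))\<^sup>2"
  have "(cmod (phi_N ?n k x - phi_N N k x))\<^sup>2 = ?c * (poisson_weight ?n x)\<^sup>2" for x
    unfolding phi_N_conv_poisson_weight by (simp add: norm_mult power_mult_distrib)
  hence "sq_dist (phi_N ?n k) (phi_N N k) =
      (\<integral>\<^sup>+x. ennreal ?c * (ennreal ((poisson_weight ?n x)\<^sup>2) * indicator {0..} x) \<partial>lborel)"
    unfolding sq_dist_def by (simp only: ennreal_mult' zero_le_power2 mult.assoc)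
  also have "\<dots> = ennreal ?c * (\<integral>\<^sup>+x\<in>{0..}. ennreal ((poisson_weight ?n x)\<^sup>2) \<partial>lborel)"
    by (rule nn_integral_cmult) measurable
  also have "\<dots> = ennreal (?c * (real ((2 * ?n) choose ?n) / (2 * 4 ^ ?n)))"
    by (simp only: nn_integral_poisson_weight_square ennreal_mult' zero_le_power2)
  finally show ?thesis .
qed

lemma norm_signed_ell_le_sq_dist:
  assumes "sq_dist (phi_N (Suc N) k) (phi_N N k) < 1"
  shows "norm (signed_ell k (Suc N)) \<le> 2 * real (Suc (Suc N))"
proof -
  let ?n = "Suc N" and ?c = "(norm (signed_ell k (Suc N)))\<^sup>2"
  have "4 ^ ?n / (2 * real ?n) \<le> real ((2 * ?n) choose ?n)" by (rule central_binomial_lower_bound) simp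
  hence "1 / (4 * real ?n) \<le> real ((2 * ?n) choose ?n) / (2 * 4 ^ ?n)"
    by (simp add: field_simps del: binomial_Suc_Suc of_nat_Suc power_Suc)
  from mult_left_mono[OF this, of ?c]
  have "ennreal (?c * (1 / (4 * real ?n))) \<le> sq_dist (phi_N ?n k) (phi_N N k)"
    unfolding sq_dist_phi_N_Suc by (intro ennreal_leI) simp
  also have "\<dots> < ennreal 1" using assms by simp
  finally have "?c * (1 / (4 * real ?n)) < 1" by (subst (asm) ennreal_less_iff) simp_all
  hence "?c < 4 * real ?n" by (simp add: field_simps)
  also have "\<dots> \<le> (2 * real (Suc ?n))\<^sup>2" by (simp add: power2_eq_square algebra_simps)
  finally have "?c \<le> (2 * real (Suc ?n))\<^sup>2" by (rule less_imp_le)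
  thus ?thesis by (rule power2_le_imp_le) simp
qed

lemma signed_ell_linear_growth:
  assumes lim: "(\<lambda>N. sq_dist (phi_N N k) (phi k)) \<longlonglongrightarrow> 0"
  shows "Bseq (\<lambda>n. signed_ell k n / of_nat (Suc n))"
proof -
  have "(\<lambda>N. 2 * sq_dist (phi_N (Suc N) k) (phi k) + 2 * sq_dist (phi_N N k) (phi k)) \<longlonglongrightarrow> 2 * 0 + 2 * 0"
    using lim by (intro tendsto_add ennreal_tendsto_cmult LIMSEQ_Suc) auto
  hence "\<forall>\<^sub>F N in sequentially. 2 * sq_dist (phi_N (Suc N) k) (phi k) + 2 * sq_dist (phi_N N k) (phi k) < 1"
    by (intro order_tendstoD(2)) auto
  hence "\<forall>\<^sub>F N in sequentially. norm (signed_ell k (Suc N) / of_nat (Suc (Suc N))) \<le> norm (2 :: real)"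
  proof eventually_elim
    case (elim N)
    hence "sq_dist (phi_N (Suc N) k) (phi_N N k) < 1"
      by (intro le_less_trans[OF sq_dist_triangle[of _ _ "phi k"]]) auto
    from norm_signed_ell_le_sq_dist[OF this] show ?case
      by (simp add: norm_divide divide_simps del: of_nat_Suc)
  qed
  hence "Bseq (\<lambda>N. signed_ell k (Suc N) / of_nat (Suc (Suc N)))"
    by (rule Bseq_eventually_mono) (rule Bfun_const)
  thus ?thesis by (subst (asm) Bseq_Suc_iff)
qed

lemma norm_moebius_gap:
  assumes "1/2 < Re s"
  shows "(Re s - 1/2) / (norm s)\<^sup>2 \<le> 1 - norm (1 - 1 / s)"
proof -
  define q where "q = (2 * Re s - 1) / (norm s)\<^sup>2"
  have s: "s \<noteq> 0" using assms by auto
  have "(norm (s - 1))\<^sup>2 = (norm s)\<^sup>2 - (2 * Re s - 1)"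
    by (simp add: cmod_power2) (simp add: power2_eq_square algebra_simps)
  moreover have "1 - 1 / s = (s - 1) / s" using s by (simp add: diff_divide_distrib)
  ultimately have "(norm (1 - 1 / s))\<^sup>2 = ((norm s)\<^sup>2 - (2 * Re s - 1)) / (norm s)\<^sup>2"
    by (simp only: norm_divide power_divide)
  hence norm_sq: "(norm (1 - 1 / s))\<^sup>2 = 1 - q" using s by (simp add: q_def diff_divide_distrib)
  have "norm (1 - 1 / s) \<le> 1 - q / 2"
  proof (rule power2_le_imp_le)
    show "(norm (1 - 1 / s))\<^sup>2 \<le> (1 - q / 2)\<^sup>2"
      unfolding norm_sq by (simp add: power2_eq_square algebra_simps)
    have "q \<le> 1" using norm_sq by (metis diff_ge_0_iff_ge zero_le_power2)
    thus "0 \<le> 1 - q / 2" by simp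
  qed
  moreover have "q / 2 = (Re s - 1/2) / (norm s)\<^sup>2" by (simp add: q_def field_simps)
  ultimately show ?thesis by linarith
qed

lemma norm_power_series_le_if_linear_coefs:
  fixes c :: "nat \<Rightarrow> 'a :: {banach, real_normed_field}"
  assumes c: "\<And>n. norm (c n) \<le> K * real (Suc n)" and z: "norm z < 1" and sums: "(\<lambda>n. c n * z ^ n) sums h"
  shows "norm h \<le> K / (1 - norm z)\<^sup>2"
proof -
  have majorant: "(\<lambda>n. K * (real (Suc n) * norm z ^ n)) sums (K * (1 / (1 - norm z)\<^sup>2))"
    using geometric_deriv_sums[of "norm z"] z by (intro sums_mult) auto
  have "norm (\<Sum>n. c n * z ^ n) \<le> (\<Sum>n. K * (real (Suc n) * norm z ^ n))"
  proof (rule norm_suminf_le)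
    fix n show "norm (c n * z ^ n) \<le> K * (real (Suc n) * norm z ^ n)"
      using mult_right_mono[OF c[of n], of "norm z ^ n"] by (simp add: norm_mult norm_power mult_ac)
  qed (use majorant in \<open>simp add: sums_iff\<close>)
  thus ?thesis using majorant sums by (simp add: sums_iff)
qed

lemma vertical_growth_if_linear_coefs:
  fixes f :: "complex \<Rightarrow> complex"
  assumes f: "\<And>z. norm z < 1 \<Longrightarrow> (\<lambda>n. c n * z ^ n) sums f (1 / (1 - z))"
    and c: "Bseq (\<lambda>n. c n / of_nat (Suc n))" and \<delta>: "0 < \<delta>"
  shows "vertical_growth f {1/2 + \<delta>} (\<lambda>_. 4)"
proof -
  obtain K where K: "0 < K" "\<And>n. norm (c n / of_nat (Suc n)) \<le> K" using c by (rule BseqE) blast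
  have c_le: "norm (c n) \<le> K * real (Suc n)" for n
    using K(2)[of n] by (simp add: norm_divide divide_le_eq del: of_nat_Suc)
  show ?thesis
  proof (rule vertical_growthI[of _ _ "K * (2 + \<delta>) ^ 4 / \<delta>\<^sup>2"])
    fix s assume s: "Re s \<in> {1/2 + \<delta>}" "1 \<le> \<bar>Im s\<bar>"
    hence s_nz: "s \<noteq> 0" by auto
    let ?z = "1 - 1 / s"
    have gap: "\<delta> / (norm s)\<^sup>2 \<le> 1 - norm ?z" using norm_moebius_gap[of s] s \<delta> by simp
    have gap_pos: "0 < \<delta> / (norm s)\<^sup>2" using \<delta> s_nz by simp
    hence "norm ?z < 1" using gap by linarith
    hence "norm (f s) \<le> K / (1 - norm ?z)\<^sup>2"
      using f[of ?z] by (intro norm_power_series_le_if_linear_coefs[OF c_le]) auto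
    also have "\<dots> \<le> K / (\<delta> / (norm s)\<^sup>2)\<^sup>2"
      using gap gap_pos K(1) by (intro divide_left_mono power_mono mult_pos_pos zero_less_power) auto
    also have "\<dots> = K * norm s ^ 4 / \<delta>\<^sup>2" by (simp add: power_divide)
    also have "\<dots> \<le> K * ((2 + \<delta>) * \<bar>Im s\<bar>) ^ 4 / \<delta>\<^sup>2"
    proof -
      have "norm s \<le> \<bar>Re s\<bar> + \<bar>Im s\<bar>" by (rule cmod_le)
      also have "\<bar>Re s\<bar> \<le> (1 + \<delta>) * 1" using s \<delta> by simp
      also have "\<dots> \<le> (1 + \<delta>) * \<bar>Im s\<bar>" using s \<delta> by (intro mult_left_mono) auto
      finally show ?thesis using K(1)
        by (intro divide_right_mono mult_left_mono power_mono) (simp_all add: algebra_simps)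
    qed
    also have "\<dots> = K * (2 + \<delta>) ^ 4 / \<delta>\<^sup>2 * \<bar>Im s\<bar> powr 4"
      using s by (simp add: power_mult_distrib)
    finally show "norm (f s) \<le> K * (2 + \<delta>) ^ 4 / \<delta>\<^sup>2 * \<bar>Im s\<bar> powr 4" .
  qed
qed

lemma lindelof_if_sq_dist_tendsto_0:
  assumes "\<And>k. 1 \<le> k \<Longrightarrow> (\<lambda>N. sq_dist (phi_N N k) (phi k)) \<longlonglongrightarrow> 0"
  shows "lindelof_hypothesis"
proof (rule lindelof_if_right_of_line)
  fix \<delta> \<epsilon> :: real assume \<delta>: "0 < \<delta>" and \<epsilon>: "0 < \<epsilon>"
  obtain k :: nat where k: "4 / \<epsilon> < real k" using reals_Archimedean2 by blast
  have k_ge: "1 \<le> k" using k \<epsilon> by (cases k) (auto simp: field_simps)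
  have "vertical_growth (zeta_pow_remainder k) {1/2 + \<delta>} (\<lambda>_. 4)"
    using zeta_pow_remainder_sums[OF k_ge] signed_ell_linear_growth[OF assms[OF k_ge]] \<delta>
    by (rule vertical_growth_if_linear_coefs)
  hence "vertical_growth (\<lambda>s. zeta s ^ k) {1/2 + \<delta>} (\<lambda>_. 4)"
    by (simp add: vertical_growth_zeta_pow_remainder_iff)
  hence "vertical_growth (\<lambda>s. zeta s ^ k) {1/2 + \<delta>} (\<lambda>_. real k * \<epsilon>)"
    by (rule vertical_growth_mono) (use k \<epsilon> in \<open>auto simp: field_simps\<close>)
  thus "vertical_growth zeta {1/2 + \<delta>} (\<lambda>_. \<epsilon>)"
    using vertical_growth_power_iff[OF k_ge, where \<mu> = "\<lambda>_. \<epsilon>"] by blast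
qed

section \<open>Summatory functions of generalised divisor functions\<close>

text \<open>\<open>mconv_count\<close> and \<open>mconv_leb\<close> are multiplicative convolution with counting and Lebesgue measure on
  \<open>[1, \<infinity>)\<close>; in the latter, \<open>v = x / t\<close> has been substituted. They commute, the summatory function of \<open>d\<^sub>k\<close>
  is the \<open>k\<close>-th \<open>mconv_count\<close>-iterate of the unit step, and expanding \<open>mconv_count = mconv_leb + mconv_diff\<close>
  produces the main term, because iterates of \<open>mconv_diff\<close> on the unit step save a power of \<open>x\<close> while
  \<open>mconv_leb\<close> only contributes polynomials in \<open>ln x\<close>.\<close>

definition mconv_count :: "(real \<Rightarrow> real) \<Rightarrow> real \<Rightarrow> real" where
  "mconv_count f x = (\<Sum>n=1..nat \<lfloor>x\<rfloor>. f (x / real n))"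

definition mconv_leb :: "(real \<Rightarrow> real) \<Rightarrow> real \<Rightarrow> real" where
  "mconv_leb f x = x * integral {0..x} (\<lambda>v. f v / v\<^sup>2)"

definition mconv_diff :: "(real \<Rightarrow> real) \<Rightarrow> real \<Rightarrow> real" where
  "mconv_diff f x = mconv_count f x - mconv_leb f x"

definition summatory :: "(real \<Rightarrow> real) \<Rightarrow> bool" where
  "summatory f \<longleftrightarrow> mono f \<and> (\<forall>x<1. f x = 0) \<and> (\<forall>\<epsilon>>0. \<exists>C. \<forall>x\<ge>1. f x \<le> C * x powr (1 + \<epsilon>))"

lemma summatoryI:
  assumes "\<And>x y. x \<le> y \<Longrightarrow> f x \<le> f y" "\<And>x. x < 1 \<Longrightarrow> f x = 0"
    and "\<And>\<epsilon>. 0 < \<epsilon> \<Longrightarrow> \<exists>C. \<forall>x\<ge>1. f x \<le> C * x powr (1 + \<epsilon>)"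
  shows "summatory f"
  using assms by (simp add: summatory_def mono_def)

lemma summatory_mono: "summatory f \<Longrightarrow> x \<le> y \<Longrightarrow> f x \<le> f y"
  by (auto simp: summatory_def mono_def)

lemma summatory_eq_0: "summatory f \<Longrightarrow> x < 1 \<Longrightarrow> f x = 0"
  by (auto simp: summatory_def)

lemma summatory_nonneg: "summatory f \<Longrightarrow> 0 \<le> f x"
  using summatory_mono[of f "min 0 x" x] summatory_eq_0[of f "min 0 x"] by simp

lemma summatory_boundE:
  assumes "summatory f" "0 < \<epsilon>"
  obtains C where "0 \<le> C" "\<And>x. 1 \<le> x \<Longrightarrow> f x \<le> C * x powr (1 + \<epsilon>)"
proof -
  obtain C where C: "\<And>x. 1 \<le> x \<Longrightarrow> f x \<le> C * x powr (1 + \<epsilon>)"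
    using assms unfolding summatory_def by blast
  have "f x \<le> \<bar>C\<bar> * x powr (1 + \<epsilon>)" if "1 \<le> x" for x
    using that by (intro order_trans[OF C] mult_right_mono) auto
  thus thesis by (intro that[of "\<bar>C\<bar>"]) auto
qed

lemma summatory_measurable: "summatory f \<Longrightarrow> f \<in> borel_measurable borel"
  by (intro borel_measurable_mono) (simp add: summatory_def)

lemma borel_dominated_integrable_on:
  fixes f g :: "real \<Rightarrow> real"
  assumes "f \<in> borel_measurable borel" "S \<in> sets borel" "g integrable_on S" "\<And>v. v \<in> S \<Longrightarrow> \<bar>f v\<bar> \<le> g v"
  shows "f integrable_on S"
proof (rule measurable_bounded_by_integrable_imp_integrable)
  show "f \<in> borel_measurable (lebesgue_on S)"
    using assms(1) by (intro measurable_restrict_space1 measurable_completion) simp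
qed (use assms in auto)

lemma summatory_integrable:
  assumes f: "summatory f"
  shows "(\<lambda>v. f v / v\<^sup>2) integrable_on {a..b}"
proof (rule borel_dominated_integrable_on)
  show "(\<lambda>v. f v / v\<^sup>2) \<in> borel_measurable borel"
    using summatory_measurable[OF f] by measurable
  show "(\<lambda>_. f b) integrable_on {a..b}" by (rule integrable_const_ivl)
  fix v assume v: "v \<in> {a..b}"
  show "\<bar>f v / v\<^sup>2\<bar> \<le> f b"
  proof (cases "v < 1")
    case True thus ?thesis using summatory_eq_0[OF f] summatory_nonneg[OF f] by simp
  next
    case False
    hence "f v / v\<^sup>2 \<le> f v / 1" using summatory_nonneg[OF f] by (intro divide_left_mono) auto
    also have "\<dots> \<le> f b" using v summatory_mono[OF f] by auto
    finally show ?thesis using summatory_nonneg[OF f] by simp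
  qed
qed simp

lemma summatory_add:
  assumes f: "summatory f" and g: "summatory g"
  shows "summatory (\<lambda>x. f x + g x)"
proof (rule summatoryI)
  fix \<epsilon> :: real assume \<epsilon>: "0 < \<epsilon>"
  obtain C where C: "\<And>x. 1 \<le> x \<Longrightarrow> f x \<le> C * x powr (1 + \<epsilon>)"
    using summatory_boundE[OF f \<epsilon>] by blast
  obtain D where D: "\<And>x. 1 \<le> x \<Longrightarrow> g x \<le> D * x powr (1 + \<epsilon>)"
    using summatory_boundE[OF g \<epsilon>] by blast
  show "\<exists>C. \<forall>x\<ge>1. f x + g x \<le> C * x powr (1 + \<epsilon>)"
    using C D by (intro exI[of _ "C + D"]) (auto simp: distrib_right intro!: add_mono)
qed (auto intro: add_mono summatory_mono f g simp: summatory_eq_0[OF f] summatory_eq_0[OF g])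

lemma mconv_count_le_powr:
  assumes f: "\<And>x. 1 \<le> x \<Longrightarrow> f x \<le> C * x powr a" and C: "0 \<le> C" and a: "1 < a" and x: "1 \<le> x"
  shows "mconv_count f x \<le> C * (\<Sum>n. real n powr (- a)) * x powr a"
proof -
  have summable_powr: "summable (\<lambda>n. real n powr (- a))" using a by (simp add: summable_real_powr_iff)
  have "mconv_count f x \<le> (\<Sum>n=1..nat \<lfloor>x\<rfloor>. C * x powr a * real n powr (- a))"
    unfolding mconv_count_def
  proof (intro sum_mono)
    fix n assume n: "n \<in> {1..nat \<lfloor>x\<rfloor>}"
    have "real n \<le> x" "1 \<le> real n" using n x by (auto simp: le_nat_iff le_floor_iff)
    hence "f (x / real n) \<le> C * (x / real n) powr a" by (intro f) (auto simp: field_simps)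
    also have "(x / real n) powr a = x powr a * real n powr (- a)"
      using x n powr_minus_divide[of "real n" a] by (simp add: powr_divide)
    finally show "f (x / real n) \<le> C * x powr a * real n powr (- a)" by (simp add: mult_ac)
  qed
  also have "\<dots> = C * x powr a * (\<Sum>n=1..nat \<lfloor>x\<rfloor>. real n powr (- a))"
    by (simp only: sum_distrib_left)
  also have "\<dots> \<le> C * x powr a * (\<Sum>n. real n powr (- a))"
    using C by (intro mult_left_mono sum_le_suminf summable_powr) auto
  finally show ?thesis by (simp only: mult_ac)
qed

lemma summatory_mconv_count:
  assumes f: "summatory f" shows "summatory (mconv_count f)"
proof (rule summatoryI)
  fix x y :: real assume xy: "x \<le> y"
  have "mconv_count f x \<le> (\<Sum>n=1..nat \<lfloor>x\<rfloor>. f (y / real n))"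
    unfolding mconv_count_def using xy by (intro sum_mono summatory_mono[OF f] divide_right_mono) auto
  also have "\<dots> \<le> mconv_count f y"
    unfolding mconv_count_def using xy
    by (intro sum_mono2 summatory_nonneg[OF f]) (auto intro: order_trans nat_mono floor_mono)
  finally show "mconv_count f x \<le> mconv_count f y" .
next
  fix x :: real assume "x < 1"
  hence "nat \<lfloor>x\<rfloor> = 0" by linarith
  thus "mconv_count f x = 0" by (simp add: mconv_count_def)
next
  fix \<epsilon> :: real assume \<epsilon>: "0 < \<epsilon>"
  obtain C where "0 \<le> C" "\<And>x. 1 \<le> x \<Longrightarrow> f x \<le> C * x powr (1 + \<epsilon>)"
    using summatory_boundE[OF f \<epsilon>] by blast
  thus "\<exists>C. \<forall>x\<ge>1. mconv_count f x \<le> C * x powr (1 + \<epsilon>)"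
    using mconv_count_le_powr[of f C "1 + \<epsilon>"] \<epsilon> by auto
qed

lemma integral_from_0_eq_from_1:
  fixes f :: "real \<Rightarrow> real"
  assumes "\<And>v. v < 1 \<Longrightarrow> f v = 0" "f integrable_on {0..x}" "1 \<le> x"
  shows "integral {0..x} f = integral {1..x} f"
proof -
  have "integral {0..1} f = integral {0..1} (\<lambda>v::real. 0)"
    by (rule integral_spike[of "{1}"]) (use assms(1) in auto)
  moreover have "integral {0..1} f + integral {1..x} f = integral {0..x} f"
    using assms by (intro Henstock_Kurzweil_Integration.integral_combine) auto
  ultimately show ?thesis by simp
qed

lemma has_integral_invsq:
  fixes c a b :: real
  assumes "0 < a" "a \<le> b"
  shows "((\<lambda>v. c / v\<^sup>2) has_integral c * (1 / a - 1 / b)) {a..b}"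
proof -
  have "((\<lambda>v. c / v\<^sup>2) has_integral (- c / b - (- c / a))) {a..b}"
    using assms by (intro fundamental_theorem_of_calculus)
      (auto simp: has_real_derivative_iff_has_vector_derivative[symmetric] power2_eq_square intro!: derivative_eq_intros)
  thus ?thesis by (simp add: right_diff_distrib)
qed

lemma integral_powr_le:
  fixes x a :: real
  assumes "0 < a" "1 \<le> x"
  shows "integral {1..x} (\<lambda>v. v powr (a - 1)) \<le> x powr a / a"
proof -
  have "((\<lambda>v. v powr (a - 1)) has_integral (x powr a / a - 1 powr a / a)) {1..x}"
    using assms by (intro fundamental_theorem_of_calculus)
      (auto simp: has_real_derivative_iff_has_vector_derivative[symmetric] intro!: derivative_eq_intros)
  thus ?thesis using assms by (simp add: integral_unique)
qed

lemma mconv_leb_le_powr: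
  assumes f: "summatory f" and bound: "\<And>x. 1 \<le> x \<Longrightarrow> f x \<le> C * x powr (1 + a)"
    and C: "0 \<le> C" and a: "0 < a" and x: "1 \<le> x"
  shows "mconv_leb f x \<le> C / a * x powr (1 + a)"
proof -
  have "integral {0..x} (\<lambda>v. f v / v\<^sup>2) = integral {1..x} (\<lambda>v. f v / v\<^sup>2)"
    using x by (intro integral_from_0_eq_from_1 summatory_integrable f) (auto simp: summatory_eq_0[OF f])
  also have "\<dots> \<le> integral {1..x} (\<lambda>v. C * v powr (a - 1))"
  proof (intro integral_le summatory_integrable f)
    show "(\<lambda>v. C * v powr (a - 1)) integrable_on {1..x}"
      by (intro integrable_continuous_real continuous_intros) auto
    fix v assume v: "v \<in> {1..x}"
    have "f v / v\<^sup>2 \<le> C * v powr (1 + a) / v\<^sup>2" using v bound by (intro divide_right_mono) auto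
    also have "\<dots> = C * v powr (a - 1)" using v by (simp add: powr_add powr_diff power2_eq_square)
    finally show "f v / v\<^sup>2 \<le> C * v powr (a - 1)" .
  qed
  also have "\<dots> \<le> C * (x powr a / a)"
    using a x C by (subst integral_mult_right) (intro mult_left_mono integral_powr_le)
  finally have "mconv_leb f x \<le> x * (C * (x powr a / a))"
    unfolding mconv_leb_def using x by (intro mult_left_mono) auto
  also have "\<dots> = C / a * x powr (1 + a)" using x by (simp add: powr_add)
  finally show ?thesis .
qed

lemma summatory_mconv_leb:
  assumes f: "summatory f" shows "summatory (mconv_leb f)"
proof (rule summatoryI)
  have integrand_nonneg: "0 \<le> f v / v\<^sup>2" for v using summatory_nonneg[OF f] by simp
  show zero: "mconv_leb f x = 0" if "x < 1" for x
  proof -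
    have "integral {0..x} (\<lambda>v. f v / v\<^sup>2) = integral {0..x} (\<lambda>v. 0)"
      using that by (intro integral_cong) (auto simp: summatory_eq_0[OF f])
    thus ?thesis by (simp add: mconv_leb_def)
  qed
  fix x y :: real assume xy: "x \<le> y"
  show "mconv_leb f x \<le> mconv_leb f y"
  proof (cases "y < 1")
    case False
    hence "0 \<le> mconv_leb f y" unfolding mconv_leb_def
      by (intro mult_nonneg_nonneg integral_nonneg summatory_integrable f integrand_nonneg) auto
    moreover have "integral {0..x} (\<lambda>v. f v / v\<^sup>2) \<le> integral {0..y} (\<lambda>v. f v / v\<^sup>2)"
      using xy integrand_nonneg by (intro integral_subset_le summatory_integrable f) auto
    hence "mconv_leb f x \<le> mconv_leb f y" if "1 \<le> x"
      unfolding mconv_leb_def using that xy integrand_nonneg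
      by (intro mult_mono integral_nonneg summatory_integrable f) auto
    ultimately show ?thesis using zero[of x] by (cases "x < 1") auto
  qed (use xy zero in auto)
next
  fix \<epsilon> :: real assume \<epsilon>: "0 < \<epsilon>"
  obtain C where "0 \<le> C" "\<And>x. 1 \<le> x \<Longrightarrow> f x \<le> C * x powr (1 + \<epsilon>)"
    using summatory_boundE[OF f \<epsilon>] by blast
  thus "\<exists>C. \<forall>x\<ge>1. mconv_leb f x \<le> C * x powr (1 + \<epsilon>)"
    using mconv_leb_le_powr[OF f _ _ \<epsilon>] by blast
qed

lemma has_integral_invsq_dilate:
  fixes f :: "real \<Rightarrow> real"
  assumes int: "(\<lambda>v. f v / v\<^sup>2) integrable_on {0..x / c}" and c: "0 < c" and x: "0 \<le> x"
  shows "((\<lambda>v. f (v / c) / v\<^sup>2) has_integral (1 / c) * integral {0..x / c} (\<lambda>v. f v / v\<^sup>2)) {0..x}"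
proof -
  let ?J = "integral {0..x / c} (\<lambda>v. f v / v\<^sup>2)"
  have "((\<lambda>v. f (1 / c * v) / (1 / c * v)\<^sup>2) has_integral (1 / \<bar>1 / c\<bar>) *\<^sub>R ?J) ((\<lambda>v. v / (1 / c)) ` {0..x / c})"
    using c by (intro has_integral_stretch_real integrable_integral int) auto
  also have "(\<lambda>v. v / (1 / c)) ` {0..x / c} = {0..x}"
    using c x by (simp add: image_mult_atLeastAtMost_if')
  finally have "((\<lambda>v. (1 / c)\<^sup>2 * (f (1 / c * v) / (1 / c * v)\<^sup>2)) has_integral (1 / c)\<^sup>2 * ((1 / \<bar>1 / c\<bar>) *\<^sub>R ?J)) {0..x}"
    by (rule has_integral_mult_right)
  thus ?thesis using c by (simp add: power_divide power2_eq_square)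
qed

lemma mconv_count_extend:
  assumes "\<And>x. x < 1 \<Longrightarrow> f x = 0" "v \<le> x"
  shows "mconv_count f v = (\<Sum>n=1..nat \<lfloor>x\<rfloor>. f (v / real n))"
  unfolding mconv_count_def
proof (rule sum.mono_neutral_left)
  show "{1..nat \<lfloor>v\<rfloor>} \<subseteq> {1..nat \<lfloor>x\<rfloor>}"
    using assms(2) by (auto intro: order_trans nat_mono floor_mono)
  show "\<forall>i\<in>{1..nat \<lfloor>x\<rfloor>} - {1..nat \<lfloor>v\<rfloor>}. f (v / real i) = 0"
  proof
    fix i assume i: "i \<in> {1..nat \<lfloor>x\<rfloor>} - {1..nat \<lfloor>v\<rfloor>}"
    hence "v < real i" by (auto simp: not_le) linarith
    thus "f (v / real i) = 0" using i by (intro assms(1)) auto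
  qed
qed auto

lemma mconv_count_leb_commute:
  assumes f: "summatory f"
  shows "mconv_count (mconv_leb f) x = mconv_leb (mconv_count f) x"
proof (cases "x < 1")
  case True
  thus ?thesis by (simp add: summatory_eq_0 summatory_mconv_count summatory_mconv_leb f)
next
  case False
  let ?J = "\<lambda>y. integral {0..y} (\<lambda>v. f v / v\<^sup>2)"
  have "((\<lambda>v. \<Sum>n=1..nat \<lfloor>x\<rfloor>. f (v / real n) / v\<^sup>2) has_integral (\<Sum>n=1..nat \<lfloor>x\<rfloor>. (1 / real n) * ?J (x / real n))) {0..x}"
    using False by (intro has_integral_sum has_integral_invsq_dilate summatory_integrable f) auto
  hence "((\<lambda>v. mconv_count f v / v\<^sup>2) has_integral (\<Sum>n=1..nat \<lfloor>x\<rfloor>. (1 / real n) * ?J (x / real n))) {0..x}"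
  proof (rule has_integral_eq[rotated])
    show "(\<Sum>n=1..nat \<lfloor>x\<rfloor>. f (v / real n) / v\<^sup>2) = mconv_count f v / v\<^sup>2" if "v \<in> {0..x}" for v
      using mconv_count_extend[of f v x] that summatory_eq_0[OF f] by (simp add: sum_divide_distrib)
  qed
  hence "mconv_leb (mconv_count f) x = x * (\<Sum>n=1..nat \<lfloor>x\<rfloor>. (1 / real n) * ?J (x / real n))"
    by (simp add: mconv_leb_def integral_unique)
  thus ?thesis by (simp add: mconv_count_def mconv_leb_def sum_distrib_left)
qed

lemma mono_integral_invsq_bounds:
  fixes f :: "real \<Rightarrow> real"
  assumes f: "\<And>v. a \<le> v \<Longrightarrow> v \<le> b \<Longrightarrow> f a \<le> f v \<and> f v \<le> f b"
    and int: "(\<lambda>v. f v / v\<^sup>2) integrable_on {a..b}" and ab: "0 < a" "a \<le> b"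
  shows "f a * (1 / a - 1 / b) \<le> integral {a..b} (\<lambda>v. f v / v\<^sup>2)"
    and "integral {a..b} (\<lambda>v. f v / v\<^sup>2) \<le> f b * (1 / a - 1 / b)"
  using f by (intro has_integral_le[OF has_integral_invsq[OF ab] integrable_integral[OF int]]
      has_integral_le[OF integrable_integral[OF int] has_integral_invsq[OF ab]] divide_right_mono; simp)+

lemma summatory_integral_step_bounds:
  assumes f: "summatory f" and x: "0 < x" and n: "1 \<le> n"
  defines "G \<equiv> \<lambda>n. x * integral {0..x / real n} (\<lambda>v. f v / v\<^sup>2)"
  shows "f (x / real (Suc n)) \<le> G n - G (Suc n)" "G n - G (Suc n) \<le> f (x / real n)"
proof -
  let ?a = "x / real (Suc n)" and ?b = "x / real n"
  have ab: "0 < ?a" "?a \<le> ?b" using x n by (auto simp: field_simps)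
  have "integral {0..?a} (\<lambda>v. f v / v\<^sup>2) + integral {?a..?b} (\<lambda>v. f v / v\<^sup>2) = integral {0..?b} (\<lambda>v. f v / v\<^sup>2)"
    using ab by (intro Henstock_Kurzweil_Integration.integral_combine summatory_integrable f) auto
  hence G_eq: "G n - G (Suc n) = x * integral {?a..?b} (\<lambda>v. f v / v\<^sup>2)"
    by (simp add: G_def algebra_simps flip: distrib_left)
  have "1 / ?a - 1 / ?b = 1 / x" using x n by (simp add: field_simps)
  with mono_integral_invsq_bounds[OF _ summatory_integrable[OF f] ab]
  have "f ?a * (1 / x) \<le> integral {?a..?b} (\<lambda>v. f v / v\<^sup>2)" "integral {?a..?b} (\<lambda>v. f v / v\<^sup>2) \<le> f ?b * (1 / x)"
    using summatory_mono[OF f] by (simp_all only: simp_thms)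
  thus "f ?a \<le> G n - G (Suc n)" "G n - G (Suc n) \<le> f ?b"
    unfolding G_eq using x by (auto simp: field_simps)
qed

lemma mconv_count_tail_approx:
  assumes f: "summatory f" and N: "1 \<le> N" "real N \<le> x"
  shows "\<bar>(\<Sum>n\<in>{N<..nat \<lfloor>x\<rfloor>}. f (x / real n)) - x * integral {0..x / real N} (\<lambda>v. f v / v\<^sup>2)\<bar> \<le> f (x / real N)"
proof -
  let ?M = "nat \<lfloor>x\<rfloor>"
  define G where "G n = x * integral {0..x / real n} (\<lambda>v. f v / v\<^sup>2)" for n :: nat
  have x: "1 \<le> x" using N by linarith
  have N_le: "N \<le> ?M" using N by (simp add: le_nat_iff le_floor_iff)
  have step: "f (x / real (Suc n)) \<le> G n - G (Suc n)" "G n - G (Suc n) \<le> f (x / real n)" if "N \<le> n" for n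
    using summatory_integral_step_bounds[OF f, of x n] x N(1) that unfolding G_def by auto
  have "x < real (Suc ?M)" using x by linarith
  hence "x / real (Suc ?M) < 1" by (simp add: divide_less_eq)
  hence last: "f (x / real (Suc ?M)) = 0" and "mconv_leb f (x / real (Suc ?M)) = 0"
    by (simp_all only: summatory_eq_0 summatory_mconv_leb f)
  moreover have "x / real (Suc ?M) \<noteq> 0" using x by (simp del: of_nat_Suc)
  ultimately have "G (Suc ?M) = 0" unfolding G_def mconv_leb_def by (metis mult_eq_0_iff)
  hence telescope: "G N = (\<Sum>n=N..?M. G n - G (Suc n))"
    using sum_Suc_diff[of N ?M "\<lambda>n. - G n"] N_le by simp
  have "G N \<le> (\<Sum>n=N..?M. f (x / real n))" unfolding telescope by (intro sum_mono step) auto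
  also have "\<dots> = f (x / real N) + (\<Sum>n\<in>{N<..?M}. f (x / real n))" using N_le by (rule sum.head)
  finally have "G N \<le> f (x / real N) + (\<Sum>n\<in>{N<..?M}. f (x / real n))" .
  moreover have "(\<Sum>n\<in>{N<..?M}. f (x / real n)) \<le> G N"
  proof -
    have "(\<Sum>n\<in>{N<..?M}. f (x / real n)) = (\<Sum>n=Suc N..?M. f (x / real n))"
      by (simp add: atLeastSucAtMost_greaterThanAtMost)
    also have "\<dots> = (\<Sum>n=Suc N..Suc ?M. f (x / real n))" using last N_le by simp
    also have "\<dots> = (\<Sum>n=N..?M. f (x / real (Suc n)))" by (rule sum.shift_bounds_cl_Suc_ivl)
    also have "\<dots> \<le> G N" unfolding telescope by (intro sum_mono step) auto
    finally show ?thesis .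
  qed
  ultimately show ?thesis unfolding G_def by linarith
qed

definition bv_summatory :: "(real \<Rightarrow> real) \<Rightarrow> bool" where
  "bv_summatory g \<longleftrightarrow> (\<exists>f1 f2. summatory f1 \<and> summatory f2 \<and> g = (\<lambda>x. f1 x - f2 x))"

lemma bv_summatoryE:
  assumes "bv_summatory g"
  obtains f1 f2 where "summatory f1" "summatory f2" "g = (\<lambda>x. f1 x - f2 x)"
  using assms unfolding bv_summatory_def by blast

lemma bv_summatory_integrable: "bv_summatory g \<Longrightarrow> (\<lambda>v. g v / v\<^sup>2) integrable_on {a..b}"
  by (elim bv_summatoryE) (simp only: diff_divide_distrib, intro integrable_diff summatory_integrable)

lemma bv_summatory_eq_0: "bv_summatory g \<Longrightarrow> x < 1 \<Longrightarrow> g x = 0"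
  by (auto elim!: bv_summatoryE simp: summatory_eq_0)

lemma bv_summatory_measurable: "bv_summatory g \<Longrightarrow> g \<in> borel_measurable borel"
  by (auto elim!: bv_summatoryE intro: borel_measurable_diff[OF summatory_measurable summatory_measurable])

lemma mconv_count_diff_distrib:
  "mconv_count (\<lambda>x. f x - g x) = (\<lambda>x. mconv_count f x - mconv_count g x)"
  by (rule ext) (simp add: mconv_count_def sum_subtractf)

lemma mconv_leb_diff_distrib:
  assumes "bv_summatory f" "bv_summatory g"
  shows "mconv_leb (\<lambda>x. f x - g x) = (\<lambda>x. mconv_leb f x - mconv_leb g x)"
  by (rule ext) (simp add: mconv_leb_def diff_divide_distrib integral_diff bv_summatory_integrable assms right_diff_distrib)

lemma summatory_imp_bv_summatory:
  assumes "summatory f" shows "bv_summatory f"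
proof -
  have "summatory (\<lambda>_. 0)" by (rule summatoryI) (auto intro: exI[of _ 0])
  thus ?thesis unfolding bv_summatory_def using assms by (intro exI[of _ f] exI[of _ "\<lambda>_. 0"]) auto
qed

lemma bv_summatory_diff:
  assumes "bv_summatory f" "bv_summatory g" shows "bv_summatory (\<lambda>x. f x - g x)"
proof -
  obtain f1 f2 where "summatory f1" "summatory f2" "f = (\<lambda>x. f1 x - f2 x)"
    using assms(1) by (rule bv_summatoryE)
  moreover obtain g1 g2 where "summatory g1" "summatory g2" "g = (\<lambda>x. g1 x - g2 x)"
    using assms(2) by (rule bv_summatoryE)
  ultimately show ?thesis unfolding bv_summatory_def
    by (intro exI[of _ "\<lambda>x. f1 x + g2 x"] exI[of _ "\<lambda>x. f2 x + g1 x"]) (auto intro: summatory_add)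
qed

lemma bv_summatory_mconv_count: "bv_summatory g \<Longrightarrow> bv_summatory (mconv_count g)"
  unfolding bv_summatory_def using mconv_count_diff_distrib summatory_mconv_count by metis

lemma bv_summatory_mconv_leb:
  assumes "bv_summatory g" shows "bv_summatory (mconv_leb g)"
proof -
  obtain f1 f2 where f: "summatory f1" "summatory f2" and g: "g = (\<lambda>x. f1 x - f2 x)"
    using assms by (rule bv_summatoryE)
  show ?thesis unfolding g
    by (subst mconv_leb_diff_distrib) (intro bv_summatory_diff summatory_imp_bv_summatory summatory_mconv_leb f)+
qed

lemma bv_summatory_mconv_diff: "bv_summatory g \<Longrightarrow> bv_summatory (mconv_diff g)"
  unfolding mconv_diff_def[abs_def] by (intro bv_summatory_diff bv_summatory_mconv_count bv_summatory_mconv_leb)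

lemma mconv_diff_mconv_count:
  assumes "bv_summatory g" shows "mconv_diff (mconv_count g) = mconv_count (mconv_diff g)"
proof -
  obtain f1 f2 where f: "summatory f1" "summatory f2" and g: "g = (\<lambda>x. f1 x - f2 x)"
    using assms by (rule bv_summatoryE)
  have "mconv_leb g = (\<lambda>x. mconv_leb f1 x - mconv_leb f2 x)" unfolding g
    by (intro mconv_leb_diff_distrib summatory_imp_bv_summatory f)
  moreover have "mconv_leb (mconv_count g) = (\<lambda>x. mconv_leb (mconv_count f1) x - mconv_leb (mconv_count f2) x)"
    unfolding g mconv_count_diff_distrib by (intro mconv_leb_diff_distrib summatory_imp_bv_summatory summatory_mconv_count f)
  ultimately have "mconv_leb (mconv_count g) = mconv_count (mconv_leb g)"
    by (simp add: mconv_count_diff_distrib mconv_count_leb_commute f)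
  thus ?thesis unfolding mconv_diff_def[abs_def] mconv_count_diff_distrib by simp
qed

lemma mconv_diff_split:
  assumes f: "summatory f1" "summatory f2" and N: "1 \<le> N" "real N \<le> x"
  defines "g \<equiv> \<lambda>v. f1 v - f2 v" and "y \<equiv> x / real N"
  shows "mconv_diff g x = (\<Sum>n=1..N. g (x / real n)) - x * integral {y..x} (\<lambda>v. g v / v\<^sup>2)
    + ((\<Sum>n\<in>{N<..nat \<lfloor>x\<rfloor>}. f1 (x / real n)) - x * integral {0..y} (\<lambda>v. f1 v / v\<^sup>2))
    - ((\<Sum>n\<in>{N<..nat \<lfloor>x\<rfloor>}. f2 (x / real n)) - x * integral {0..y} (\<lambda>v. f2 v / v\<^sup>2))"
proof -
  let ?M = "nat \<lfloor>x\<rfloor>" and ?J = "\<lambda>f. integral {0..y} (\<lambda>v. f v / v\<^sup>2)" and ?I = "integral {y..x} (\<lambda>v. g v / v\<^sup>2)"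
  have g: "bv_summatory g" unfolding g_def by (intro bv_summatory_diff summatory_imp_bv_summatory f)
  have y: "0 \<le> y" "y \<le> x" using N by (auto simp: y_def field_simps)
  have "N \<le> ?M" using N by (simp add: le_nat_iff le_floor_iff)
  hence "{1..?M} = {1..N} \<union> {N<..?M}" using N by auto
  hence "mconv_count g x = (\<Sum>n=1..N. g (x / real n)) + (\<Sum>n\<in>{N<..?M}. g (x / real n))"
    unfolding mconv_count_def by (simp only:) (rule sum.union_disjoint; auto)
  moreover have "?J g + ?I = integral {0..x} (\<lambda>v. g v / v\<^sup>2)"
    using y by (intro Henstock_Kurzweil_Integration.integral_combine bv_summatory_integrable g) auto
  hence "mconv_leb g x = x * ?J g + x * ?I" by (simp add: mconv_leb_def flip: distrib_left)
  moreover have "?J g = ?J f1 - ?J f2"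
    unfolding g_def diff_divide_distrib by (intro integral_diff summatory_integrable f)
  moreover have "(\<Sum>n\<in>{N<..?M}. g (x / real n)) = (\<Sum>n\<in>{N<..?M}. f1 (x / real n)) - (\<Sum>n\<in>{N<..?M}. f2 (x / real n))"
    unfolding g_def by (rule sum_subtractf)
  ultimately show ?thesis by (simp add: mconv_diff_def algebra_simps)
qed

text \<open>Hyperbola method: the terms \<open>n \<le> N\<close> are estimated trivially, the remaining ones by the
  integral test for the two monotone parts of \<open>g\<close>.\<close>

lemma mconv_diff_hyperbola:
  assumes f: "summatory f1" "summatory f2" and N: "1 \<le> N" "real N \<le> x"
  defines "g \<equiv> \<lambda>v. f1 v - f2 v"
  assumes D: "\<And>v. 1 \<le> v \<Longrightarrow> v \<le> x \<Longrightarrow> \<bar>g v\<bar> \<le> D"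
  shows "\<bar>mconv_diff g x\<bar> \<le> 2 * D * real N + f1 (x / real N) + f2 (x / real N)"
proof -
  let ?y = "x / real N"
  let ?I = "integral {?y..x} (\<lambda>v. g v / v\<^sup>2)"
  have g: "bv_summatory g" unfolding g_def by (intro bv_summatory_diff summatory_imp_bv_summatory f)
  have x: "1 \<le> x" "1 \<le> ?y" "?y \<le> x" using N by (auto simp: field_simps)
  have "\<bar>\<Sum>n=1..N. g (x / real n)\<bar> \<le> (\<Sum>n=1..N. D)"
  proof (intro order_trans[OF sum_abs] sum_mono D)
    fix n assume n: "n \<in> {1..N}"
    have "real n \<le> x" using n N by (auto intro: order_trans[OF of_nat_mono])
    thus "1 \<le> x / real n" "x / real n \<le> x" using n x by (auto simp: field_simps)
  qed
  hence first_terms: "\<bar>\<Sum>n=1..N. g (x / real n)\<bar> \<le> D * real N" by (simp add: mult.commute)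
  have "\<bar>?I\<bar> \<le> integral {?y..x} (\<lambda>v. D / v\<^sup>2)"
  proof (rule integral_norm_bound_integral[where f = "\<lambda>v. g v / v\<^sup>2", unfolded real_norm_def])
    show "(\<lambda>v. D / v\<^sup>2) integrable_on {?y..x}"
      using has_integral_invsq[of ?y x D] x by (auto simp: integrable_on_def)
    show "\<bar>g v / v\<^sup>2\<bar> \<le> D / v\<^sup>2" if "v \<in> {?y..x}" for v
      using D[of v] that x by (auto simp: abs_div intro!: divide_right_mono)
  qed (rule bv_summatory_integrable[OF g])
  also have "\<dots> = D * (1 / ?y - 1 / x)" using has_integral_invsq[of ?y x D] x by (auto intro: integral_unique)
  finally have "x * \<bar>?I\<bar> \<le> x * (D * (1 / ?y - 1 / x))" using x by (intro mult_left_mono) auto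
  also have "\<dots> = D * real N - D" using x by (simp add: field_simps)
  also have "\<dots> \<le> D * real N" using D[of x] x by simp
  finally have "\<bar>x * ?I\<bar> \<le> D * real N" using x by (simp add: abs_mult)
  thus ?thesis
    using mconv_diff_split[OF f N] first_terms mconv_count_tail_approx[OF f(1) N] mconv_count_tail_approx[OF f(2) N]
    unfolding g_def by linarith
qed

lemma hyperbola_cutoff:
  fixes x \<delta> :: real
  assumes x: "1 \<le> x" and \<delta>: "0 < \<delta>" "\<delta> \<le> 1"
  obtains N :: nat where "1 \<le> N" "real N \<le> x" "x powr (1 - \<delta>) * real N \<le> x powr (1 - \<delta> / 4)"
    "(x / real N) powr (1 + \<delta> / 4) \<le> 2 powr (1 + \<delta> / 4) * x powr (1 - \<delta> / 4)"
proof
  define N where "N = nat \<lfloor>x powr (\<delta> / 2)\<rfloor>"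
  have "1 \<le> x powr (\<delta> / 2)" using x \<delta> by (intro ge_one_powr_ge_zero) auto
  hence N: "1 \<le> N" "real N \<le> x powr (\<delta> / 2)" and "x powr (\<delta> / 2) < real N + 1"
    by (auto simp: N_def le_nat_iff le_floor_iff)
  hence N_ge: "x powr (\<delta> / 2) \<le> 2 * real N" by linarith
  show "1 \<le> N" by (rule N(1))
  have "x powr (\<delta> / 2) \<le> x powr 1" using x \<delta> by (intro powr_mono) auto
  thus "real N \<le> x" using N(2) x by simp
  have "x powr (1 - \<delta>) * real N \<le> x powr (1 - \<delta>) * x powr (\<delta> / 2)"
    using N(2) by (intro mult_left_mono) auto
  also have "\<dots> = x powr (1 - \<delta> / 2)" using x by (simp add: powr_add[symmetric])
  also have "\<dots> \<le> x powr (1 - \<delta> / 4)" using x \<delta> by (intro powr_mono) auto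
  finally show "x powr (1 - \<delta>) * real N \<le> x powr (1 - \<delta> / 4)" .
  have "x = x powr (1 - \<delta> / 2) * x powr (\<delta> / 2)" using x by (simp add: powr_add[symmetric])
  also have "\<dots> \<le> x powr (1 - \<delta> / 2) * (2 * real N)" using N_ge by (intro mult_left_mono) auto
  finally have "x / real N \<le> 2 * x powr (1 - \<delta> / 2)" using N(1) by (simp add: field_simps)
  hence "(x / real N) powr (1 + \<delta> / 4) \<le> (2 * x powr (1 - \<delta> / 2)) powr (1 + \<delta> / 4)"
    using x \<delta> by (intro powr_mono2) auto
  also have "\<dots> = 2 powr (1 + \<delta> / 4) * x powr ((1 - \<delta> / 2) * (1 + \<delta> / 4))"
    by (simp add: powr_mult powr_powr)
  also have "\<dots> \<le> 2 powr (1 + \<delta> / 4) * x powr (1 - \<delta> / 4)"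
    using x \<delta> by (intro mult_left_mono powr_mono) (auto simp: algebra_simps)
  finally show "(x / real N) powr (1 + \<delta> / 4) \<le> 2 powr (1 + \<delta> / 4) * x powr (1 - \<delta> / 4)" .
qed

lemma mconv_diff_power_saving:
  assumes g: "bv_summatory g" and \<delta>: "0 < \<delta>" "\<delta> \<le> 1"
    and C: "\<And>x. 1 \<le> x \<Longrightarrow> \<bar>g x\<bar> \<le> C * x powr (1 - \<delta>)"
  shows "\<exists>C'. \<forall>x\<ge>1. \<bar>mconv_diff g x\<bar> \<le> C' * x powr (1 - \<delta> / 4)"
proof -
  obtain f1 f2 where f: "summatory f1" "summatory f2" and g_eq: "g = (\<lambda>x. f1 x - f2 x)"
    using g by (rule bv_summatoryE)
  have "0 < \<delta> / 4" using \<delta> by simp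
  then obtain B where B: "0 \<le> B" "\<And>x. 1 \<le> x \<Longrightarrow> f1 x + f2 x \<le> B * x powr (1 + \<delta> / 4)"
    using summatory_boundE[OF summatory_add[OF f]] by blast
  have C_nonneg: "0 \<le> C" using C[of 1] by simp
  show ?thesis
  proof (intro exI allI impI)
    fix x :: real assume x: "1 \<le> x"
    let ?X = "x powr (1 - \<delta> / 4)"
    obtain N :: nat where N: "1 \<le> N" "real N \<le> x" and N_le: "x powr (1 - \<delta>) * real N \<le> ?X"
      and N_ge: "(x / real N) powr (1 + \<delta> / 4) \<le> 2 powr (1 + \<delta> / 4) * ?X"
      using x \<delta> by (rule hyperbola_cutoff)
    have "\<bar>g v\<bar> \<le> C * x powr (1 - \<delta>)" if "1 \<le> v" "v \<le> x" for v
      using that \<delta> C_nonneg by (intro order_trans[OF C] mult_left_mono powr_mono2) auto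
    hence "\<bar>mconv_diff g x\<bar> \<le> 2 * (C * x powr (1 - \<delta>)) * real N + f1 (x / real N) + f2 (x / real N)"
      unfolding g_eq by (rule mconv_diff_hyperbola[OF f N])
    moreover have "C * (x powr (1 - \<delta>) * real N) \<le> C * ?X" using N_le C_nonneg by (rule mult_left_mono)
    moreover have "f1 (x / real N) + f2 (x / real N) \<le> B * (x / real N) powr (1 + \<delta> / 4)"
      using N by (intro B(2)) (auto simp: field_simps)
    moreover have "\<dots> \<le> B * (2 powr (1 + \<delta> / 4) * ?X)" using N_ge B(1) by (rule mult_left_mono)
    ultimately show "\<bar>mconv_diff g x\<bar> \<le> (2 * C + B * 2 powr (1 + \<delta> / 4)) * ?X"
      by (simp add: algebra_simps)
  qed
qed

definition log_poly_asymp :: "(real \<Rightarrow> real) \<Rightarrow> bool" where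
  "log_poly_asymp g \<longleftrightarrow> (\<exists>p C \<delta>. 0 < \<delta> \<and> \<delta> \<le> 1 \<and> (\<forall>x\<ge>1. \<bar>g x - x * poly p (ln x)\<bar> \<le> C * x powr (1 - \<delta>)))"

lemma log_poly_asympE:
  assumes "log_poly_asymp g"
  obtains p C \<delta> where "0 < \<delta>" "\<delta> \<le> 1" "0 \<le> C" "\<And>x. 1 \<le> x \<Longrightarrow> \<bar>g x - x * poly p (ln x)\<bar> \<le> C * x powr (1 - \<delta>)"
proof -
  obtain p C \<delta> where \<delta>: "0 < \<delta>" "\<delta> \<le> 1" and C: "\<And>x. 1 \<le> x \<Longrightarrow> \<bar>g x - x * poly p (ln x)\<bar> \<le> C * x powr (1 - \<delta>)"
    using assms unfolding log_poly_asymp_def by blast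
  moreover have "0 \<le> C" using C[of 1] by simp
  ultimately show thesis using that by blast
qed

lemma log_poly_asymp_add:
  assumes "log_poly_asymp f" "log_poly_asymp g" shows "log_poly_asymp (\<lambda>x. f x + g x)"
proof -
  obtain p C \<delta> where f: "0 < \<delta>" "\<delta> \<le> 1" "0 \<le> C" "\<And>x. 1 \<le> x \<Longrightarrow> \<bar>f x - x * poly p (ln x)\<bar> \<le> C * x powr (1 - \<delta>)"
    using assms(1) by (rule log_poly_asympE) blast
  obtain q D \<eta> where g: "0 < \<eta>" "\<eta> \<le> 1" "0 \<le> D" "\<And>x. 1 \<le> x \<Longrightarrow> \<bar>g x - x * poly q (ln x)\<bar> \<le> D * x powr (1 - \<eta>)"
    using assms(2) by (rule log_poly_asympE) blast
  have "\<bar>f x + g x - x * poly (p + q) (ln x)\<bar> \<le> (C + D) * x powr (1 - min \<delta> \<eta>)" if x: "1 \<le> x" for x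
  proof -
    have "C * x powr (1 - \<delta>) \<le> C * x powr (1 - min \<delta> \<eta>)" "D * x powr (1 - \<eta>) \<le> D * x powr (1 - min \<delta> \<eta>)"
      using x f g by (auto intro!: mult_left_mono powr_mono)
    thus ?thesis using f(4)[OF x] g(4)[OF x] by (simp add: algebra_simps)
  qed
  thus ?thesis unfolding log_poly_asymp_def using f(1,2) g(1,2)
    by (intro exI[of _ "p + q"] exI[of _ "C + D"] exI[of _ "min \<delta> \<eta>"]) auto
qed

lemma poly_antiderivative:
  fixes p :: "'a :: field_char_0 poly"
  obtains P where "pderiv P = p"
proof
  have "pderiv (\<Sum>i\<le>degree p. monom (coeff p i / of_nat (Suc i)) (Suc i)) = (\<Sum>i\<le>degree p. monom (coeff p i) i)"
    by (simp add: higher_pderiv_sum[of 1, simplified] pderiv_monom del: of_nat_Suc)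
  thus "pderiv (\<Sum>i\<le>degree p. monom (coeff p i / of_nat (Suc i)) (Suc i)) = p"
    by (simp add: poly_as_sum_of_monoms)
qed

lemma integral_tail_powr_bound:
  fixes h :: "real \<Rightarrow> real"
  assumes h: "h \<in> borel_measurable borel" and bound: "\<And>v. 1 \<le> v \<Longrightarrow> \<bar>h v\<bar> \<le> C * v powr (- \<delta> - 1)" and \<delta>: "0 < \<delta>"
  obtains L where "\<And>x. 1 \<le> x \<Longrightarrow> h integrable_on {1..x}"
    "\<And>x. 1 \<le> x \<Longrightarrow> \<bar>integral {1..x} h - L\<bar> \<le> C / \<delta> * x powr (- \<delta>)"
proof -
  have majorant: "((\<lambda>v. C * v powr (- \<delta> - 1)) has_integral C / \<delta> * x powr (- \<delta>)) {x..}" if "1 \<le> x" for x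
    using has_integral_mult_right[OF has_integral_powr_to_inf[of "- \<delta> - 1" x], of C] that \<delta> by simp
  have int: "h integrable_on {x..}" if "1 \<le> x" for x
    using majorant[OF that] bound that
    by (intro borel_dominated_integrable_on[OF h, of _ "\<lambda>v. C * v powr (- \<delta> - 1)"]) (auto simp: integrable_on_def)
  have int_Icc: "h integrable_on {1..x}" if "1 \<le> x" for x
    by (rule integrable_on_subinterval[OF int[of 1]]) auto
  have "\<bar>integral {1..x} h - integral {1..} h\<bar> \<le> C / \<delta> * x powr (- \<delta>)" if x: "1 \<le> x" for x
  proof -
    have "{1..} = {1..x} \<union> {x..}" using x by auto
    moreover have "negligible ({1..x} \<inter> {x..})" using x by (auto intro: negligible_subset[of "{x}"])
    ultimately have "integral {1..} h = integral {1..x} h + integral {x..} h"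
      using int_Icc[OF x] int[OF x] by simp
    moreover have "\<bar>integral {x..} h\<bar> \<le> integral {x..} (\<lambda>v. C * v powr (- \<delta> - 1))"
      using bound x majorant[OF x] by (intro integral_norm_bound_integral[where f = h, unfolded real_norm_def] int)
        (auto simp: integrable_on_def)
    ultimately show ?thesis by (simp add: integral_unique[OF majorant[OF x]] del: integral_mult_right)
  qed
  thus thesis using that int_Icc by blast
qed

lemma log_poly_asymp_mconv_leb:
  assumes g: "log_poly_asymp g" and bv: "bv_summatory g"
  shows "log_poly_asymp (mconv_leb g)"
proof -
  obtain p C \<delta> where \<delta>: "0 < \<delta>" "\<delta> \<le> 1" and C: "\<And>x. 1 \<le> x \<Longrightarrow> \<bar>g x - x * poly p (ln x)\<bar> \<le> C * x powr (1 - \<delta>)"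
    using g by (rule log_poly_asympE) blast
  obtain P where P: "pderiv P = p" by (rule poly_antiderivative)
  have main: "((\<lambda>v. poly p (ln v) / v) has_integral (poly P (ln x) - poly P (ln 1))) {1..x}" if "1 \<le> x" for x
    using that by (intro fundamental_theorem_of_calculus)
      (auto simp: has_real_derivative_iff_has_vector_derivative[symmetric] P intro!: derivative_eq_intros DERIV_chain2[OF poly_DERIV])
  define h where "h v = (g v - v * poly p (ln v)) / v\<^sup>2" for v
  have "h \<in> borel_measurable borel"
    using bv_summatory_measurable[OF bv] unfolding h_def[abs_def] poly_altdef by measurable
  moreover have "\<bar>h v\<bar> \<le> C * v powr (- \<delta> - 1)" if v: "1 \<le> v" for v
  proof -
    have "\<bar>h v\<bar> \<le> C * v powr (1 - \<delta>) / v\<^sup>2"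
      using C[OF v] by (simp add: h_def abs_div divide_right_mono)
    also have "\<dots> = C * v powr (- \<delta> - 1)"
      using v by (simp add: powr_diff powr_minus power2_eq_square field_simps)
    finally show ?thesis .
  qed
  ultimately obtain L where int: "\<And>x. 1 \<le> x \<Longrightarrow> h integrable_on {1..x}"
    and L: "\<And>x. 1 \<le> x \<Longrightarrow> \<bar>integral {1..x} h - L\<bar> \<le> C / \<delta> * x powr (- \<delta>)"
    using \<delta>(1) by (rule integral_tail_powr_bound) blast+
  define Q where "Q = P + [:L - poly P 0:]"
  have "\<bar>mconv_leb g x - x * poly Q (ln x)\<bar> \<le> C / \<delta> * x powr (1 - \<delta>)" if x: "1 \<le> x" for x
  proof -
    have "integral {0..x} (\<lambda>v. g v / v\<^sup>2) = integral {1..x} (\<lambda>v. g v / v\<^sup>2)"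
      using x by (intro integral_from_0_eq_from_1 bv_summatory_integrable bv) (auto simp: bv_summatory_eq_0[OF bv])
    also have "\<dots> = integral {1..x} (\<lambda>v. h v + poly p (ln v) / v)"
      by (intro integral_cong) (auto simp: h_def diff_divide_distrib power2_eq_square)
    also have "\<dots> = integral {1..x} h + (poly P (ln x) - poly P 0)"
      using main[OF x] int[OF x] by (subst integral_add) (auto simp: integral_unique integrable_on_def)
    finally have integral_g: "integral {0..x} (\<lambda>v. g v / v\<^sup>2) = integral {1..x} h + (poly P (ln x) - poly P 0)" .
    have "mconv_leb g x - x * poly Q (ln x) = x * (integral {1..x} h - L)"
      unfolding mconv_leb_def integral_g by (simp add: Q_def algebra_simps)
    hence "\<bar>mconv_leb g x - x * poly Q (ln x)\<bar> = x * \<bar>integral {1..x} h - L\<bar>"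
      using x by (simp add: abs_mult)
    also have "\<dots> \<le> x * (C / \<delta> * x powr (- \<delta>))" using x L[OF x] by (intro mult_left_mono) auto
    also have "\<dots> = C / \<delta> * x powr (1 - \<delta>)" using x by (simp add: powr_diff powr_minus field_simps)
    finally show ?thesis .
  qed
  thus ?thesis unfolding log_poly_asymp_def using \<delta> by blast
qed

definition unit_step :: "real \<Rightarrow> real" where "unit_step x = (if 1 \<le> x then 1 else 0)"

lemma summatory_unit_step: "summatory unit_step"
proof (rule summatoryI)
  fix \<epsilon> :: real assume "0 < \<epsilon>"
  thus "\<exists>C. \<forall>x\<ge>1. unit_step x \<le> C * x powr (1 + \<epsilon>)"
    by (intro exI[of _ 1]) (auto simp: unit_step_def intro!: ge_one_powr_ge_zero)
qed (auto simp: unit_step_def)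

lemma bv_summatory_mconv_diff_iterates: "bv_summatory g \<Longrightarrow> bv_summatory ((mconv_diff ^^ j) g)"
  by (induction j) (auto intro: bv_summatory_mconv_diff)

lemma mconv_diff_iterates_unit_step:
  "\<exists>C \<delta>. 0 < \<delta> \<and> \<delta> \<le> 1 \<and> (\<forall>x\<ge>1. \<bar>(mconv_diff ^^ j) unit_step x\<bar> \<le> C * x powr (1 - \<delta>))"
proof (induction j)
  case 0
  show ?case by (intro exI[of _ 1]) (auto simp: unit_step_def)
next
  case (Suc j)
  then obtain C \<delta> where IH: "0 < \<delta>" "\<delta> \<le> 1" "\<And>x. 1 \<le> x \<Longrightarrow> \<bar>(mconv_diff ^^ j) unit_step x\<bar> \<le> C * x powr (1 - \<delta>)"
    by blast
  have "bv_summatory ((mconv_diff ^^ j) unit_step)"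
    by (intro bv_summatory_mconv_diff_iterates summatory_imp_bv_summatory summatory_unit_step)
  from mconv_diff_power_saving[OF this IH]
  obtain C' where "\<forall>x\<ge>1. \<bar>mconv_diff ((mconv_diff ^^ j) unit_step) x\<bar> \<le> C' * x powr (1 - \<delta> / 4)"
    by blast
  thus ?case using IH by (intro exI[of _ C'] exI[of _ "\<delta> / 4"]) auto
qed

lemma mconv_diff_iterates_mconv_count:
  "bv_summatory g \<Longrightarrow> (mconv_diff ^^ j) (mconv_count g) = mconv_count ((mconv_diff ^^ j) g)"
  by (induction j) (simp_all add: mconv_diff_mconv_count bv_summatory_mconv_diff_iterates)

definition divisor_sum :: "nat \<Rightarrow> real \<Rightarrow> real" where
  "divisor_sum k x = real (\<Sum>n=1..nat \<lfloor>x\<rfloor>. dk k n)"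

definition factor_lists :: "nat \<Rightarrow> nat \<Rightarrow> nat list set" where
  "factor_lists k N = {xs. length xs = k \<and> prod_list xs \<in> {1..N}}"

lemma factor_lists_Suc: "factor_lists (Suc k) N = (\<Union>d\<in>{1..N}. (#) d ` factor_lists k (N div d))"
proof (intro set_eqI iffI)
  fix xs assume "xs \<in> factor_lists (Suc k) N"
  then obtain d ys where xs: "xs = d # ys" "length ys = k" and prod: "1 \<le> d * prod_list ys" "d * prod_list ys \<le> N"
    by (cases xs) (auto simp: factor_lists_def)
  have pos: "0 < d" "0 < prod_list ys" using prod by (auto simp: Suc_le_eq)
  have "d * 1 \<le> d * prod_list ys" using pos by (intro mult_le_mono2) auto
  hence "d * 1 \<le> N" using prod(2) by linarith
  moreover have "prod_list ys \<le> N div d" using pos prod(2) by (simp add: less_eq_div_iff_mult_less_eq mult.commute)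
  ultimately show "xs \<in> (\<Union>d\<in>{1..N}. (#) d ` factor_lists k (N div d))"
    using xs pos by (auto simp: Suc_le_eq factor_lists_def)
next
  fix xs assume "xs \<in> (\<Union>d\<in>{1..N}. (#) d ` factor_lists k (N div d))"
  thus "xs \<in> factor_lists (Suc k) N"
    by (auto simp: factor_lists_def less_eq_div_iff_mult_less_eq mult.commute Suc_le_eq)
qed

lemma finite_factor_lists: "finite (factor_lists k N)"
proof (induction k arbitrary: N)
  case 0 show ?case by (rule finite_subset[of _ "{[]}"]) (auto simp: factor_lists_def)
qed (simp add: factor_lists_Suc)

lemma card_factor_lists_Suc: "card (factor_lists (Suc k) N) = (\<Sum>d=1..N. card (factor_lists k (N div d)))"
proof -
  have "card (factor_lists (Suc k) N) = (\<Sum>d=1..N. card ((#) d ` factor_lists k (N div d)))"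
    unfolding factor_lists_Suc by (intro card_UN_disjoint) (auto simp: finite_factor_lists)
  also have "\<dots> = (\<Sum>d=1..N. card (factor_lists k (N div d)))"
    by (intro sum.cong card_image refl) auto
  finally show ?thesis .
qed

lemma sum_dk_conv_card: "(\<Sum>n=1..N. dk k n) = card (factor_lists k N)"
proof -
  have "factor_lists k N = (\<Union>n\<in>{1..N}. {xs. length xs = k \<and> prod_list xs = n})"
    by (auto simp: factor_lists_def)
  also have "card \<dots> = (\<Sum>n=1..N. card {xs::nat list. length xs = k \<and> prod_list xs = n})"
    by (intro card_UN_disjoint) (auto intro: finite_subset[OF _ finite_factor_lists[of k N]] simp: factor_lists_def)
  finally show ?thesis by (simp add: dk_def)
qed

lemma divisor_sum_0: "divisor_sum 0 = unit_step"
proof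
  fix x :: real
  have "factor_lists 0 (nat \<lfloor>x\<rfloor>) = (if 1 \<le> x then {[]} else {})"
    by (auto simp: factor_lists_def le_nat_iff le_floor_iff)
  thus "divisor_sum 0 x = unit_step x"
    unfolding divisor_sum_def sum_dk_conv_card by (simp add: unit_step_def)
qed

lemma nat_floor_div: "nat \<lfloor>x\<rfloor> div n = nat \<lfloor>x / real n\<rfloor>"
proof (cases "0 \<le> x")
  case True
  thus ?thesis using floor_divide_real_eq_div[of "int n" x] by (simp add: nat_div_distrib)
next
  case False
  hence "x / real n \<le> 0" by (simp add: divide_nonpos_nonneg)
  hence "\<lfloor>x / real n\<rfloor> \<le> 0" by (simp add: floor_le_iff)
  thus ?thesis using False by simp
qed

lemma divisor_sum_Suc: "divisor_sum (Suc k) = mconv_count (divisor_sum k)"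
  unfolding divisor_sum_def[abs_def] mconv_count_def[abs_def] sum_dk_conv_card card_factor_lists_Suc
  by (simp add: nat_floor_div)

lemma summatory_divisor_sum: "summatory (divisor_sum k)"
  by (induction k) (simp_all add: divisor_sum_0 divisor_sum_Suc summatory_unit_step summatory_mconv_count)

lemma log_poly_asymp_mconv_diff_iterates: "log_poly_asymp ((mconv_diff ^^ j) (divisor_sum k))"
proof (induction k arbitrary: j)
  case 0
  obtain C \<delta> where "0 < \<delta>" "\<delta> \<le> 1" "\<forall>x\<ge>1. \<bar>(mconv_diff ^^ j) unit_step x\<bar> \<le> C * x powr (1 - \<delta>)"
    using mconv_diff_iterates_unit_step by blast
  thus ?case unfolding log_poly_asymp_def divisor_sum_0 by (intro exI[of _ 0] exI[of _ C] exI[of _ \<delta>]) auto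
next
  case (Suc k)
  let ?g = "(mconv_diff ^^ j) (divisor_sum k)"
  have bv: "bv_summatory (divisor_sum k)" by (intro summatory_imp_bv_summatory summatory_divisor_sum)
  have "(mconv_diff ^^ j) (divisor_sum (Suc k)) = (\<lambda>x. mconv_leb ?g x + mconv_diff ?g x)"
    unfolding divisor_sum_Suc mconv_diff_iterates_mconv_count[OF bv] by (simp add: mconv_diff_def fun_eq_iff)
  moreover have "log_poly_asymp (\<lambda>x. mconv_leb ?g x + mconv_diff ?g x)"
    using Suc[of j] Suc[of "Suc j"]
    by (intro log_poly_asymp_add log_poly_asymp_mconv_leb bv_summatory_mconv_diff_iterates bv) auto
  ultimately show ?case by simp
qed

lemma log_poly_asymp_divisor_sum: "log_poly_asymp (divisor_sum k)"
  using log_poly_asymp_mconv_diff_iterates[of 0 k] by simp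

section \<open>Mellin transforms and moments\<close>

lemma nn_integral_dilate_powr:
  assumes [measurable]: "f \<in> borel_measurable borel" and neg: "\<And>r. r < 0 \<Longrightarrow> f r = 0" and c: "0 < c"
  shows "(\<integral>\<^sup>+r. ennreal (f (r / c) * r powr (- s - 1)) \<partial>lborel) =
    ennreal (c powr (- s)) * (\<integral>\<^sup>+r. ennreal (f r * r powr (- s - 1)) \<partial>lborel)"
proof -
  have "(\<integral>\<^sup>+r. ennreal (f (r / c) * r powr (- s - 1)) \<partial>lborel) =
      ennreal \<bar>c\<bar> * (\<integral>\<^sup>+r. ennreal (f ((0 + c * r) / c) * (0 + c * r) powr (- s - 1)) \<partial>lborel)"
    using c by (intro nn_integral_real_affine) auto
  also have "(\<integral>\<^sup>+r. ennreal (f ((0 + c * r) / c) * (0 + c * r) powr (- s - 1)) \<partial>lborel) =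
      (\<integral>\<^sup>+r. ennreal (c powr (- s - 1)) * ennreal (f r * r powr (- s - 1)) \<partial>lborel)"
  proof (intro nn_integral_cong)
    fix r :: real
    have "f ((0 + c * r) / c) * (0 + c * r) powr (- s - 1) = c powr (- s - 1) * (f r * r powr (- s - 1))"
      using c neg by (cases "r < 0") (simp_all add: powr_mult)
    thus "ennreal (f ((0 + c * r) / c) * (0 + c * r) powr (- s - 1)) =
        ennreal (c powr (- s - 1)) * ennreal (f r * r powr (- s - 1))"
      by (simp only: ennreal_mult' powr_ge_zero)
  qed
  also have "\<dots> = ennreal (c powr (- s - 1)) * (\<integral>\<^sup>+r. ennreal (f r * r powr (- s - 1)) \<partial>lborel)"
    by (rule nn_integral_cmult) measurable
  finally show ?thesis
    using c by (simp add: powr_diff ennreal_mult'[symmetric] flip: mult.assoc)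
qed

lemma Mellin_mconv_count:
  assumes f: "summatory f" and s: "1 < s"
  shows "(\<integral>\<^sup>+r. ennreal (mconv_count f r * r powr (- s - 1)) \<partial>lborel) =
    ennreal (real_zeta s) * (\<integral>\<^sup>+r. ennreal (f r * r powr (- s - 1)) \<partial>lborel)"
proof -
  let ?I = "\<integral>\<^sup>+r. ennreal (f r * r powr (- s - 1)) \<partial>lborel"
  note [measurable] = summatory_measurable[OF f]
  have pointwise: "ennreal (mconv_count f r * r powr (- s - 1)) = (\<Sum>n. ennreal (f (r / real (Suc n)) * r powr (- s - 1)))" for r
  proof -
    have "f (r / real (Suc n)) = 0" if "n \<notin> {..<nat \<lfloor>r\<rfloor>}" for n
    proof (rule summatory_eq_0[OF f])
      have "r < real (Suc n)" using that by simp linarith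
      thus "r / real (Suc n) < 1" by (simp add: divide_less_eq)
    qed
    hence "(\<Sum>n. ennreal (f (r / real (Suc n)) * r powr (- s - 1))) = (\<Sum>n<nat \<lfloor>r\<rfloor>. ennreal (f (r / real (Suc n)) * r powr (- s - 1)))"
      by (intro suminf_finite) auto
    also have "\<dots> = ennreal (\<Sum>n<nat \<lfloor>r\<rfloor>. f (r / real (Suc n)) * r powr (- s - 1))"
      using summatory_nonneg[OF f] by (intro sum_ennreal) auto
    also have "(\<Sum>n<nat \<lfloor>r\<rfloor>. f (r / real (Suc n)) * r powr (- s - 1)) = mconv_count f r * r powr (- s - 1)"
      unfolding mconv_count_def sum_distrib_right[symmetric] by (simp add: sum.atLeast1_atMost_eq)
    finally show ?thesis by simp
  qed
  have "(\<integral>\<^sup>+r. ennreal (mconv_count f r * r powr (- s - 1)) \<partial>lborel) = (\<Sum>n. \<integral>\<^sup>+r. ennreal (f (r / real (Suc n)) * r powr (- s - 1)) \<partial>lborel)"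
    unfolding pointwise by (rule nn_integral_suminf) measurable
  also have "\<dots> = (\<Sum>n. ennreal (real (Suc n) powr (- s)) * ?I)"
    by (intro suminf_cong nn_integral_dilate_powr) (auto simp: summatory_eq_0[OF f])
  also have "\<dots> = (\<Sum>n. ennreal (real (Suc n) powr (- s))) * ?I"
    by (rule ennreal_suminf_multc)
  also have "(\<Sum>n. ennreal (real (Suc n) powr (- s))) = ennreal (real_zeta s)"
    unfolding real_zeta_def using s by (intro suminf_ennreal2 summable_Suc_powr) auto
  finally show ?thesis .
qed

lemma DERIV_sum_poisson_weight: "DERIV (\<lambda>y. \<Sum>n\<le>j. poisson_weight n y) y :> - poisson_weight j y"
proof (induction j)
  case 0
  show ?case by (auto simp: poisson_weight_def intro!: derivative_eq_intros)
next
  case (Suc j)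
  have "DERIV (\<lambda>y. exp (- y)) y :> - exp (- y)" by (auto intro!: derivative_eq_intros)
  moreover have "DERIV (\<lambda>y. y ^ Suc j) y :> real (Suc j) * y ^ j" using DERIV_pow[of "Suc j" y] by simp
  ultimately have "DERIV (\<lambda>y. exp (- y) * y ^ Suc j) y :> - exp (- y) * y ^ Suc j + real (Suc j) * y ^ j * exp (- y)"
    by (rule DERIV_mult)
  hence "DERIV (\<lambda>y. exp (- y) * y ^ Suc j / fact (Suc j)) y :>
      (- exp (- y) * y ^ Suc j + real (Suc j) * y ^ j * exp (- y)) / fact (Suc j)"
    by (rule DERIV_cdivide)
  moreover have "(- exp (- y) * y ^ Suc j + real (Suc j) * y ^ j * exp (- y)) / fact (Suc j) =
      poisson_weight j y - poisson_weight (Suc j) y"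
    unfolding poisson_weight_def fact_Suc by (simp add: diff_divide_distrib mult.commute[of _ "exp (- y)"] del: of_nat_Suc)
  ultimately have "DERIV (poisson_weight (Suc j)) y :> poisson_weight j y - poisson_weight (Suc j) y"
    unfolding poisson_weight_def[abs_def] by (simp only:)
  from DERIV_add[OF Suc this] show ?case by simp
qed

lemma poisson_weight_tendsto_0: "(poisson_weight n \<longlongrightarrow> 0) at_top"
proof -
  have "((\<lambda>x::real. x ^ n / exp x / fact n) \<longlongrightarrow> 0 / fact n) at_top"
    by (rule tendsto_divide[OF tendsto_power_div_exp_0 tendsto_const]) simp
  thus ?thesis by (simp add: poisson_weight_def[abs_def] exp_minus field_simps)
qed

lemma has_bochner_integral_ln_power_powr:
  fixes w :: real
  assumes w: "0 < w"
  shows "has_bochner_integral lborel (\<lambda>r. indicator {1..} r * (ln r ^ j * r powr (- w - 1))) (fact j / w ^ Suc j)"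
proof -
  define F where "F r = - (fact j / w ^ Suc j) * (\<Sum>n\<le>j. poisson_weight n (w * ln r))" for r
  have F_deriv: "DERIV F r :> ln r ^ j * r powr (- w - 1)" if r: "1 \<le> r" for r
  proof -
    have inner: "DERIV (\<lambda>r. w * ln r) r :> w * (1 / r)"
      using DERIV_cmult[OF DERIV_ln_divide[of r], of w] r by simp
    have "DERIV F r :> - (fact j / w ^ Suc j) * (- poisson_weight j (w * ln r) * (w * (1 / r)))"
      unfolding F_def by (intro DERIV_cmult DERIV_chain2[OF DERIV_sum_poisson_weight inner])
    moreover have "r powr (- w - 1) = exp (- (w * ln r)) / r"
      using r by (simp add: powr_diff) (simp add: powr_def)
    hence "- (fact j / w ^ Suc j) * (- poisson_weight j (w * ln r) * (w * (1 / r))) = ln r ^ j * r powr (- w - 1)"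
      using w by (simp add: poisson_weight_def power_mult_distrib)
    ultimately show ?thesis by (simp only:)
  qed
  have "filterlim (\<lambda>r. w * ln r) at_top at_top"
    using w by (intro filterlim_tendsto_pos_mult_at_top[OF tendsto_const _ ln_at_top]) auto
  hence "(F \<longlongrightarrow> - (fact j / w ^ Suc j) * (\<Sum>n\<le>j. 0)) at_top"
    unfolding F_def by (intro tendsto_mult tendsto_const tendsto_sum filterlim_compose[OF poisson_weight_tendsto_0])
  hence "(F \<longlongrightarrow> 0) at_top" by simp
  from nn_integral_FTC_atLeast[OF _ F_deriv _ this]
  have "(\<integral>\<^sup>+r. ennreal (ln r ^ j * r powr (- w - 1)) * indicator {1..} r \<partial>lborel) = ennreal (0 - F 1)"
    by auto
  also have "F 1 = - (fact j / w ^ Suc j)"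
    by (simp add: F_def poisson_weight_def sum.atMost_shift)
  also have "(\<lambda>r. ennreal (ln r ^ j * r powr (- w - 1)) * indicator {1..} r) = (\<lambda>r::real. ennreal (indicator {1..} r * (ln r ^ j * r powr (- w - 1))))"
    by (auto simp: indicator_def fun_eq_iff)
  finally show ?thesis using w
    by (intro has_bochner_integral_nn_integral) (auto simp: indicator_def)
qed

lemma Mellin_divisor_sum:
  assumes s: "1 < s"
  shows "has_bochner_integral lborel (\<lambda>r. divisor_sum k r * r powr (- s - 1)) (real_zeta s ^ k / s)"
proof -
  have "(\<integral>\<^sup>+r. ennreal (divisor_sum k r * r powr (- s - 1)) \<partial>lborel) = ennreal (real_zeta s ^ k / s)"
  proof (induction k)
    case 0
    have "unit_step = indicator {1..}" by (auto simp: unit_step_def indicator_def fun_eq_iff)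
    hence "has_bochner_integral lborel (\<lambda>r. unit_step r * r powr (- s - 1)) (1 / s)"
      using has_bochner_integral_ln_power_powr[of s 0] s by simp
    thus ?case using s
      by (subst nn_integral_eq_integral) (auto simp: divisor_sum_0 has_bochner_integral_iff unit_step_def)
  next
    case (Suc k)
    thus ?case using Mellin_mconv_count[OF summatory_divisor_sum s, of k] real_zeta_nonneg[OF s] s
      by (simp add: divisor_sum_Suc ennreal_mult'[symmetric])
  qed
  thus ?thesis using summatory_measurable[OF summatory_divisor_sum[of k]] summatory_nonneg[OF summatory_divisor_sum] real_zeta_nonneg[OF s] s
    by (intro has_bochner_integral_nn_integral) auto
qed

lemma poisson_weight_le_1:
  assumes "0 \<le> x" shows "poisson_weight n x \<le> 1"
  using sum_le_suminf[OF sums_summable[OF poisson_weight_sums], of "{n}" x] assms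
  by (simp add: poisson_weight_nonneg sums_unique[OF poisson_weight_sums, symmetric])

lemma ln_power_le_powr:
  fixes r \<eta> :: real
  assumes "1 \<le> r" "0 < \<eta>"
  shows "ln r ^ m \<le> fact m / \<eta> ^ m * r powr \<eta>"
  using poisson_weight_le_1[of "\<eta> * ln r" m] assms
  by (simp add: poisson_weight_def powr_def exp_minus power_mult_distrib field_simps)

definition powr_integrable :: "real \<Rightarrow> (real \<Rightarrow> complex) \<Rightarrow> bool" where
  "powr_integrable \<eta> g \<longleftrightarrow> g \<in> borel_measurable borel \<and> (\<forall>r<1. g r = 0) \<and> integrable lborel (\<lambda>r. norm (g r) * r powr \<eta>)"

definition log_moment :: "(real \<Rightarrow> complex) \<Rightarrow> nat \<Rightarrow> complex" where
  "log_moment g m = (\<integral>r. g r * of_real (ln r ^ m) \<partial>lborel)"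

lemma norm_log_moment_integrand_le:
  assumes "powr_integrable \<eta> g" "0 < \<eta>"
  shows "norm (g r * of_real (ln r ^ m)) \<le> fact m / \<eta> ^ m * (norm (g r) * r powr \<eta>)"
proof (cases "r < 1")
  case False
  hence "norm (g r) * \<bar>ln r ^ m\<bar> \<le> norm (g r) * (fact m / \<eta> ^ m * r powr \<eta>)"
    using ln_power_le_powr[of r \<eta> m] assms by (intro mult_left_mono) auto
  thus ?thesis by (simp only: norm_mult norm_of_real) (simp add: mult_ac)
qed (use assms in \<open>simp add: powr_integrable_def\<close>)

lemma log_moment_integrable:
  assumes "powr_integrable \<eta> g" "0 < \<eta>"
  shows "integrable lborel (\<lambda>r. g r * of_real (ln r ^ m))"
proof (rule Bochner_Integration.integrable_bound)
  show "integrable lborel (\<lambda>r. fact m / \<eta> ^ m * (norm (g r) * r powr \<eta>))"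
    using assms by (intro integrable_mult_right) (simp add: powr_integrable_def)
  have [measurable]: "g \<in> borel_measurable borel" using assms by (simp add: powr_integrable_def)
  show "(\<lambda>r. g r * of_real (ln r ^ m)) \<in> borel_measurable lborel" by measurable
  show "AE r in lborel. norm (g r * of_real (ln r ^ m)) \<le> norm (fact m / \<eta> ^ m * (norm (g r) * r powr \<eta>))"
    by (intro AE_I2 order_trans[OF norm_log_moment_integrand_le[OF assms]]) (simp only: real_norm_def abs_ge_self)
qed

lemma log_moment_sums:
  assumes g: "powr_integrable \<eta> g" and \<eta>: "0 < \<eta>"
    and summable: "summable (\<lambda>m. norm (a m) * (fact m / \<eta> ^ m))"
    and f: "\<And>y. 0 \<le> y \<Longrightarrow> (\<lambda>m. a m * of_real (y ^ m)) sums f y"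
  shows "(\<lambda>m. a m * log_moment g m) sums (\<integral>r. g r * f (ln r) \<partial>lborel)"
proof -
  define K where "K = (\<integral>r. norm (g r) * r powr \<eta> \<partial>lborel)"
  let ?h = "\<lambda>m r. a m * (g r * of_real (ln r ^ m))"
  have norm_h_le: "norm (?h m r) \<le> norm (a m) * (fact m / \<eta> ^ m) * (norm (g r) * r powr \<eta>)" for m r
    unfolding norm_mult[of "a m"] mult.assoc[of "norm (a m)"]
    by (intro mult_left_mono norm_log_moment_integrand_le[OF g \<eta>]) auto
  have "(\<lambda>m. \<integral>r. ?h m r \<partial>lborel) sums (\<integral>r. (\<Sum>m. ?h m r) \<partial>lborel)"
  proof (rule sums_integral)
    show h_int: "integrable lborel (?h m)" for m by (intro integrable_mult_right log_moment_integrable[OF g \<eta>])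
    show "AE r in lborel. summable (\<lambda>m. norm (?h m r))"
      using norm_h_le by (intro AE_I2 summable_comparison_test'[OF summable_mult2[OF summable]]) auto
    show "summable (\<lambda>m. \<integral>r. norm (?h m r) \<partial>lborel)"
    proof (rule summable_comparison_test'[OF summable_mult2[OF summable, of K]])
      fix m
      have "(\<integral>r. norm (?h m r) \<partial>lborel) \<le> (\<integral>r. norm (a m) * (fact m / \<eta> ^ m) * (norm (g r) * r powr \<eta>) \<partial>lborel)"
        using g by (intro integral_mono integrable_norm h_int integrable_mult_right norm_h_le) (simp add: powr_integrable_def)
      thus "norm (\<integral>r. norm (?h m r) \<partial>lborel) \<le> norm (a m) * (fact m / \<eta> ^ m) * K"
        by (simp add: K_def)
    qed
  qed
  moreover have "(\<Sum>m. ?h m r) = g r * f (ln r)" for r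
  proof (cases "r < 1")
    case False
    hence "(\<lambda>m. g r * (a m * of_real (ln r ^ m))) sums (g r * f (ln r))" by (intro sums_mult f) auto
    thus ?thesis by (simp add: sums_iff mult_ac)
  qed (use g in \<open>simp add: powr_integrable_def\<close>)
  ultimately show ?thesis by (simp add: log_moment_def)
qed

lemma has_fps_expansion_log_Laplace:
  assumes g: "powr_integrable \<eta> g" and \<eta>: "0 < \<eta>"
  shows "(\<lambda>z. \<integral>r. g r * exp (- z * of_real (ln r)) \<partial>lborel)
    has_fps_expansion Abs_fps (\<lambda>m. (-1) ^ m / fact m * log_moment g m)"
proof (rule has_fps_expansionI)
  have "\<forall>\<^sub>F z::complex in nhds 0. z \<in> ball 0 \<eta>"
    using \<eta> by (intro eventually_nhds_in_open) auto
  thus "\<forall>\<^sub>F z in nhds 0. (\<lambda>m. fps_nth (Abs_fps (\<lambda>m. (-1) ^ m / fact m * log_moment g m)) m * z ^ m)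
      sums (\<integral>r. g r * exp (- z * of_real (ln r)) \<partial>lborel)"
  proof eventually_elim
    case (elim z)
    have "(\<lambda>m. (- z) ^ m / fact m * log_moment g m) sums (\<integral>r. g r * exp (- z * of_real (ln r)) \<partial>lborel)"
    proof (rule log_moment_sums[OF g \<eta>])
      have "norm ((- z) ^ m / fact m) * (fact m / \<eta> ^ m) = (norm z / \<eta>) ^ m" for m
        by (simp add: norm_divide norm_power power_divide)
      thus "summable (\<lambda>m. norm ((- z) ^ m / fact m) * (fact m / \<eta> ^ m))"
        using elim \<eta> by (simp add: summable_geometric)
      show "(\<lambda>m. (- z) ^ m / fact m * of_real (y ^ m)) sums exp (- z * of_real y)" for y
      proof -
        have "(- z) ^ m / fact m * of_real (y ^ m) = (- z * of_real y) ^ m /\<^sub>R fact m" for m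
          unfolding power_mult_distrib by (simp add: scaleR_conv_of_real divide_inverse mult_ac)
        thus ?thesis using exp_converges[of "- z * of_real y"] by (simp only:)
      qed
    qed
    thus ?case by (simp add: power_minus[of z] mult_ac)
  qed
qed

lemma has_laurent_expansion_eqI_positive_reals:
  assumes f: "f has_laurent_expansion F" and g: "g has_laurent_expansion G"
    and eq: "\<And>w. 0 < w \<Longrightarrow> f (of_real w) = g (of_real w)"
  shows "F = G"
proof (rule ccontr)
  assume "F \<noteq> G"
  hence "\<forall>\<^sub>F z in at 0. f z - g z \<noteq> 0"
    by (intro has_laurent_expansion_nonzero_imp_eventually_nonzero[OF has_laurent_expansion_diff[OF f g]]) simp
  then obtain d where d: "0 < d" "\<And>z. z \<noteq> 0 \<Longrightarrow> norm z < d \<Longrightarrow> f z - g z \<noteq> 0"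
    by (auto simp: eventually_at)
  show False using d(2)[of "of_real (d / 2)"] eq[of "d / 2"] d(1) by simp
qed

lemma laurent_coeffs_eqI_positive_reals:
  fixes f g :: "complex \<Rightarrow> complex" and c :: "complex poly"
  assumes f: "f has_fps_expansion F" and g: "g has_fps_expansion G"
    and eq: "\<And>w. 0 < w \<Longrightarrow> f (of_real w) / of_real w ^ k = g (of_real w) + (\<Sum>j\<le>degree c. coeff c j / of_real w ^ Suc j)"
  shows "coeff c j = (if j < k then fps_nth F (k - 1 - j) else 0)" and "fps_nth G m = fps_nth F (k + m)"
proof -
  let ?P = "\<Sum>j\<le>degree c. fls_const (coeff c j) * fls_X_intpow (- int (Suc j))"
  have "(\<lambda>w. f w * w powi (- int k)) has_laurent_expansion fls_shift (int k) (fps_to_fls F)"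
    by (intro has_laurent_expansion_shift' has_laurent_expansion_fps f)
  moreover have "(\<lambda>w. g w + (\<Sum>j\<le>degree c. coeff c j * w powi (- int (Suc j)))) has_laurent_expansion fps_to_fls G + ?P"
    by (intro laurent_expansion_intros has_laurent_expansion_fps g)
  moreover have "f (of_real w) * of_real w powi (- int k) =
      g (of_real w) + (\<Sum>j\<le>degree c. coeff c j * of_real w powi (- int (Suc j)))" if "0 < w" for w
    using eq[OF that] by (simp only: power_int_minus power_int_of_nat divide_inverse)
  ultimately have fls_eq: "fls_shift (int k) (fps_to_fls F) = fps_to_fls G + ?P"
    by (rule has_laurent_expansion_eqI_positive_reals)
  have P_nth: "fls_nth ?P n = (if n < 0 then coeff c (nat (- n - 1)) else 0)" for n
  proof -
    have "fls_nth ?P n = (\<Sum>j\<le>degree c. if n = - int (Suc j) then coeff c j else 0)"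
      unfolding fls_nth_sum by (intro sum.cong) auto
    also have "\<dots> = (\<Sum>j\<le>degree c. if n < 0 \<and> j = nat (- n - 1) then coeff c j else 0)"
      by (intro sum.cong) auto
    finally show ?thesis by (auto simp: coeff_eq_0)
  qed
  have exponent: "nat (- 1 - int j + int k) = k - Suc j" by linarith
  show "coeff c j = (if j < k then fps_nth F (k - 1 - j) else 0)"
    using arg_cong[OF fls_eq, of "\<lambda>F. fls_nth F (- int (Suc j))"] P_nth[of "- int (Suc j)"]
    by (auto simp: exponent)
  show "fps_nth G m = fps_nth F (k + m)"
    using arg_cong[OF fls_eq, of "\<lambda>F. fls_nth F (int m)"] P_nth[of "int m"] by (simp add: nat_add_distrib add.commute)
qed

lemma powr_integrable_power_saving:
  fixes e :: "real \<Rightarrow> real"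
  assumes [measurable]: "e \<in> borel_measurable borel" and \<delta>: "0 < \<delta>"
    and e: "\<And>r. 1 \<le> r \<Longrightarrow> \<bar>e r\<bar> \<le> C * r powr (1 - \<delta>)"
  shows "powr_integrable (\<delta> / 2) (\<lambda>r. indicator {1..} r * of_real (e r / r\<^sup>2))"
proof -
  let ?g = "\<lambda>r. indicator {1..} r * complex_of_real (e r / r\<^sup>2)"
  have "integrable lborel (\<lambda>r. norm (?g r) * r powr (\<delta> / 2))"
  proof (rule Bochner_Integration.integrable_bound)
    show "integrable lborel (\<lambda>r. C * (indicator {1..} r * (ln r ^ 0 * r powr (- (\<delta> / 2) - 1))))"
      using has_bochner_integral_ln_power_powr[of "\<delta> / 2" 0] \<delta> by (intro integrable_mult_right) (auto simp: has_bochner_integral_iff)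
    show "AE r in lborel. norm (norm (?g r) * r powr (\<delta> / 2)) \<le> norm (C * (indicator {1..} r * (ln r ^ 0 * r powr (- (\<delta> / 2) - 1))))"
    proof (intro AE_I2)
      fix r :: real
      show "norm (norm (?g r) * r powr (\<delta> / 2)) \<le> norm (C * (indicator {1..} r * (ln r ^ 0 * r powr (- (\<delta> / 2) - 1))))"
      proof (cases "1 \<le> r")
        case r: True
        have "norm (norm (?g r) * r powr (\<delta> / 2)) = \<bar>e r\<bar> * (r powr (\<delta> / 2) / r\<^sup>2)"
          using r by (simp add: norm_divide norm_power)
        also have "\<dots> \<le> C * r powr (1 - \<delta>) * (r powr (\<delta> / 2) / r\<^sup>2)"
          using r by (intro mult_right_mono e) auto
        also have "\<dots> = C * (r powr (1 - \<delta>) * r powr (\<delta> / 2) * (1 / r\<^sup>2))" by simp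
        also have "1 / r\<^sup>2 = r powr (- 2)" using r by (simp add: powr_minus_divide)
        also have "r powr (1 - \<delta>) * r powr (\<delta> / 2) * r powr (- 2) = r powr (- (\<delta> / 2) - 1)"
          unfolding powr_add[symmetric] by (intro arg_cong2[where f = "(powr)"]) auto
        also have "C * r powr (- (\<delta> / 2) - 1) \<le> norm (C * r powr (- (\<delta> / 2) - 1))" by simp
        finally show ?thesis using r by simp
      qed simp
    qed
  qed measurable
  thus ?thesis by (auto simp: powr_integrable_def)
qed

lemma Laplace_divisor_sum_remainder:
  assumes w: "0 < w"
  shows "(\<integral>r. indicator {1..} r * of_real ((divisor_sum k r - r * poly p (ln r)) / r\<^sup>2) * exp (- of_real w * of_real (ln r)) \<partial>lborel)
    = complex_of_real (real_zeta (1 + w) ^ k / (1 + w) - (\<Sum>j\<le>degree p. coeff p j * (fact j / w ^ Suc j)))"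
proof -
  let ?Q = "\<lambda>r. \<Sum>j\<le>degree p. coeff p j * (indicator {1..} r * (ln r ^ j * r powr (- w - 1)))"
  have "has_bochner_integral lborel (\<lambda>r. divisor_sum k r * r powr (- (1 + w) - 1) - ?Q r)
      (real_zeta (1 + w) ^ k / (1 + w) - (\<Sum>j\<le>degree p. coeff p j * (fact j / w ^ Suc j)))"
    using w by (intro has_bochner_integral_diff has_bochner_integral_sum has_bochner_integral_mult_right
        Mellin_divisor_sum has_bochner_integral_ln_power_powr) auto
  moreover have "indicator {1..} r * of_real ((divisor_sum k r - r * poly p (ln r)) / r\<^sup>2) * exp (- of_real w * of_real (ln r))
      = complex_of_real (divisor_sum k r * r powr (- (1 + w) - 1) - ?Q r)" for r
  proof (cases "r < 1")
    case True
    thus ?thesis by (simp add: summatory_eq_0[OF summatory_divisor_sum])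
  next
    case False
    hence r: "1 \<le> r" by simp
    have "(divisor_sum k r - r * poly p (ln r)) / r\<^sup>2 * exp (- w * ln r)
        = divisor_sum k r * (r powr (- w) / r\<^sup>2) - poly p (ln r) * (r * r powr (- w) / r\<^sup>2)"
      using r by (simp add: powr_def diff_divide_distrib algebra_simps)
    also have "r powr (- w) / r\<^sup>2 = r powr (- (1 + w) - 1)"
      using r by (simp add: powr_diff powr_minus power2_eq_square powr_add field_simps)
    also have "r * r powr (- w) / r\<^sup>2 = r powr (- w - 1)"
      using r by (simp add: powr_diff power2_eq_square)
    also have "poly p (ln r) * r powr (- w - 1) = ?Q r"
      using r by (simp add: poly_altdef sum_distrib_right mult.assoc)
    finally show ?thesis
      using r by (simp only: indicator_simps atLeast_iff mult_1_left of_real_mult[symmetric] of_real_minus[symmetric] exp_of_real of_real_1)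
  qed
  ultimately show ?thesis
    by (simp only: integral_complex_of_real has_bochner_integral_iff)
qed

text \<open>Near \<open>s = 1\<close>, the Mellin transform of the summatory function is known both as \<open>\<zeta>(s)\<^sup>k / s\<close> and
  through the main term and the moments of the remainder; comparing Laurent coefficients determines both.\<close>

lemma divisor_sum_laurent_coeffs:
  fixes p :: "real poly" and k :: nat
  defines "g \<equiv> \<lambda>r. indicator {1..} r * complex_of_real ((divisor_sum k r - r * poly p (ln r)) / r\<^sup>2)"
  assumes g: "powr_integrable \<eta> g" and \<eta>: "0 < \<eta>"
  shows "of_real (coeff p j * fact j) = (if j < k then quot_coef k (k - 1 - j) else 0)"
    and "log_moment g m = (-1) ^ m * fact m * quot_coef k (k + m)"
proof -
  define c where "c = (\<Sum>j\<le>degree p. monom (complex_of_real (coeff p j * fact j)) j)"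
  have coeff_c: "coeff c j = of_real (coeff p j * fact j)" for j
    by (auto simp: c_def coeff_sum coeff_eq_0)
  have degree_c: "degree c = degree p"
  proof (rule order_antisym; intro degree_le allI impI)
    show "coeff c i = 0" if "degree p < i" for i using that by (simp add: coeff_c coeff_eq_0)
    show "coeff p i = 0" if "degree c < i" for i using coeff_eq_0[OF that] by (simp add: coeff_c)
  qed
  have laurent_eq: "zeta_pow_reg k (1 + of_real w) * inverse (1 + of_real w) / of_real w ^ k =
      (\<integral>r. g r * exp (- of_real w * of_real (ln r)) \<partial>lborel) + (\<Sum>j\<le>degree c. coeff c j / of_real w ^ Suc j)"
    if w: "0 < w" for w
  proof -
    have "zeta (1 + of_real w) = of_real (real_zeta (1 + w))" using zeta_of_real[of "1 + w"] w by simp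
    hence "zeta_pow_reg k (1 + of_real w) * inverse (1 + of_real w) / of_real w ^ k = of_real (real_zeta (1 + w) ^ k / (1 + w))"
      using w by (simp add: zeta_pow_reg_def divide_inverse)
    moreover have "(\<Sum>j\<le>degree c. coeff c j / of_real w ^ Suc j) = of_real (\<Sum>j\<le>degree p. coeff p j * (fact j / w ^ Suc j))"
      by (simp add: coeff_c degree_c)
    ultimately show ?thesis
      unfolding g_def Laplace_divisor_sum_remainder[OF w] by simp
  qed
  note coeffs = laurent_coeffs_eqI_positive_reals
    [OF has_fps_expansion_quot_coef has_fps_expansion_log_Laplace[OF g \<eta>] laurent_eq]
  show "of_real (coeff p j * fact j) = (if j < k then quot_coef k (k - 1 - j) else 0)"
    using coeffs(1)[of j] by (simp add: coeff_c)
  have quot_coef_eq: "quot_coef k (k + m) = (-1) ^ m / fact m * log_moment g m" using coeffs(2)[of m] by simp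
  show "log_moment g m = (-1) ^ m * fact m * quot_coef k (k + m)"
    unfolding quot_coef_eq by (simp add: minus_one_power_iff)
qed

lemma P_poly_eqI:
  assumes k: "1 \<le> k"
    and p: "\<And>j. of_real (coeff p j * fact j) = (if j < k then quot_coef k (k - 1 - j) else 0)"
  shows "P_poly k X = of_real (poly p X)"
proof -
  have "degree p \<le> k - 1"
  proof (rule degree_le, intro allI impI)
    fix j assume "k - 1 < j"
    hence "complex_of_real (coeff p j * fact j) = 0" using p[of j] by simp
    thus "coeff p j = 0" by (simp only: of_real_eq_0_iff mult_eq_0_iff) simp
  qed
  hence "poly p X = (\<Sum>j\<le>k - 1. coeff p j * X ^ j)"
    unfolding poly_altdef by (intro sum.mono_neutral_left) (auto simp: coeff_eq_0)
  moreover have "a_coef j k = of_real (coeff p j * fact j)" if "j \<le> k - 1" for j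
    using p[of j] that k by (simp add: a_coef_conv_quot_coef)
  ultimately show ?thesis by (simp add: P_poly_def atLeast0AtMost)
qed

definition Delta_kernel :: "nat \<Rightarrow> real \<Rightarrow> complex" where
  "Delta_kernel k r = indicator {1..} r * Delta k r / of_real (r\<^sup>2)"

lemma Delta_kernel_moments:
  assumes k: "1 \<le> k"
  obtains \<eta> where "0 < \<eta>" "powr_integrable \<eta> (Delta_kernel k)"
    "\<And>m. log_moment (Delta_kernel k) m = (-1) ^ m * fact m * quot_coef k (k + m)"
proof -
  obtain p C \<delta> where \<delta>: "0 < \<delta>" and C: "\<And>x. 1 \<le> x \<Longrightarrow> \<bar>divisor_sum k x - x * poly p (ln x)\<bar> \<le> C * x powr (1 - \<delta>)"
    using log_poly_asymp_divisor_sum[of k] by (rule log_poly_asympE) blast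
  let ?e = "\<lambda>r. divisor_sum k r - r * poly p (ln r)"
  let ?g = "\<lambda>r. indicator {1..} r * complex_of_real (?e r / r\<^sup>2)"
  have "?e \<in> borel_measurable borel"
    using summatory_measurable[OF summatory_divisor_sum[of k]] unfolding poly_altdef by measurable
  hence g: "powr_integrable (\<delta> / 2) ?g" using \<delta> C by (rule powr_integrable_power_saving)
  note coeffs = divisor_sum_laurent_coeffs[OF g half_gt_zero[OF \<delta>]]
  have "Delta k r = of_real (?e r)" for r
    unfolding Delta_def P_poly_eqI[OF k coeffs(1)] by (simp add: divisor_sum_def)
  hence "Delta_kernel k = ?g" by (simp add: Delta_kernel_def fun_eq_iff)
  with that[of "\<delta> / 2"] g coeffs(2) \<delta> show thesis by simp
qed

section \<open>Series expansion of phi\<close>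

lemma bessel_J0_sums:
  assumes "0 \<le> (y::real)"
  shows "(\<lambda>m. (-1) ^ m / (fact m)\<^sup>2 * y ^ m) sums bessel_J0 (2 * sqrt y)"
proof -
  have "(2 * sqrt y / 2) ^ (2 * m) = y ^ m" for m
    using assms by (simp add: power_mult)
  hence J0_eq: "bessel_J0 (2 * sqrt y) = (\<Sum>m. (-1) ^ m / (fact m)\<^sup>2 * y ^ m)"
    unfolding bessel_J0_def by (simp only:) simp
  have "summable (\<lambda>m. (-1) ^ m / (fact m)\<^sup>2 * y ^ m)"
  proof (rule summable_comparison_test'[OF summable_exp[of y]])
    fix m
    have "y ^ m / (fact m)\<^sup>2 \<le> y ^ m / fact m"
      using assms self_le_power[of "fact m :: real" 2] by (intro divide_left_mono) auto
    moreover have "norm ((-1) ^ m / (fact m)\<^sup>2 * y ^ m) = y ^ m / (fact m)\<^sup>2"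
      using assms by (simp add: abs_mult power_abs)
    ultimately show "norm ((-1) ^ m / (fact m)\<^sup>2 * y ^ m) \<le> inverse (fact m) * y ^ m"
      by (simp add: divide_inverse mult.commute)
  qed
  thus ?thesis unfolding J0_eq by (rule summable_sums)
qed

lemma phi_sums_quot_coef:
  assumes k: "1 \<le> k" and x: "0 \<le> x"
  shows "(\<lambda>m. quot_coef k (k + m) / fact m * of_real x ^ m) sums phi k x"
proof -
  obtain \<eta> where \<eta>: "0 < \<eta>" and kernel: "powr_integrable \<eta> (Delta_kernel k)"
    and moments: "\<And>m. log_moment (Delta_kernel k) m = (-1) ^ m * fact m * quot_coef k (k + m)"
    using k by (rule Delta_kernel_moments) blast
  let ?a = "\<lambda>m. (-1) ^ m / (fact m)\<^sup>2 * x ^ m"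
  have "(\<lambda>m. of_real (?a m) * log_moment (Delta_kernel k) m) sums
      (\<integral>r. Delta_kernel k r * of_real (bessel_J0 (2 * sqrt (x * ln r))) \<partial>lborel)"
  proof (rule log_moment_sums[OF kernel \<eta>])
    have "norm (complex_of_real (?a m)) * (fact m / \<eta> ^ m) = inverse (fact m) * (x / \<eta>) ^ m" for m
      unfolding norm_of_real using x \<eta> by (simp add: abs_mult abs_div power_divide power2_eq_square field_simps)
    thus "summable (\<lambda>m. norm (complex_of_real (?a m)) * (fact m / \<eta> ^ m))"
      using summable_exp[of "x / \<eta>"] by simp
    fix y :: real assume "0 \<le> y"
    hence "(\<lambda>m. ?a m * y ^ m) sums bessel_J0 (2 * sqrt (x * y))"
      using bessel_J0_sums[of "x * y"] x by (simp add: power_mult_distrib mult_ac)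
    thus "(\<lambda>m. of_real (?a m) * of_real (y ^ m)) sums complex_of_real (bessel_J0 (2 * sqrt (x * y)))"
      unfolding of_real_mult[symmetric] by (rule sums_of_real)
  qed
  moreover have "of_real (?a m) * log_moment (Delta_kernel k) m = quot_coef k (k + m) / fact m * of_real x ^ m" for m
    unfolding moments by (simp add: power2_eq_square field_simps minus_one_power_iff)
  moreover have "(\<integral>r. Delta_kernel k r * of_real (bessel_J0 (2 * sqrt (x * ln r))) \<partial>lborel) = phi k x"
    unfolding phi_def set_lebesgue_integral_def
    by (intro Bochner_Integration.integral_cong) (auto simp: Delta_kernel_def indicator_def)
  ultimately show ?thesis by (simp only:)
qed

text \<open>The Poisson weights are the coefficients of \<open>e\<^sup>-\<^sup>x e\<^sup>x = 1\<close>, so this is a Cauchy product with \<open>1\<close>.\<close>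

lemma binomial_transform_poisson_weight_sums:
  fixes b :: "nat \<Rightarrow> complex"
  assumes b: "\<And>x. 0 \<le> x \<Longrightarrow> (\<lambda>m. b m / fact m * of_real x ^ m) sums f x" and x: "0 \<le> x"
  shows "(\<lambda>n. (\<Sum>m\<le>n. of_nat (n choose m) * b m) * of_real (poisson_weight n x)) sums f x"
proof -
  let ?a = "\<lambda>m. b m / fact m * of_real x ^ m" and ?w = "\<lambda>m. complex_of_real (poisson_weight m x)"
  have "summable (\<lambda>m. b m / fact m * of_real (x + 1) ^ m)" using b[of "x + 1"] x by (simp add: sums_summable)
  hence abs_a: "summable (\<lambda>m. norm (?a m))" by (rule powser_insidea) (use x in auto)
  have "summable (\<lambda>m. norm (?w m))"
    using sums_summable[OF poisson_weight_sums] poisson_weight_nonneg[OF x] by simp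
  from Cauchy_product_sums[OF abs_a this]
  have "(\<lambda>n. \<Sum>i\<le>n. ?a i * ?w (n - i)) sums (f x * 1)"
    using b[OF x] sums_of_real[OF poisson_weight_sums, of x, where 'a = complex] by (simp add: sums_iff)
  moreover have "(\<Sum>i\<le>n. ?a i * ?w (n - i)) = (\<Sum>m\<le>n. of_nat (n choose m) * b m) * ?w n" for n
    unfolding sum_distrib_right
  proof (intro sum.cong refl)
    fix i assume "i \<in> {..n}"
    hence i: "i \<le> n" by simp
    have "of_nat (n choose i) = fact n / (fact i * fact (n - i) :: complex)" using i by (rule binomial_fact)
    moreover have "x ^ n = x ^ i * x ^ (n - i)" using i by (simp add: power_add[symmetric])
    ultimately show "?a i * ?w (n - i) = of_nat (n choose i) * b i * ?w n"
      by (simp add: poisson_weight_def field_simps)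
  qed
  ultimately show ?thesis by simp
qed

lemma phi_sums_signed_ell:
  assumes "1 \<le> k" "0 \<le> x"
  shows "(\<lambda>n. signed_ell k n * of_real (poisson_weight n x)) sums phi k x"
  unfolding signed_ell_conv_quot_coef
  by (intro binomial_transform_poisson_weight_sums phi_sums_quot_coef assms)

lemma cauchy_schwarz_weighted:
  fixes c :: "nat \<Rightarrow> complex" and e :: "nat \<Rightarrow> real"
  assumes e: "\<And>n. 0 \<le> e n" and sum_e: "(\<Sum>n\<in>A. e n) \<le> 1"
  shows "(norm (\<Sum>n\<in>A. c n * of_real (e n)))\<^sup>2 \<le> (\<Sum>n\<in>A. (norm (c n))\<^sup>2 * e n)"
proof -
  have "norm (\<Sum>n\<in>A. c n * of_real (e n)) \<le> (\<Sum>n\<in>A. (norm (c n) * sqrt (e n)) * sqrt (e n))"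
    using e by (intro order_trans[OF norm_sum] sum_mono) (simp add: norm_mult mult.assoc)
  hence "(norm (\<Sum>n\<in>A. c n * of_real (e n)))\<^sup>2 \<le> (\<Sum>n\<in>A. (norm (c n) * sqrt (e n)) * sqrt (e n))\<^sup>2"
    by (intro power_mono) auto
  also have "\<dots> \<le> (\<Sum>n\<in>A. (norm (c n) * sqrt (e n))\<^sup>2) * (\<Sum>n\<in>A. (sqrt (e n))\<^sup>2)"
    by (rule Cauchy_Schwarz_ineq_sum)
  also have "\<dots> = (\<Sum>n\<in>A. (norm (c n))\<^sup>2 * e n) * (\<Sum>n\<in>A. e n)"
    using e by (simp add: power_mult_distrib)
  also have "\<dots> \<le> (\<Sum>n\<in>A. (norm (c n))\<^sup>2 * e n) * 1"
    using e sum_e by (intro mult_left_mono sum_nonneg) auto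
  finally show ?thesis by simp
qed

lemma cauchy_schwarz_weighted_suminf:
  fixes c :: "nat \<Rightarrow> complex" and e :: "nat \<Rightarrow> real"
  assumes e: "\<And>n. 0 \<le> e n" and sum_e: "\<And>M. (\<Sum>n<M. e n) \<le> 1" and sums: "(\<lambda>n. c n * of_real (e n)) sums S"
  shows "ennreal ((norm S)\<^sup>2) \<le> (\<Sum>n. ennreal ((norm (c n))\<^sup>2 * e n))"
proof (rule LIMSEQ_le_const2)
  show "(\<lambda>M. ennreal ((norm (\<Sum>n<M. c n * of_real (e n)))\<^sup>2)) \<longlonglongrightarrow> ennreal ((norm S)\<^sup>2)"
    using sums unfolding sums_def by (intro tendsto_ennrealI tendsto_power tendsto_norm)
  show "\<exists>N. \<forall>M\<ge>N. ennreal ((norm (\<Sum>n<M. c n * of_real (e n)))\<^sup>2) \<le> (\<Sum>n. ennreal ((norm (c n))\<^sup>2 * e n))"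
  proof (intro exI allI impI)
    fix M
    have "ennreal ((norm (\<Sum>n<M. c n * of_real (e n)))\<^sup>2) \<le> ennreal (\<Sum>n<M. (norm (c n))\<^sup>2 * e n)"
      using e sum_e by (intro ennreal_leI cauchy_schwarz_weighted)
    also have "\<dots> = (\<Sum>n<M. ennreal ((norm (c n))\<^sup>2 * e n))"
      using e by (intro sum_ennreal[symmetric]) auto
    also have "\<dots> \<le> (\<Sum>n. ennreal ((norm (c n))\<^sup>2 * e n))" by (intro sum_le_suminf) auto
    finally show "ennreal ((norm (\<Sum>n<M. c n * of_real (e n)))\<^sup>2) \<le> (\<Sum>n. ennreal ((norm (c n))\<^sup>2 * e n))" .
  qed
qed

lemma sum_shifted_poisson_weight_le_1:
  assumes "0 \<le> x" shows "(\<Sum>n<M. poisson_weight (n + m) x) \<le> 1"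
proof -
  have "(\<Sum>n<M. poisson_weight (n + m) x) = (\<Sum>n\<in>(\<lambda>n. n + m) ` {..<M}. poisson_weight n x)"
    by (subst sum.reindex) (auto simp: inj_on_def)
  also have "\<dots> \<le> (\<Sum>n. poisson_weight n x)"
    using sums_summable[OF poisson_weight_sums] poisson_weight_nonneg[OF assms] by (intro sum_le_suminf) auto
  also have "\<dots> = 1" by (rule sums_unique[OF poisson_weight_sums, symmetric])
  finally show ?thesis .
qed

lemma sq_dist_poisson_series_le:
  fixes c :: "nat \<Rightarrow> complex"
  assumes f: "\<And>x. 0 \<le> x \<Longrightarrow> (\<lambda>n. c n * of_real (poisson_weight n x)) sums f x"
    and c: "summable (\<lambda>n. (norm (c n))\<^sup>2)"
  shows "sq_dist (\<lambda>x. \<Sum>n\<le>N. c n * of_real (poisson_weight n x)) f \<le> ennreal (\<Sum>n. (norm (c (n + Suc N)))\<^sup>2)"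
proof -
  let ?q = "\<lambda>n. (norm (c (n + Suc N)))\<^sup>2" and ?e = "\<lambda>n. poisson_weight (n + Suc N)"
  have "ennreal ((cmod ((\<Sum>n\<le>N. c n * of_real (poisson_weight n x)) - f x))\<^sup>2) \<le> (\<Sum>n. ennreal (?q n * ?e n x))"
    if x: "0 \<le> x" for x
  proof -
    have tail: "(\<lambda>n. c (n + Suc N) * of_real (?e n x)) sums (f x - (\<Sum>n<Suc N. c n * of_real (poisson_weight n x)))"
      by (rule sums_split_initial_segment[OF f[OF x]])
    have "ennreal ((cmod (f x - (\<Sum>n<Suc N. c n * of_real (poisson_weight n x))))\<^sup>2) \<le> (\<Sum>n. ennreal (?q n * ?e n x))"
      by (intro cauchy_schwarz_weighted_suminf[OF _ _ tail] poisson_weight_nonneg sum_shifted_poisson_weight_le_1 x)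
    thus ?thesis by (simp only: norm_minus_commute lessThan_Suc_atMost)
  qed
  hence "sq_dist (\<lambda>x. \<Sum>n\<le>N. c n * of_real (poisson_weight n x)) f
      \<le> (\<integral>\<^sup>+x. (\<Sum>n. ennreal (?q n) * (ennreal (?e n x) * indicator {0..} x)) \<partial>lborel)"
    unfolding sq_dist_def by (intro nn_integral_mono) (auto simp: indicator_def ennreal_mult')
  also have "\<dots> = (\<Sum>n. \<integral>\<^sup>+x. ennreal (?q n) * (ennreal (?e n x) * indicator {0..} x) \<partial>lborel)"
    by (rule nn_integral_suminf) measurable
  also have "\<dots> = (\<Sum>n. ennreal (?q n))"
    by (simp add: nn_integral_cmult nn_integral_poisson_weight)
  also have "\<dots> = ennreal (\<Sum>n. ?q n)"
    using summable_ignore_initial_segment[OF c, of "Suc N"] by (intro suminf_ennreal2) simp_all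
  finally show ?thesis .
qed

lemma sq_dist_tendsto_0_if_square_summable:
  assumes k: "1 \<le> k" and summable: "summable (\<lambda>n. (norm (signed_ell k n))\<^sup>2)"
  shows "(\<lambda>N. sq_dist (phi_N N k) (phi k)) \<longlonglongrightarrow> 0"
proof (rule tendsto_sandwich[where f = "\<lambda>_. 0"])
  have "phi_N N k = (\<lambda>x. \<Sum>n\<le>N. signed_ell k n * of_real (poisson_weight n x))" for N
    by (simp add: fun_eq_iff phi_N_conv_poisson_weight)
  thus "\<forall>\<^sub>F N in sequentially. sq_dist (phi_N N k) (phi k) \<le> ennreal (\<Sum>n. (norm (signed_ell k (n + Suc N)))\<^sup>2)"
    using sq_dist_poisson_series_le[OF phi_sums_signed_ell[OF k] summable] by (intro always_eventually allI) (simp only:)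
  have "(\<lambda>N. \<Sum>n. (norm (signed_ell k (n + Suc N)))\<^sup>2) \<longlonglongrightarrow> 0"
    using LIMSEQ_Suc[OF suminf_exist_split2[OF summable]] by simp
  thus "(\<lambda>N. ennreal (\<Sum>n. (norm (signed_ell k (n + Suc N)))\<^sup>2)) \<longlonglongrightarrow> 0"
    using tendsto_ennrealI by fastforce
qed auto

section \<open>Square summability of the coefficients\<close>

lemma sin_ge_third:
  assumes "0 \<le> y" "y \<le> 2"
  shows "y / 3 \<le> sin (y::real)"
proof -
  have "(\<Sum>m<3. sin_coeff m * y ^ m) = y"
    by (simp add: eval_nat_numeral sin_coeff_def)
  hence "\<bar>sin y - y\<bar> \<le> inverse (fact 3) * \<bar>y\<bar> ^ 3"
    using Maclaurin_sin_bound[of y 3] by simp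
  also have "\<dots> = y * y\<^sup>2 / 6" using assms by (simp add: eval_nat_numeral)
  also have "\<dots> \<le> y * 2\<^sup>2 / 6" using assms by (intro divide_right_mono mult_left_mono power_mono) auto
  finally show ?thesis using abs_le_D2 by fastforce
qed

lemma norm_one_minus_cis_squared:
  "(norm (1 - of_real \<rho> * cis \<theta>))\<^sup>2 = (1 - \<rho>)\<^sup>2 + 4 * \<rho> * (sin (\<theta> / 2))\<^sup>2"
proof -
  have "(norm (1 - of_real \<rho> * cis \<theta>))\<^sup>2 = (1 - \<rho> * cos \<theta>)\<^sup>2 + (\<rho> * sin \<theta>)\<^sup>2"
    by (simp add: cmod_power2)
  also have "\<dots> = 1 - 2 * \<rho> * cos \<theta> + \<rho>\<^sup>2 * ((sin \<theta>)\<^sup>2 + (cos \<theta>)\<^sup>2)"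
    by algebra
  also have "\<dots> = 1 - 2 * \<rho> * cos \<theta> + \<rho>\<^sup>2" by (simp only: sin_cos_squared_add mult_1_right)
  also have "cos \<theta> = 1 - 2 * (sin (\<theta> / 2))\<^sup>2" using cos_double_sin[of "\<theta> / 2"] by simp
  finally show ?thesis by (simp add: power2_eq_square algebra_simps)
qed

lemma norm_one_minus_cis_ge:
  assumes "1/2 \<le> \<rho>" "\<bar>\<theta>\<bar> \<le> pi"
  shows "\<bar>\<theta>\<bar> / 5 \<le> norm (1 - of_real \<rho> * cis \<theta>)"
proof (rule power2_le_imp_le)
  have "\<bar>\<theta>\<bar> / 2 / 3 \<le> sin (\<bar>\<theta>\<bar> / 2)"
    using assms pi_half_less_two by (intro sin_ge_third) auto
  hence "(\<bar>\<theta>\<bar> / 6)\<^sup>2 \<le> (sin (\<bar>\<theta>\<bar> / 2))\<^sup>2" by (intro power_mono) auto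
  also have "(sin (\<bar>\<theta>\<bar> / 2))\<^sup>2 = (sin (\<theta> / 2))\<^sup>2" by (auto simp: abs_if)
  finally have "2 * (\<bar>\<theta>\<bar> / 6)\<^sup>2 \<le> 4 * \<rho> * (sin (\<theta> / 2))\<^sup>2"
    using assms by (intro mult_mono) auto
  moreover have "(\<bar>\<theta>\<bar> / 5)\<^sup>2 \<le> 2 * (\<bar>\<theta>\<bar> / 6)\<^sup>2"
    by (simp add: power_divide)
  moreover have "0 \<le> (1 - \<rho>)\<^sup>2" by simp
  ultimately show "(\<bar>\<theta>\<bar> / 5)\<^sup>2 \<le> (norm (1 - of_real \<rho> * cis \<theta>))\<^sup>2"
    unfolding norm_one_minus_cis_squared by linarith
qed simp

lemma has_integral_cis_int:
  "((\<lambda>\<theta>. cis (of_int m * \<theta>)) has_integral (if m = 0 then 2 * of_real pi else 0)) {- pi..pi}"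
proof (cases "m = 0")
  case True
  thus ?thesis using has_integral_const_real[of "1::complex" "- pi" pi] by (simp add: scaleR_conv_of_real)
next
  case False
  let ?F = "\<lambda>\<theta>. exp (\<i> * of_int m * of_real \<theta>) / (\<i> * of_int m)"
  have "((\<lambda>\<theta>. exp (\<i> * of_int m * of_real \<theta>)) has_integral (?F pi - ?F (- pi))) {- pi..pi}"
  proof (rule fundamental_theorem_of_calculus)
    fix \<theta> :: real
    have "((\<lambda>\<theta>. \<i> * of_int m * complex_of_real \<theta>) has_vector_derivative (\<i> * of_int m * of_real 1)) (at \<theta> within {- pi..pi})"
      by (intro has_vector_derivative_mult_right has_vector_derivative_of_real DERIV_ident)
    moreover have "((\<lambda>z. exp z / (\<i> * of_int m)) has_field_derivative exp y / (\<i> * of_int m)) (at y within S)" for y S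
      using False by (auto intro!: derivative_eq_intros)
    ultimately show "(?F has_vector_derivative exp (\<i> * of_int m * of_real \<theta>)) (at \<theta> within {- pi..pi})"
      using field_vector_diff_chain_within False by (fastforce simp: o_def)
  qed simp
  moreover have "exp (\<i> * of_int m * of_real \<theta>) = cis (of_int m * \<theta>)" for \<theta>
    by (simp add: cis_conv_exp mult_ac)
  ultimately have "((\<lambda>\<theta>. cis (of_int m * \<theta>)) has_integral
      (cis (of_int m * pi) / (\<i> * of_int m) - cis (of_int m * (- pi)) / (\<i> * of_int m))) {- pi..pi}"
    by (simp only:)
  moreover have "cis (of_int m * (- pi)) = cis (of_int m * pi)"
    using sin_npi_int[of m] by (simp add: complex_eq_iff mult.commute)
  ultimately show ?thesis using False by (simp only: diff_self if_False)
qed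

lemma parseval_trig_polynomial:
  fixes a :: "nat \<Rightarrow> complex"
  shows "((\<lambda>\<theta>. (norm (\<Sum>n\<le>M. a n * cis (real n * \<theta>)))\<^sup>2) has_integral (2 * pi * (\<Sum>n\<le>M. (norm (a n))\<^sup>2))) {- pi..pi}"
proof -
  let ?S = "\<lambda>\<theta>. \<Sum>n\<le>M. a n * cis (real n * \<theta>)"
  let ?I = "\<lambda>n m. if int n - int m = 0 then 2 * of_real pi else 0 :: complex"
  have norm_square: "complex_of_real ((norm (?S \<theta>))\<^sup>2) = (\<Sum>n\<le>M. \<Sum>m\<le>M. a n * cnj (a m) * cis (of_int (int n - int m) * \<theta>))" for \<theta>
  proof -
    have "complex_of_real ((norm (?S \<theta>))\<^sup>2) = (?S \<theta>) * cnj (\<Sum>m\<le>M. a m * cis (real m * \<theta>))"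
      by (rule complex_norm_square)
    also have "\<dots> = (\<Sum>n\<le>M. \<Sum>m\<le>M. a n * cnj (a m) * (cis (real n * \<theta>) * cis (- (real m * \<theta>))))"
      by (simp add: sum_product cis_cnj mult_ac)
    also have "\<dots> = (\<Sum>n\<le>M. \<Sum>m\<le>M. a n * cnj (a m) * cis (of_int (int n - int m) * \<theta>))"
      unfolding cis_mult by (simp add: algebra_simps)
    finally show ?thesis .
  qed
  have "((\<lambda>\<theta>. complex_of_real ((norm (?S \<theta>))\<^sup>2)) has_integral (\<Sum>n\<le>M. \<Sum>m\<le>M. a n * cnj (a m) * ?I n m)) {- pi..pi}"
    unfolding norm_square by (intro has_integral_sum has_integral_mult_right has_integral_cis_int) auto
  also have "(\<Sum>n\<le>M. \<Sum>m\<le>M. a n * cnj (a m) * ?I n m) = of_real (2 * pi * (\<Sum>n\<le>M. (norm (a n))\<^sup>2))"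
  proof -
    have "(\<Sum>m\<le>M. a n * cnj (a m) * ?I n m) = of_real (2 * pi * (norm (a n))\<^sup>2)" if "n \<le> M" for n
    proof -
      have "(\<Sum>m\<le>M. a n * cnj (a m) * ?I n m) = (\<Sum>m\<le>M. if m = n then a n * cnj (a m) * (2 * of_real pi) else 0)"
        by (intro sum.cong) auto
      also have "\<dots> = a n * cnj (a n) * (2 * of_real pi)" using that by simp
      also have "\<dots> = of_real (2 * pi * (norm (a n))\<^sup>2)" unfolding complex_norm_square[symmetric] by simp
      finally show ?thesis .
    qed
    thus ?thesis by (simp add: sum_distrib_left)
  qed
  finally have "((\<lambda>\<theta>. complex_of_real ((norm (?S \<theta>))\<^sup>2)) has_integral of_real (2 * pi * (\<Sum>n\<le>M. (norm (a n))\<^sup>2))) {- pi..pi}" .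
  from has_integral_linear[OF this bounded_linear_Re] show ?thesis
    by (simp only: o_def Re_complex_of_real)
qed

lemma power_series_uniform_partial_sum:
  fixes c :: "nat \<Rightarrow> complex"
  assumes h: "\<And>z. norm z < 1 \<Longrightarrow> (\<lambda>n. c n * z ^ n) sums h z" and \<rho>: "0 \<le> \<rho>" "\<rho> < 1"
  obtains M where "N \<le> M" "\<And>z. norm z = \<rho> \<Longrightarrow> norm ((\<Sum>n\<le>M. c n * z ^ n) - h z) \<le> 1"
proof -
  obtain q where q: "\<rho> < q" "q < 1" using dense \<rho>(2) by blast
  have "summable (\<lambda>n. c n * of_real q ^ n)"
    using h[of "of_real q"] q \<rho> by (intro sums_summable[of _ "h (of_real q)"]) auto
  hence "summable (\<lambda>n. norm (c n * of_real \<rho> ^ n))"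
    by (rule powser_insidea) (use \<rho> q in auto)
  hence abs_summable: "summable (\<lambda>n. norm (c n) * \<rho> ^ n)" using \<rho> by (simp add: norm_mult norm_power)
  obtain M0 where M0: "\<And>n. M0 \<le> n \<Longrightarrow> norm (\<Sum>i. norm (c (i + n)) * \<rho> ^ (i + n)) < 1"
    using suminf_exist_split[OF zero_less_one abs_summable] by blast
  define M where "M = max M0 N"
  have "norm ((\<Sum>n\<le>M. c n * z ^ n) - h z) \<le> 1" if z: "norm z = \<rho>" for z
  proof -
    have "(\<lambda>n. c (n + Suc M) * z ^ (n + Suc M)) sums (h z - (\<Sum>n<Suc M. c n * z ^ n))"
      using z \<rho> by (intro sums_split_initial_segment h) simp
    hence "norm (h z - (\<Sum>n<Suc M. c n * z ^ n)) = norm (\<Sum>n. c (n + Suc M) * z ^ (n + Suc M))"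
      by (simp only: sums_iff)
    also have "\<dots> \<le> (\<Sum>n. norm (c (n + Suc M)) * \<rho> ^ (n + Suc M))"
      by (intro norm_suminf_le summable_ignore_initial_segment[OF abs_summable]) (simp only: norm_mult norm_power z)
    also have "\<dots> \<le> norm (\<Sum>n. norm (c (n + Suc M)) * \<rho> ^ (n + Suc M))"
      unfolding real_norm_def by (rule abs_ge_self)
    also have "\<dots> < 1" by (rule M0) (simp add: M_def)
    finally show ?thesis by (simp only: norm_minus_commute lessThan_Suc_atMost less_imp_le)
  qed
  thus thesis by (intro that[of M]) (auto simp: M_def)
qed

lemma sum_square_coeffs_le_circle_integral:
  fixes c :: "nat \<Rightarrow> complex"
  assumes h: "\<And>z. norm z < 1 \<Longrightarrow> (\<lambda>n. c n * z ^ n) sums h z" and \<rho>: "0 \<le> \<rho>" "\<rho> < 1"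
    and b: "(b has_integral B) {- pi..pi}"
    and h_le: "\<And>\<theta>. \<theta> \<in> {- pi..pi} \<Longrightarrow> \<theta> \<noteq> 0 \<Longrightarrow> (norm (h (of_real \<rho> * cis \<theta>)))\<^sup>2 \<le> b \<theta>"
  shows "2 * pi * (\<Sum>n\<le>N. (norm (c n))\<^sup>2 * (\<rho>\<^sup>2) ^ n) \<le> 2 * B + 4 * pi"
proof -
  obtain M where M: "N \<le> M" "\<And>z. norm z = \<rho> \<Longrightarrow> norm ((\<Sum>n\<le>M. c n * z ^ n) - h z) \<le> 1"
    using h \<rho> by (rule power_series_uniform_partial_sum[where N = N]) blast+
  let ?z = "\<lambda>\<theta>. of_real \<rho> * cis \<theta>" and ?T = "\<lambda>\<theta>. \<Sum>n\<le>M. (c n * of_real (\<rho> ^ n)) * cis (real n * \<theta>)"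
  have T_le: "(norm (?T \<theta>))\<^sup>2 \<le> 2 * b \<theta> + 2" if \<theta>: "\<theta> \<in> {- pi..pi}" "\<theta> \<noteq> 0" for \<theta>
  proof -
    have "?T \<theta> = (\<Sum>n\<le>M. c n * ?z \<theta> ^ n)"
      by (simp add: power_mult_distrib Complex.DeMoivre mult.assoc)
    hence "norm (?T \<theta> - h (?z \<theta>)) \<le> 1" using M(2)[of "?z \<theta>"] \<rho> by (simp add: norm_mult)
    hence "norm (?T \<theta>) \<le> norm (h (?z \<theta>)) + 1"
      using norm_triangle_ineq[of "?T \<theta> - h (?z \<theta>)" "h (?z \<theta>)"] by simp
    hence "(norm (?T \<theta>))\<^sup>2 \<le> (norm (h (?z \<theta>)) + 1)\<^sup>2" by (intro power_mono) auto
    also have "\<dots> \<le> 2 * (norm (h (?z \<theta>)))\<^sup>2 + 2"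
      using zero_le_power2[of "norm (h (?z \<theta>)) - 1"] by (simp add: power2_eq_square algebra_simps)
    finally show ?thesis using h_le[OF \<theta>] by linarith
  qed
  have "((\<lambda>\<theta>. 2 * b \<theta> + 2) has_integral (2 * B + 4 * pi)) {- pi..pi}"
    using has_integral_add[OF has_integral_mult_right[OF b, of 2] has_integral_const_real[of "2::real" "- pi" pi]] by simp
  hence "((\<lambda>\<theta>. if \<theta> = 0 then (norm (?T 0))\<^sup>2 else 2 * b \<theta> + 2) has_integral (2 * B + 4 * pi)) {- pi..pi}"
    by (rule has_integral_spike_finite[of "{0}", rotated 2]) auto
  with parseval_trig_polynomial[of "\<lambda>n. c n * of_real (\<rho> ^ n)" M]
  have "2 * pi * (\<Sum>n\<le>M. (norm (c n * of_real (\<rho> ^ n)))\<^sup>2) \<le> 2 * B + 4 * pi"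
    by (rule has_integral_le) (use T_le in auto)
  moreover have "(norm (c n * of_real (\<rho> ^ n)))\<^sup>2 = (norm (c n))\<^sup>2 * (\<rho>\<^sup>2) ^ n" for n
    using \<rho> by (simp add: norm_mult norm_power power_mult_distrib power_mult[symmetric] mult.commute abs_of_nonneg)
  ultimately have "2 * pi * (\<Sum>n\<le>M. (norm (c n))\<^sup>2 * (\<rho>\<^sup>2) ^ n) \<le> 2 * B + 4 * pi"
    by (simp only:)
  moreover have "2 * pi * (\<Sum>n\<le>N. (norm (c n))\<^sup>2 * (\<rho>\<^sup>2) ^ n) \<le> 2 * pi * (\<Sum>n\<le>M. (norm (c n))\<^sup>2 * (\<rho>\<^sup>2) ^ n)"
    using M(1) by (intro mult_left_mono sum_mono2) auto
  ultimately show ?thesis by linarith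
qed

lemma hardy_square_summable:
  fixes c :: "nat \<Rightarrow> complex"
  assumes h: "\<And>z. norm z < 1 \<Longrightarrow> (\<lambda>n. c n * z ^ n) sums h z"
    and b: "(b has_integral B) {- pi..pi}"
    and h_le: "\<And>\<rho> \<theta>. 1/2 \<le> \<rho> \<Longrightarrow> \<rho> < 1 \<Longrightarrow> \<theta> \<in> {- pi..pi} \<Longrightarrow> \<theta> \<noteq> 0 \<Longrightarrow> (norm (h (of_real \<rho> * cis \<theta>)))\<^sup>2 \<le> b \<theta>"
  shows "summable (\<lambda>n. (norm (c n))\<^sup>2)"
proof (rule summableI_nonneg_bounded)
  fix N
  have "2 * pi * (\<Sum>n\<le>N. (norm (c n))\<^sup>2) \<le> 2 * B + 4 * pi"
  proof (rule LIMSEQ_le_const2)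
    define \<rho> where "\<rho> j = 1 - inverse (real (Suc (Suc j)))" for j
    have "\<rho> \<longlonglongrightarrow> 1 - 0" unfolding \<rho>_def
      by (intro tendsto_diff tendsto_const LIMSEQ_Suc[OF LIMSEQ_inverse_real_of_nat])
    hence "(\<lambda>j. 2 * pi * (\<Sum>n\<le>N. (norm (c n))\<^sup>2 * ((\<rho> j)\<^sup>2) ^ n)) \<longlonglongrightarrow> 2 * pi * (\<Sum>n\<le>N. (norm (c n))\<^sup>2 * ((1 - 0)\<^sup>2) ^ n)"
      by (intro tendsto_intros)
    thus "(\<lambda>j. 2 * pi * (\<Sum>n\<le>N. (norm (c n))\<^sup>2 * ((\<rho> j)\<^sup>2) ^ n)) \<longlonglongrightarrow> 2 * pi * (\<Sum>n\<le>N. (norm (c n))\<^sup>2)"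
      by simp
    have \<rho>: "1/2 \<le> \<rho> j" "\<rho> j < 1" for j by (auto simp: \<rho>_def field_simps)
    have "2 * pi * (\<Sum>n\<le>N. (norm (c n))\<^sup>2 * ((\<rho> j)\<^sup>2) ^ n) \<le> 2 * B + 4 * pi" for j
      using \<rho>[of j] by (intro sum_square_coeffs_le_circle_integral[OF h _ _ b h_le]) auto
    thus "\<exists>M. \<forall>j\<ge>M. 2 * pi * (\<Sum>n\<le>N. (norm (c n))\<^sup>2 * ((\<rho> j)\<^sup>2) ^ n) \<le> 2 * B + 4 * pi"
      by blast
  qed
  hence "(\<Sum>n\<le>N. (norm (c n))\<^sup>2) \<le> (2 * B + 4 * pi) / (2 * pi)" by (simp add: field_simps)
  moreover have "(\<Sum>n<N. (norm (c n))\<^sup>2) \<le> (\<Sum>n\<le>N. (norm (c n))\<^sup>2)"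
    by (intro sum_mono2) auto
  ultimately show "(\<Sum>n<N. (norm (c n))\<^sup>2) \<le> (2 * B + 4 * pi) / (2 * pi)" by linarith
qed simp

lemma has_integral_abs_powr:
  fixes a c :: real
  assumes "- 1 < a" "0 \<le> c"
  shows "((\<lambda>x. \<bar>x\<bar> powr a) has_integral 2 * (c powr (a + 1) / (a + 1))) {- c..c}"
proof -
  have right: "((\<lambda>x. x powr a) has_integral c powr (a + 1) / (a + 1)) {0..c}"
    using has_integral_powr_from_0[OF assms] .
  hence left: "((\<lambda>x. (- x) powr a) has_integral c powr (a + 1) / (a + 1)) {- c..- 0}"
    by (subst has_integral_reflect_real)
  have "((\<lambda>x. \<bar>x\<bar> powr a) has_integral c powr (a + 1) / (a + 1)) {0..c}"
    by (rule has_integral_eq[OF _ right]) auto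
  moreover have "((\<lambda>x. \<bar>x\<bar> powr a) has_integral c powr (a + 1) / (a + 1)) {- c..0}"
    by (rule has_integral_eq[OF _ left[simplified]]) auto
  ultimately have "((\<lambda>x. \<bar>x\<bar> powr a) has_integral c powr (a + 1) / (a + 1) + c powr (a + 1) / (a + 1)) {- c..c}"
    using assms by (intro has_integral_combine[of "- c" 0 c]) auto
  thus ?thesis by simp
qed

lemma square_summable_if_powr_singularity:
  fixes c :: "nat \<Rightarrow> complex"
  assumes h: "\<And>z. norm z < 1 \<Longrightarrow> (\<lambda>n. c n * z ^ n) sums h z" and a: "0 \<le> a" "a < 1/2"
    and h_le: "\<And>z. norm z < 1 \<Longrightarrow> norm (h z) \<le> C * norm (1 - z) powr (- a)"
  shows "summable (\<lambda>n. (norm (c n))\<^sup>2)"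
proof (rule hardy_square_summable[OF h])
  show "((\<lambda>\<theta>. C\<^sup>2 * 5 powr (2 * a) * \<bar>\<theta>\<bar> powr (- 2 * a)) has_integral
      C\<^sup>2 * 5 powr (2 * a) * (2 * (pi powr (- 2 * a + 1) / (- 2 * a + 1)))) {- pi..pi}"
    using a by (intro has_integral_mult_right has_integral_abs_powr) auto
  fix \<rho> \<theta> :: real assume \<rho>: "1/2 \<le> \<rho>" "\<rho> < 1" and \<theta>: "\<theta> \<in> {- pi..pi}" "\<theta> \<noteq> 0"
  let ?z = "of_real \<rho> * cis \<theta>"
  have dist_ge: "\<bar>\<theta>\<bar> / 5 \<le> norm (1 - ?z)"
    using \<rho> \<theta> by (intro norm_one_minus_cis_ge) auto
  have "(norm (h ?z))\<^sup>2 \<le> (C * norm (1 - ?z) powr (- a))\<^sup>2"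
    using \<rho> by (intro power_mono h_le) (auto simp: norm_mult)
  also have "\<dots> = C\<^sup>2 * norm (1 - ?z) powr (- 2 * a)"
    by (simp add: power_mult_distrib) (simp add: power2_eq_square powr_add[symmetric])
  also have "\<dots> \<le> C\<^sup>2 * (\<bar>\<theta>\<bar> / 5) powr (- 2 * a)"
    using dist_ge \<theta> a by (intro mult_left_mono powr_mono2') auto
  also have "(\<bar>\<theta>\<bar> / 5) powr (- 2 * a) = 5 powr (2 * a) * \<bar>\<theta>\<bar> powr (- 2 * a)"
    using powr_minus_divide[of "5::real" "2 * a"] by (simp add: powr_divide)
  finally show "(norm (h ?z))\<^sup>2 \<le> C\<^sup>2 * 5 powr (2 * a) * \<bar>\<theta>\<bar> powr (- 2 * a)"
    by (simp add: mult.assoc)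
qed

lemma norm_le_powr_if_vertical_growth:
  assumes cont: "continuous_on UNIV f" and a: "0 < a" and \<mu>: "0 \<le> \<mu>"
    and growth: "vertical_growth f {a..} (\<lambda>_. \<mu>)" and right: "bounded (f ` {s. b \<le> Re s})"
  obtains C where "\<And>s. a \<le> Re s \<Longrightarrow> norm (f s) \<le> C * norm s powr \<mu>"
proof -
  obtain K where K: "1 \<le> K" "\<And>s. a \<le> Re s \<Longrightarrow> 1 \<le> \<bar>Im s\<bar> \<Longrightarrow> norm (f s) \<le> K * \<bar>Im s\<bar> powr \<mu>"
    using growth by (rule vertical_growthE) auto
  have "compact (f ` cbox (Complex a (- 1)) (Complex b 1))"
    using cont by (intro compact_continuous_image) (auto intro: continuous_on_subset)
  hence "bounded (f ` cbox (Complex a (- 1)) (Complex b 1) \<union> f ` {s. b \<le> Re s})"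
    using right by (auto dest: compact_imp_bounded)
  then obtain B where B: "0 < B" "\<And>s. s \<in> cbox (Complex a (- 1)) (Complex b 1) \<or> b \<le> Re s \<Longrightarrow> norm (f s) \<le> B"
    unfolding bounded_pos by blast
  have "norm (f s) \<le> (K + B * a powr (- \<mu>)) * norm s powr \<mu>" if s: "a \<le> Re s" for s
  proof (cases "1 \<le> \<bar>Im s\<bar>")
    case True
    have "norm (f s) \<le> K * \<bar>Im s\<bar> powr \<mu>" using K(2)[OF s True] .
    also have "\<dots> \<le> K * norm s powr \<mu>"
      using K(1) \<mu> abs_Im_le_cmod by (intro mult_left_mono powr_mono2) auto
    also have "\<dots> \<le> (K + B * a powr (- \<mu>)) * norm s powr \<mu>" using B(1) by (intro mult_right_mono) auto
    finally show ?thesis .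
  next
    case False
    hence "norm (f s) \<le> B" using s by (intro B(2)) (auto simp: in_cbox_complex_iff)
    also have "\<dots> = B * a powr (- \<mu>) * a powr \<mu>" using a by (simp add: mult.assoc powr_add[symmetric])
    also have "\<dots> \<le> B * a powr (- \<mu>) * norm s powr \<mu>"
      using a \<mu> B(1) s complex_Re_le_cmod[of s] by (intro mult_left_mono powr_mono2) auto
    also have "\<dots> \<le> (K + B * a powr (- \<mu>)) * norm s powr \<mu>" using K(1) by (intro mult_right_mono) auto
    finally show ?thesis .
  qed
  thus thesis by (rule that)
qed

lemma bounded_zeta_pow_remainder_right: "bounded (zeta_pow_remainder k ` {s. 2 \<le> Re s})"
proof -
  obtain A where A: "\<And>s. 1 \<le> norm (s - 1) \<Longrightarrow> norm (zeta s ^ k - zeta_pow_remainder k s) \<le> A"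
    using bounded_zeta_pow_diff_remainder[of k] unfolding bounded_iff by auto
  have "norm (zeta_pow_remainder k s) \<le> real_zeta 2 ^ k + A" if s: "2 \<le> Re s" for s
  proof -
    have "norm (zeta_pow_remainder k s) \<le> norm (zeta s ^ k) + norm (zeta s ^ k - zeta_pow_remainder k s)"
      using norm_triangle_ineq4[of "zeta s ^ k" "zeta s ^ k - zeta_pow_remainder k s"] by simp
    moreover have "norm (zeta s ^ k) \<le> real_zeta 2 ^ k"
      unfolding norm_power using s by (intro power_mono norm_zeta_le_real_zeta) auto
    moreover have "1 \<le> norm (s - 1)" using s complex_Re_le_cmod[of "s - 1"] by simp
    ultimately show ?thesis using A[of s] by linarith
  qed
  thus ?thesis unfolding bounded_iff by auto
qed

lemma Re_inverse_one_minus_ge: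
  assumes "norm z < 1"
  shows "1/2 \<le> Re (1 / (1 - z))"
proof -
  have "(norm (1 - z))\<^sup>2 = 1 - 2 * Re z + (norm z)\<^sup>2"
    by (simp add: cmod_power2) (simp add: power2_eq_square algebra_simps)
  also have "\<dots> \<le> 2 * (1 - Re z)" using assms by (simp add: power2_eq_square mult_le_one)
  finally have "(norm (1 - z))\<^sup>2 \<le> 2 * (1 - Re z)" .
  moreover have "Re (1 / (1 - z)) = (1 - Re z) / (norm (1 - z))\<^sup>2"
    by (simp add: Re_divide cmod_power2)
  moreover have "0 < (norm (1 - z))\<^sup>2" using assms by auto
  ultimately show ?thesis by (simp only: pos_le_divide_eq) simp
qed

lemma signed_ell_square_summable:
  assumes LH: "lindelof_hypothesis" and k: "1 \<le> k"
  shows "summable (\<lambda>n. (norm (signed_ell k n))\<^sup>2)"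
proof -
  have "vertical_growth zeta {1/2..} (\<lambda>_. 1 / (4 * real k))"
    using LH k by (intro lindelof_half_plane) auto
  hence "vertical_growth (\<lambda>s. zeta s ^ k) {1/2..} (\<lambda>_. 1/4)"
    using vertical_growth_power_iff[OF k, where \<mu> = "\<lambda>_. 1 / (4 * real k)"] k by simp
  hence growth: "vertical_growth (zeta_pow_remainder k) {1/2..} (\<lambda>_. 1/4)"
    by (simp add: vertical_growth_zeta_pow_remainder_iff)
  have "continuous_on UNIV (zeta_pow_remainder k)"
    by (intro holomorphic_on_imp_continuous_on zeta_pow_remainder_holomorphic k)
  then obtain C where C: "\<And>s. 1/2 \<le> Re s \<Longrightarrow> norm (zeta_pow_remainder k s) \<le> C * norm s powr (1/4)"
    by (rule norm_le_powr_if_vertical_growth[OF _ _ _ growth bounded_zeta_pow_remainder_right]) auto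
  show ?thesis
  proof (rule square_summable_if_powr_singularity[OF zeta_pow_remainder_sums[OF k], where a = "1/4"])
    fix z :: complex assume "norm z < 1"
    from C[OF Re_inverse_one_minus_ge[OF this]]
    show "norm (zeta_pow_remainder k (1 / (1 - z))) \<le> C * norm (1 - z) powr (- (1/4))"
      using powr_minus_divide[of "norm (1 - z)" "1/4"] by (simp add: norm_divide powr_divide)
  qed auto
qed

theorem theorem4:
  shows "lindelof_hypothesis \<longleftrightarrow>
    (\<forall>k::nat. k \<ge> 1 \<longrightarrow>
       ((\<lambda>N. \<integral>\<^sup>+ x\<in>{0..}. ennreal ((cmod (phi_N N k x - phi k x))\<^sup>2) \<partial>lborel) \<longlonglongrightarrow> 0))"
  unfolding sq_dist_def[symmetric]
proof
  assume "lindelof_hypothesis"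
  thus "\<forall>k\<ge>1. (\<lambda>N. sq_dist (phi_N N k) (phi k)) \<longlonglongrightarrow> 0"
    by (intro allI impI sq_dist_tendsto_0_if_square_summable signed_ell_square_summable)
next
  assume "\<forall>k\<ge>1. (\<lambda>N. sq_dist (phi_N N k) (phi k)) \<longlonglongrightarrow> 0"
  thus "lindelof_hypothesis" by (intro lindelof_if_sq_dist_tendsto_0) blast
qed

end
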